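(* Let $K$ be a number field and let $\phi \in K(z)$ be a rational function of degree $d \geq 2$. Define $S_0$ to be the set of rational primes $$S_0 = \{2\} \cup \left\{p \text{ odd prime}: \tfrac{p - 1}{2} \,\Big|\, [K : \mathbb{Q}] \ \text{ and } \ p \mid d(d^2 - 1) \right\},$$ and let $S$ be the (finite) set of places of $K$ of bad reduction for $\phi$ along with the places that divide a prime in $S_0$. Then $\mathrm{red}_v: \mathrm{Aut}_{\phi}(K) \to \mathrm{Aut}_{\phi}(\mathbb{F}_v)$ is a well-defined injective homomorphism for all finite places $v$ of $K$ outside $S$.
   Context: For a finite place $v$ of $K$, $K_v$ is the completion and $\mathbb{F}_v$ the residue field. The function $\phi$ has good reduction at $v$ if the induced endomorphism of $\mathbb{P}^1_{K_v}$ extends to a morphism of $\mathbb{P}^1$ over the valuation ring of $K_v$ (equivalently, one can reduce the coefficients of $\phi$ modulo $v$ and the resulting endomorphism of $\mathbb{P}^1_{\mathbb{F}_v}$ has the same degree as $\phi$); otherwise it has bad reduction at $v$. $\mathrm{Aut}_\phi(K)=\{f\in\mathrm{PGL}_2(K): f\circ\phi\circ f^{-1}=\phi\}$, and for $v$ of good reduction $\mathrm{Aut}_\phi(\mathbb{F}_v)$ is the group of $f\in\mathrm{PGL}_2(\mathbb{F}_v)$ with $f\circ\phi_v\circ f^{-1}=\phi_v$, where $\phi_v$ is the reduction of $\phi$ at $v$. The map $\mathrm{red}_v$ sends an automorphism to its reduction modulo $v$; its being well defined includes the assertion that each element of $\mathrm{Aut}_\phi(K)$ has good reduction at $v$. 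*)

theory Defs
  imports "HOL-Algebra.Algebra" "HOL-Algebra.Algebraic_Closure_Type"
begin

text \<open>
  The residue field of a place depends on the place and is therefore a ring record,
  not a type.  So that the same notions apply to a number field and to its residue fields, rational
  functions and \<open>PGL\<^sub>2\<close> are defined over arbitrary ring records.
\<close>

section \<open>Rational functions over a field\<close>

definition lowest_terms ::
  "('a, 'm) ring_scheme \<Rightarrow> (nat \<Rightarrow> 'a) \<Rightarrow> (nat \<Rightarrow> 'a) \<Rightarrow> bool" where
  "lowest_terms R P Q \<longleftrightarrow> P \<in> carrier (UP R) \<and> Q \<in> carrier (UP R) \<and>
     (\<forall>H \<in> carrier (UP R). H divides\<^bsub>UP R\<^esub> P \<and> H divides\<^bsub>UP R\<^esub> Q \<longrightarrow> H \<in> Units (UP R))"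

text \<open>
  For \<open>(P, Q) \<noteq> (0, 0)\<close>, the morphism \<open>[P : Q]\<close> from the projective line to itself is
  represented by the set of all its lowest-terms representatives, which differ only by nonzero
  constants.  Thus \<open>rat_frac R P Q\<close> is the fraction \<open>P / Q\<close>, and \<open>Q = 0\<close> gives the
  constant \<open>\<infinity>\<close>.
\<close>

type_synonym 'a ratfun = "((nat \<Rightarrow> 'a) \<times> (nat \<Rightarrow> 'a)) set"

definition rat_frac ::
  "('a, 'm) ring_scheme \<Rightarrow> (nat \<Rightarrow> 'a) \<Rightarrow> (nat \<Rightarrow> 'a) \<Rightarrow> 'a ratfun" where
  "rat_frac R P Q = {(P', Q'). lowest_terms R P' Q' \<and> P \<otimes>\<^bsub>UP R\<^esub> Q' = P' \<otimes>\<^bsub>UP R\<^esub> Q}"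

definition rat_functions :: "('a, 'm) ring_scheme \<Rightarrow> 'a ratfun set" where
  "rat_functions R =
     {rat_frac R P Q | P Q. P \<in> carrier (UP R) \<and> Q \<in> carrier (UP R) \<and> Q \<noteq> \<zero>\<^bsub>UP R\<^esub>}"

definition rat_degree :: "('a, 'm) ring_scheme \<Rightarrow> 'a ratfun \<Rightarrow> nat" where
  "rat_degree R \<phi> = the_elem ((\<lambda>(P, Q). max (deg R P) (deg R Q)) ` \<phi>)"

text \<open>
  \<open>hom_subst R n A P Q\<close> is \<open>\<Sum>i\<le>n. A\<^sub>i P\<^sup>i Q\<^sup>n\<^sup>-\<^sup>i\<close>, the value at \<open>(P, Q)\<close> of the degree \<open>n\<close>
  homogenization of \<open>A\<close>.
\<close>

definition hom_subst ::
  "('a, 'm) ring_scheme \<Rightarrow> nat \<Rightarrow> (nat \<Rightarrow> 'a) \<Rightarrow> (nat \<Rightarrow> 'a) \<Rightarrow> (nat \<Rightarrow> 'a) \<Rightarrow> (nat \<Rightarrow> 'a)" where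
  "hom_subst R n A P Q =
     (\<Oplus>\<^bsub>UP R\<^esub> i\<in>{..n}. up_ring.coeff (UP R) A i \<odot>\<^bsub>UP R\<^esub>
        (P [^]\<^bsub>UP R\<^esub> i \<otimes>\<^bsub>UP R\<^esub> Q [^]\<^bsub>UP R\<^esub> (n - i)))"

text \<open>
  Here and below, operations on classes are unions over representatives: the members of the union
  all coincide when the operation is independent of the representatives.
\<close>

definition rat_comp ::
  "('a, 'm) ring_scheme \<Rightarrow> 'a ratfun \<Rightarrow> 'a ratfun \<Rightarrow> 'a ratfun" where
  "rat_comp R \<phi> \<psi> =
     (\<Union>(A, B)\<in>\<phi>. \<Union>(P, Q)\<in>\<psi>.
        let n = max (deg R A) (deg R B)
        in rat_frac R (hom_subst R n A P Q) (hom_subst R n B P Q))"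


section \<open>\<open>PGL\<^sub>2\<close> and automorphism groups\<close>

text \<open>The tuple \<open>(a, b, c, d)\<close> is the matrix with rows \<open>(a, b)\<close> and \<open>(c, d)\<close>.\<close>

type_synonym 'a mat2 = "'a \<times> 'a \<times> 'a \<times> 'a"

definition GL2 :: "('a, 'm) ring_scheme \<Rightarrow> 'a mat2 monoid" where
  "GL2 R = \<lparr>
     carrier = {(a, b, c, d). a \<in> carrier R \<and> b \<in> carrier R \<and> c \<in> carrier R \<and> d \<in> carrier R \<and>
                  a \<otimes>\<^bsub>R\<^esub> d \<ominus>\<^bsub>R\<^esub> b \<otimes>\<^bsub>R\<^esub> c \<in> Units R},
     monoid.mult = (\<lambda>(a, b, c, d) (a', b', c', d').
       (a \<otimes>\<^bsub>R\<^esub> a' \<oplus>\<^bsub>R\<^esub> b \<otimes>\<^bsub>R\<^esub> c', a \<otimes>\<^bsub>R\<^esub> b' \<oplus>\<^bsub>R\<^esub> b \<otimes>\<^bsub>R\<^esub> d',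
        c \<otimes>\<^bsub>R\<^esub> a' \<oplus>\<^bsub>R\<^esub> d \<otimes>\<^bsub>R\<^esub> c', c \<otimes>\<^bsub>R\<^esub> b' \<oplus>\<^bsub>R\<^esub> d \<otimes>\<^bsub>R\<^esub> d')),
     one = (\<one>\<^bsub>R\<^esub>, \<zero>\<^bsub>R\<^esub>, \<zero>\<^bsub>R\<^esub>, \<one>\<^bsub>R\<^esub>)\<rparr>"

definition scalar_mats :: "('a, 'm) ring_scheme \<Rightarrow> 'a mat2 set" where
  "scalar_mats R = {(u, \<zero>\<^bsub>R\<^esub>, \<zero>\<^bsub>R\<^esub>, u) | u. u \<in> Units R}"

definition PGL2 :: "('a, 'm) ring_scheme \<Rightarrow> 'a mat2 set monoid" where
  "PGL2 R = GL2 R Mod scalar_mats R"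

definition lin_poly :: "('a, 'm) ring_scheme \<Rightarrow> 'a \<Rightarrow> 'a \<Rightarrow> (nat \<Rightarrow> 'a)" where
  "lin_poly R a b = up_ring.monom (UP R) a 1 \<oplus>\<^bsub>UP R\<^esub> up_ring.monom (UP R) b 0"

text \<open>The endomorphism \<open>(a z + b) / (c z + d)\<close> of the projective line.\<close>

definition moebius :: "('a, 'm) ring_scheme \<Rightarrow> 'a mat2 set \<Rightarrow> 'a ratfun" where
  "moebius R f = (\<Union>(a, b, c, d)\<in>f. rat_frac R (lin_poly R a b) (lin_poly R c d))"

definition Aut_rat :: "('a, 'm) ring_scheme \<Rightarrow> 'a ratfun \<Rightarrow> 'a mat2 set monoid" where
  "Aut_rat R \<phi> = (PGL2 R)\<lparr>carrier :=
     {f \<in> carrier (PGL2 R).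
        rat_comp R (rat_comp R (moebius R f) \<phi>) (moebius R (inv\<^bsub>PGL2 R\<^esub> f)) = \<phi>}\<rparr>"


section \<open>Number fields, finite places and reduction\<close>

definition number_field :: "'k::field_char_0 itself \<Rightarrow> bool" where
  "number_field _ \<longleftrightarrow>
     (\<exists>B. finite B \<and> module.span (\<lambda>q x. of_rat q * x) B = (UNIV :: 'k set))"

definition degree_over_rat :: "'k::field_char_0 itself \<Rightarrow> nat" where
  "degree_over_rat _ = vector_space.dim (\<lambda>q x. of_rat q * x) (UNIV :: 'k set)"

text \<open>
  A finite place is given by a representing nontrivial non-archimedean absolute value \<open>v\<close>.
  Everything below depends only on the sets \<open>{x. v x \<le> 1}\<close> and \<open>{x. v x < 1}\<close>, hence only on
  the place.
\<close>

definition finite_place :: "('k::field \<Rightarrow> real) \<Rightarrow> bool" where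
  "finite_place v \<longleftrightarrow>
     (\<forall>x. v x \<ge> 0) \<and> (\<forall>x. v x = 0 \<longleftrightarrow> x = 0) \<and> (\<forall>x y. v (x * y) = v x * v y) \<and>
     (\<forall>x y. v (x + y) \<le> max (v x) (v y)) \<and> (\<exists>x. x \<noteq> 0 \<and> v x \<noteq> 1)"

definition val_ring :: "('k::field \<Rightarrow> real) \<Rightarrow> 'k ring" where
  "val_ring v = ring_of_type_algebra\<lparr>carrier := {x. v x \<le> 1}\<rparr>"

definition max_ideal :: "('k::field \<Rightarrow> real) \<Rightarrow> 'k set" where
  "max_ideal v = {x. v x < 1}"

text \<open>
  The valuation ring of \<open>v\<close> in the field itself has the same residue field as the valuation
  ring of the completion at \<open>v\<close>.
\<close>

definition residue_field :: "('k::field \<Rightarrow> real) \<Rightarrow> 'k set ring" where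
  "residue_field v = val_ring v Quot max_ideal v"

definition residue :: "('k::field \<Rightarrow> real) \<Rightarrow> 'k \<Rightarrow> 'k set" where
  "residue v x = max_ideal v +>\<^bsub>val_ring v\<^esub> x"

text \<open>
  Reduction of coefficients modulo \<open>v\<close>, after scaling numerator and denominator so that all their
  coefficients are integral at \<open>v\<close> and at least one of them is a unit.  The outcome need not
  be in lowest terms.
\<close>

definition reduction :: "('k::field \<Rightarrow> real) \<Rightarrow> 'k ratfun \<Rightarrow> 'k set ratfun" where
  "reduction v \<phi> =
     (\<Union>(P, Q) \<in> {(P, Q) \<in> \<phi>. (\<forall>i. v (P i) \<le> 1 \<and> v (Q i) \<le> 1) \<and>
                                   (\<exists>i. v (P i) = 1 \<or> v (Q i) = 1)}.
        rat_frac (residue_field v) (residue v \<circ> P) (residue v \<circ> Q))"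

definition good_reduction :: "('k::field \<Rightarrow> real) \<Rightarrow> 'k ratfun \<Rightarrow> bool" where
  "good_reduction v \<phi> \<longleftrightarrow>
     rat_degree (residue_field v) (reduction v \<phi>) = rat_degree ring_of_type_algebra \<phi>"

text \<open>
  An element of \<open>PGL\<^sub>2(K)\<close> with good reduction is represented by matrices that are invertible
  over the valuation ring; its reduction is the class of the entrywise reduction of any of them.
\<close>

definition red :: "('k::field \<Rightarrow> real) \<Rightarrow> 'k mat2 set \<Rightarrow> 'k set mat2 set" where
  "red v f =
     (\<Union>(a, b, c, d) \<in> f \<inter> carrier (GL2 (val_ring v)).
        scalar_mats (residue_field v) #>\<^bsub>GL2 (residue_field v)\<^esub>
          (residue v a, residue v b, residue v c, residue v d))"

definition S0 :: "'k::field_char_0 itself \<Rightarrow> nat \<Rightarrow> nat set" where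
  "S0 K d = {2} \<union> {p. Factorial_Ring.prime p \<and> odd p \<and> (p - 1) div 2 dvd degree_over_rat K \<and> p dvd d * (d\<^sup>2 - 1)}"

text \<open>The place \<open>v\<close> divides the rational prime \<open>p\<close> iff \<open>v p < 1\<close>.\<close>

definition exceptional_places ::
  "'k::field_char_0 ratfun \<Rightarrow> ('k \<Rightarrow> real) set" where
  "exceptional_places \<phi> = {v. finite_place v \<and>
     (\<not> good_reduction v \<phi> \<or>
      (\<exists>p \<in> S0 TYPE('k) (rat_degree ring_of_type_algebra \<phi>). v (of_nat p) < 1))}"

end

theory Submission
  imports Defs
begin

text \<open>
  Write \<open>\<Phi> = (A, B)\<close> for a numerator and a denominator of \<open>\<phi>\<close> in lowest terms, regarded as a pair of
  binary forms of degree \<open>n = deg \<phi>\<close>, with integral coefficients at \<open>v\<close> of which one is a unit.  A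
  class in \<open>PGL\<^sub>2(K)\<close> fixes \<open>\<phi>\<close> under conjugation iff a matrix \<open>M\<close> representing it satisfies
  \<open>\<Phi>(M w) = t M \<Phi>(w)\<close> for a constant \<open>t \<noteq> 0\<close> (\<open>conjugate_fixedD\<close>, \<open>commuting_if_conjugate_fixed\<close>).

  Good reduction of \<open>\<phi>\<close> means that the reductions of \<open>A\<close> and \<open>B\<close> have no common zero on the projective
  line, that is, \<open>|\<Phi>(w)| = |w|\<^sup>n\<close> for the maximum norm (\<open>form_norm\<close>).  Scale \<open>M\<close> so that its largest
  entry has absolute value \<open>1\<close>.  Comparing norms in \<open>\<Phi>(M w) = t M \<Phi>(w)\<close> at a vector that \<open>M\<close> does not
  contract and at one that it contracts by \<open>|det M|\<close> yields \<open>1 \<le> |t| \<le> |det M|\<^sup>n\<^sup>-\<^sup>1\<close>, so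
  \<open>det M\<close> is a unit as \<open>n \<ge> 2\<close> (\<open>commuting_unimodular\<close>).  Hence automorphisms have good reduction, and the
  identity of polynomials expressing that \<open>M\<close> fixes \<open>\<phi>\<close> can be reduced modulo \<open>v\<close>.  This makes
  reduction a well-defined homomorphism.

  For injectivity, let two automorphisms have the same reduction and let \<open>D\<close> be the quotient of their
  matrices, which is scalar modulo \<open>v\<close>.  If \<open>D\<close> is not scalar, evaluate \<open>\<Phi>(D w) = t D \<Phi>(w)\<close> at
  eigenvectors of \<open>D\<close> over an algebraic closure.  The map \<open>\<Phi>\<close> takes eigenvectors to eigenvectors, and
  comparing eigenvalues shows that the ratio \<open>r \<noteq> 1\<close> of the eigenvalues of \<open>D\<close> satisfies \<open>r\<^sup>m = 1\<close>
  for some \<open>m\<close> among \<open>n - 1, n, n + 1\<close>; a double eigenvalue is impossible in characteristic \<open>0\<close>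
  (\<open>commuting_not_unipotent\<close>, \<open>commuting_finite_order\<close>).  Replace \<open>r\<close> by a power of prime order \<open>\<ell>\<close>; then
  \<open>\<ell>\<close> divides \<open>n(n\<^sup>2 - 1)\<close>.  The element \<open>t = r + 1 / r\<close> of \<open>K\<close> is congruent to \<open>2\<close> modulo \<open>v\<close>, and the product
  of all \<open>2 - r\<^sup>k - r\<^sup>-\<^sup>k\<close> with \<open>0 < k < \<ell>\<close> is \<open>\<ell>\<^sup>2\<close>.  Therefore \<open>v\<close> divides \<open>\<ell>\<close>, and for
  odd \<open>\<ell>\<close> the factors differ from \<open>2 - t\<close> by units, so that \<open>|2 - t|\<^sup>e = |\<ell>|\<close> with
  \<open>e = (\<ell> - 1) / 2\<close> (\<open>ramification\<close>).  So \<open>\<rat>(t)\<close> is ramified of index \<open>e\<close> below \<open>v\<close>, has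
  degree exactly \<open>e\<close> over \<open>\<rat>\<close>, and \<open>e\<close> divides \<open>[K : \<rat>]\<close> (\<open>ramification_dvd_degree\<close>).  Thus \<open>\<ell>\<close>
  belongs to the excluded primes, which \<open>v\<close> does not divide.
\<close>

section \<open>Finite places\<close>

locale place =
  fixes v :: "'k::field_char_0 \<Rightarrow> real"
  assumes finite_place: "finite_place v"
begin

lemma v_nonneg [simp]: "v x \<ge> 0"
  and v_eq_0 [simp]: "v x = 0 \<longleftrightarrow> x = 0"
  and v_mult [simp]: "v (x * y) = v x * v y"
  and v_add: "v (x + y) \<le> max (v x) (v y)"
  using finite_place unfolding finite_place_def by auto

lemma v_0 [simp]: "v 0 = 0" by simp

lemma v_1 [simp]: "v 1 = 1"
proof -
  have "v 1 * v 1 = v 1" using v_mult[of 1 1] by simp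
  thus ?thesis by simp
qed

lemma v_minus [simp]: "v (- x) = v x"
proof -
  have "v (-1) * v (-1) = 1" using v_mult[of "-1" "-1"] by simp
  hence "(v (-1))\<^sup>2 = 1\<^sup>2" by (simp add: power2_eq_square)
  hence "v (-1) = 1" using v_nonneg[of "-1"] power2_eq_imp_eq by fastforce
  thus ?thesis using v_mult[of "-1" x] by simp
qed

lemma v_diff: "v (x - y) \<le> max (v x) (v y)"
  using v_add[of x "- y"] by simp

lemma v_diff_commute: "v (x - y) = v (y - x)"
  using v_minus[of "x - y"] by simp

lemma v_power [simp]: "v (x ^ n) = v x ^ n"
  by (induction n) auto

lemma v_inverse [simp]: "v (inverse x) = inverse (v x)"
proof (cases "x = 0")
  case False
  hence "v x * v (inverse x) = 1" by (simp flip: v_mult)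
  thus ?thesis using inverse_unique by metis
qed simp

lemma v_divide [simp]: "v (x / y) = v x / v y"
  by (simp add: divide_inverse)

lemma v_add_le: "v x \<le> r \<Longrightarrow> v y \<le> r \<Longrightarrow> v (x + y) \<le> r"
  using v_add[of x y] by simp

lemma v_add_less: "v x < r \<Longrightarrow> v y < r \<Longrightarrow> v (x + y) < r"
  using v_add[of x y] by simp

lemma v_diff_le: "v x \<le> r \<Longrightarrow> v y \<le> r \<Longrightarrow> v (x - y) \<le> r"
  using v_diff[of x y] by simp

lemma v_diff_less: "v x < r \<Longrightarrow> v y < r \<Longrightarrow> v (x - y) < r"
  using v_diff[of x y] by simp

lemma v_mult_le_1: "v x \<le> 1 \<Longrightarrow> v y \<le> 1 \<Longrightarrow> v (x * y) \<le> 1"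
  by (simp add: mult_le_one)

lemma v_mult_less_1: "v x < 1 \<Longrightarrow> v y \<le> 1 \<Longrightarrow> v (x * y) < 1"
  using mult_left_le[of "v y" "v x"] by simp

lemma v_add_eq: "v x < v y \<Longrightarrow> v (x + y) = v y"
  using v_add[of x y] v_diff[of "x + y" x] by simp

lemma v_eq_1_if_close: "v (x - y) < 1 \<Longrightarrow> v y = 1 \<Longrightarrow> v x = 1"
  using v_add_eq[of "x - y" y] by simp

lemma v_sum_le: "r \<ge> 0 \<Longrightarrow> (\<And>i. i \<in> A \<Longrightarrow> v (g i) \<le> r) \<Longrightarrow> v (\<Sum>i\<in>A. g i) \<le> r"
  by (induction A rule: infinite_finite_induct) (auto intro: v_add_le)

lemma v_sum_less: "r > 0 \<Longrightarrow> (\<And>i. i \<in> A \<Longrightarrow> v (g i) < r) \<Longrightarrow> v (\<Sum>i\<in>A. g i) < r"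
  by (induction A rule: infinite_finite_induct) (auto intro: v_add_less)

lemma v_of_nat_le_1: "v (of_nat n) \<le> 1"
  by (induction n) (auto intro: v_add_le)

lemma v_of_int_le_1: "v (of_int n) \<le> 1"
  by (cases n rule: int_cases2) (auto simp: v_of_nat_le_1)

lemma v_prod [simp]: "v (\<Prod>i\<in>A. g i) = (\<Prod>i\<in>A. v (g i))"
  by (induction A rule: infinite_finite_induct) auto

text \<open>
  In an ultrametric sum whose nonzero terms have pairwise different absolute values the largest
  term cannot be cancelled.
\<close>

lemma sum_nonzero_if_distinct_values:
  assumes "finite A" and inj: "inj_on (\<lambda>i. v (g i)) A"
    and "j \<in> A" "g j \<noteq> 0"
  shows "(\<Sum>i\<in>A. g i) \<noteq> 0"
proof -
  obtain m where m: "m \<in> A" "\<And>i. i \<in> A \<Longrightarrow> v (g i) \<le> v (g m)"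
  proof -
    have "Max ((\<lambda>i. v (g i)) ` A) \<in> (\<lambda>i. v (g i)) ` A"
      using assms(1,3) by (intro Max_in) auto
    then obtain m where "m \<in> A" "v (g m) = Max ((\<lambda>i. v (g i)) ` A)" by force
    moreover have "v (g i) \<le> Max ((\<lambda>i. v (g i)) ` A)" if "i \<in> A" for i
      using assms(1) that by (intro Max_ge) auto
    ultimately show ?thesis using that by simp
  qed
  have pos: "v (g m) > 0"
    using m(2)[OF assms(3)] assms(4) v_nonneg[of "g j"] v_eq_0[of "g j"] by linarith
  have "v (\<Sum>i\<in>A - {m}. g i) < v (g m)"
  proof (rule v_sum_less[OF pos])
    fix i assume "i \<in> A - {m}"
    thus "v (g i) < v (g m)" using m inj_onD[OF inj, of i m] by fastforce
  qed
  hence "v ((\<Sum>i\<in>A - {m}. g i) + g m) = v (g m)" by (rule v_add_eq)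
  moreover have "(\<Sum>i\<in>A - {m}. g i) + g m = (\<Sum>i\<in>A. g i)"
    using sum.remove[OF assms(1) m(1), of g] by (simp add: add.commute)
  ultimately show ?thesis using pos by force
qed

text \<open>Reduce a relation \<open>a k + b l = 1\<close> modulo \<open>v\<close>.\<close>

lemma v_of_nat_eq_1:
  assumes "v (of_nat l) < 1" "coprime k l"
  shows "v (of_nat k) = 1"
proof -
  obtain a b where "a * int k + b * int l = 1"
    using assms(2) by (metis bezout_int coprime_iff_gcd_eq_1 coprime_int_iff)
  hence "of_int a * of_nat k + of_int b * of_nat l = (1::'k)"
    by (metis of_int_1 of_int_add of_int_mult of_int_of_nat_eq)
  moreover have "v (of_int b * of_nat l) < 1"
    using v_mult_less_1[OF assms(1) v_of_int_le_1[of b]] by (simp add: mult.commute)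
  ultimately have "v (of_int a * of_nat k) = 1"
    using v_eq_1_if_close[of "of_int a * of_nat k" 1] v_diff_commute[of "of_int a * of_nat k" 1]
    by (metis add_diff_cancel_left' v_1)
  moreover have "v (of_int a * of_nat k) \<le> v (of_nat k)"
    using mult_right_mono[OF v_of_int_le_1[of a], of "v (of_nat k)"] by simp
  ultimately show ?thesis using v_of_nat_le_1[of k] by linarith
qed

end

section \<open>Roots of unity and Dickson polynomials\<close>

text \<open>
  \<open>dickson t k\<close> is the Dickson polynomial \<open>D\<^sub>k(t)\<close>, for which \<open>D\<^sub>k(r + 1 / r) = r\<^sup>k + r\<^sup>-\<^sup>k\<close>.  It expresses
  symmetric functions of \<open>r\<close> and \<open>1 / r\<close> inside a field that contains \<open>r + 1 / r\<close> but perhaps not \<open>r\<close>.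
\<close>

fun dickson :: "'a::comm_ring_1 \<Rightarrow> nat \<Rightarrow> 'a" where
  "dickson t 0 = 2"
| "dickson t (Suc 0) = t"
| "dickson t (Suc (Suc k)) = t * dickson t (Suc k) - dickson t k"

lemma dickson_add:
  assumes "r * s = 1"
  shows "dickson (r + s) k = r ^ k + s ^ k"
proof (induction k rule: induct_nat_012)
  case (ge2 k)
  have "(r + s) * (r * r ^ k + s * s ^ k) =
      r * (r * r ^ k) + s * (s * s ^ k) + (r * s) * (r ^ k + s ^ k)"
    by (simp add: algebra_simps)
  thus ?case using ge2 assms by simp
qed simp_all

lemma dickson_add_inverse:
  fixes r :: "'a::field"
  assumes "r \<noteq> 0"
  shows "dickson (r + inverse r) k = r ^ k + inverse r ^ k"
  using assms by (intro dickson_add) simp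

lemma to_ac_dickson: "to_ac (dickson t k) = dickson (to_ac t) k"
  by (induction t k rule: dickson.induct) auto

definition has_order :: "'a::monoid_mult \<Rightarrow> nat \<Rightarrow> bool" where
  "has_order r n \<longleftrightarrow> (\<forall>k. r ^ k = 1 \<longleftrightarrow> n dvd k)"

lemma has_orderD: "has_order r n \<Longrightarrow> r ^ k = 1 \<longleftrightarrow> n dvd k"
  unfolding has_order_def by simp

lemma has_order_exists:
  fixes r :: "'a::field"
  assumes "r ^ m = 1" "m > 0"
  obtains n where "n > 0" "has_order r n"
proof -
  define n where "n = (LEAST n. n > 0 \<and> r ^ n = 1)"
  have n: "n > 0" "r ^ n = 1"
    using LeastI[of "\<lambda>n. n > 0 \<and> r ^ n = 1" m] assms unfolding n_def by auto
  have "r ^ k = 1 \<longleftrightarrow> n dvd k" for k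
  proof
    assume "r ^ k = 1"
    have "r ^ k = (r ^ n) ^ (k div n) * r ^ (k mod n)"
      by (simp flip: power_mult power_add)
    hence "r ^ (k mod n) = 1" using n \<open>r ^ k = 1\<close> by simp
    moreover have "k mod n < n" using n by simp
    ultimately have "\<not> k mod n > 0"
      using not_less_Least[of "k mod n" "\<lambda>n. n > 0 \<and> r ^ n = 1"] unfolding n_def[symmetric] by auto
    hence "k mod n = 0" by simp
    thus "n dvd k" by blast
  next
    assume "n dvd k" thus "r ^ k = 1" using n by (auto simp: power_mult)
  qed
  thus ?thesis using that n unfolding has_order_def by blast
qed

lemma has_order_power:
  assumes "has_order r n" "l dvd n" "n > 0"
  shows "has_order (r ^ (n div l)) l"
  unfolding has_order_def
proof
  fix k
  have "(r ^ (n div l)) ^ k = 1 \<longleftrightarrow> n dvd (n div l) * k"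
    using assms(1) unfolding has_order_def by (simp flip: power_mult)
  also have "\<dots> \<longleftrightarrow> l dvd k"
  proof -
    obtain m where m: "n = l * m" using assms(2) by blast
    hence "n div l = m" "l > 0" "m > 0" using assms(3) by auto
    thus ?thesis using m by (simp add: mult.commute[of l])
  qed
  finally show "(r ^ (n div l)) ^ k = 1 \<longleftrightarrow> l dvd k" .
qed

lemma has_order_inj:
  fixes r :: "'a::field"
  assumes "has_order r n" "n > 0"
  shows "inj_on (\<lambda>k. r ^ k) {..<n}"
proof -
  have "r \<noteq> 0" using assms(2) has_orderD[OF assms(1), of n] by (auto simp: power_0_left)
  have aux: "j = k" if "j \<le> k" "k < n" "r ^ j = r ^ k" for j k
  proof -
    have "r ^ j * r ^ (k - j) = r ^ j" using that by (metis le_add_diff_inverse power_add)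
    hence "r ^ (k - j) = 1" using \<open>r \<noteq> 0\<close> by simp
    hence "n dvd k - j" using assms unfolding has_order_def by blast
    thus ?thesis using that nat_dvd_not_less[of "k - j" n] by force
  qed
  show ?thesis by (rule inj_onI) (metis aux lessThan_iff nat_le_linear)
qed

text \<open>
  The powers \<open>r\<^sup>k\<close> with \<open>0 < k < n\<close> are all the roots of \<open>1 + z + \<dots> + z\<^sup>n\<^sup>-\<^sup>1\<close>; compare
  values at \<open>z = 1\<close>.
\<close>

lemma prod_one_minus_roots:
  fixes r :: "'a::field"
  assumes r: "has_order r n" and n: "n > 0"
  shows "(\<Prod>k=1..<n. 1 - r ^ k) = of_nat n"
proof -
  define q where "q = (\<Prod>k=1..<n. [:- (r ^ k), 1:])"
  define s :: "'a poly" where "s = (\<Sum>i<n. Polynomial.monom 1 i)"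
  have coeff_s: "poly.coeff s i = (if i < n then 1 else 0)" for i
    unfolding s_def by (simp add: Polynomial.coeff_sum)
  have deg_s: "Polynomial.degree s \<le> n - 1"
    by (rule Polynomial.degree_le) (use coeff_s in auto)
  have deg_q: "Polynomial.degree q = n - 1"
    unfolding q_def by (subst Polynomial.degree_prod_eq_sum_degree) auto
  have lead_q: "poly.coeff q (n - 1) = 1"
  proof -
    have "Polynomial.lead_coeff q = 1" unfolding q_def Polynomial.lead_coeff_prod by simp
    thus ?thesis using deg_q by simp
  qed
  have rn: "r ^ n = 1" by (simp only: has_orderD[OF r] dvd_refl)
  have "q = s"
  proof (rule Polynomial.poly_eqI_degree_lead_coeff[where n = "n - 1" and A = "(\<lambda>k. r ^ k) ` {1..<n}"])
    show "poly.coeff q (n - 1) = poly.coeff s (n - 1)" using lead_q coeff_s n by simp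
    have "inj_on (\<lambda>k. r ^ k) {1..<n}"
      by (rule inj_on_subset[OF has_order_inj[OF r n]]) auto
    thus "card ((\<lambda>k. r ^ k) ` {1..<n}) \<ge> n - 1" by (simp add: card_image)
  next
    fix z assume "z \<in> (\<lambda>k. r ^ k) ` {1..<n}"
    then obtain k where k: "z = r ^ k" "k \<in> {1..<n}" by blast
    have "poly q z = 0" unfolding q_def using k by (auto simp: Polynomial.poly_prod)
    moreover have "poly s z = 0"
    proof -
      have "z \<noteq> 1" using k has_orderD[OF r, of k] nat_dvd_not_less[of k n] by auto
      moreover have "(1 - z) * (\<Sum>i<n. z ^ i) = 1 - z ^ n"
        by (rule one_diff_power_eq[symmetric])
      moreover have "z ^ n = 1" using k(1) rn by (metis mult.commute power_mult power_one)
      ultimately have "(\<Sum>i<n. z ^ i) = 0" by simp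
      thus ?thesis unfolding s_def by (simp add: Polynomial.poly_sum Polynomial.poly_monom)
    qed
    ultimately show "poly q z = poly s z" by simp
  qed (use deg_q deg_s in auto)
  hence "poly q 1 = poly s 1" by simp
  thus ?thesis unfolding q_def s_def
    by (simp add: Polynomial.poly_prod Polynomial.poly_sum Polynomial.poly_monom)
qed

text \<open>The \<open>k\<close>-th factor is \<open>(1 - r\<^sup>k) (1 - r\<^sup>-\<^sup>k)\<close>.\<close>

lemma prod_two_minus_dickson:
  fixes r :: "'a::field"
  assumes r: "has_order r n" and n: "n > 0"
  shows "(\<Prod>k=1..<n. 2 - dickson (r + inverse r) k) = (of_nat n)\<^sup>2"
proof -
  have r0: "r \<noteq> 0" using assms(2) has_orderD[OF assms(1), of n] by (auto simp: power_0_left)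
  have r': "has_order (inverse r) n"
    using r unfolding has_order_def by (simp add: power_inverse)
  have "2 - dickson (r + inverse r) k = (1 - r ^ k) * (1 - inverse r ^ k)" for k
    unfolding dickson_add_inverse[OF r0] using r0 by (simp add: field_simps)
  thus ?thesis
    using prod_one_minus_roots[OF r n] prod_one_minus_roots[OF r' n]
    by (simp only: prod.distrib power2_eq_square)
qed

text \<open>This is \<open>1 + r + \<dots> + r\<^sup>2\<^sup>e = 0\<close> divided by \<open>r\<^sup>e\<close>.\<close>

lemma sum_dickson:
  fixes r :: "'a::field"
  assumes r: "has_order r (2 * e + 1)" and e: "e > 0"
  shows "1 + (\<Sum>k=1..e. dickson (r + inverse r) k) = 0"
proof -
  have rn: "r ^ (2 * e + 1) = 1" by (simp only: has_orderD[OF r] dvd_refl)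
  hence r0: "r \<noteq> 0" by auto
  have "\<not> 2 * e + 1 dvd 1" using e by simp
  hence r1: "r \<noteq> 1" using has_orderD[OF r, of 1] by simp
  have "(\<Sum>i<2*m+1. r ^ i) = r ^ m * (1 + (\<Sum>k=1..m. dickson (r + inverse r) k))" for m
  proof (induction m)
    case (Suc m)
    have "(\<Sum>i<Suc (2*m+1). r ^ i) = 1 + r * (\<Sum>i<2*m+1. r ^ i)"
      using sum.lessThan_Suc_shift[of "\<lambda>i. r ^ i" "2*m+1"]
      by (simp only: power_0 power_Suc sum_distrib_left)
    hence "(\<Sum>i<2*Suc m+1. r ^ i) = 1 + r * (\<Sum>i<2*m+1. r ^ i) + r ^ (2 * Suc m)"
      by simp
    also have "\<dots> = r ^ Suc m * (1 + (\<Sum>k=1..m. dickson (r + inverse r) k)) + (1 + r ^ (2 * Suc m))"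
      by (simp only: Suc.IH power_Suc) (simp add: algebra_simps)
    also have "1 + r ^ (2 * Suc m) = r ^ Suc m * (r ^ Suc m + inverse r ^ Suc m)"
    proof -
      have "r ^ Suc m * inverse r ^ Suc m = 1" using r0 by (subst power_mult_distrib[symmetric]) simp
      thus ?thesis unfolding distrib_left mult_2 power_add by simp
    qed
    also have "r ^ Suc m + inverse r ^ Suc m = dickson (r + inverse r) (Suc m)"
      by (rule dickson_add_inverse[OF r0, symmetric])
    finally show ?case by (simp only: sum.cl_ivl_Suc) (use r0 in \<open>simp add: distrib_left\<close>)
  qed simp
  from this[of e] have "r ^ e * (1 + (\<Sum>k=1..e. dickson (r + inverse r) k)) = (\<Sum>i<2*e+1. r ^ i)" ..
  also have "\<dots> = 0"
    using one_diff_power_eq[of r "2*e+1"] rn r1 by simp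
  finally show ?thesis using r0 by simp
qed

section \<open>Ramification\<close>

context place begin

text \<open>
  The quotient \<open>(D\<^sub>k(t) - 2) / (t - 2)\<close> is a polynomial in \<open>t\<close> with integer coefficients, and its value
  at \<open>t = 2\<close> is \<open>k\<^sup>2\<close>: with \<open>t = r + 1 / r\<close>, it is \<open>(r\<^sup>k - 1)\<^sup>2 / (r - 1)\<^sup>2\<close> divided by
  \<open>r\<^sup>k\<^sup>-\<^sup>1\<close>.
\<close>

lemma dickson_near_2:
  assumes "v (t - 2) < 1"
  obtains u where "dickson t k - 2 = (t - 2) * u" "v (u - (of_nat k)\<^sup>2) < 1" "v u \<le> 1"
proof -
  have "\<exists>u. dickson t k - 2 = (t - 2) * u \<and> v (u - (of_nat k)\<^sup>2) < 1" for k
  proof (induction k rule: induct_nat_012)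
    case 0 show ?case by (rule exI[of _ 0]) simp
  next
    case 1 show ?case by (rule exI[of _ 1]) simp
  next
    case (ge2 k)
    then obtain u w where
      u: "dickson t k - 2 = (t - 2) * u" "v (u - (of_nat k)\<^sup>2) < 1" and
      w: "dickson t (Suc k) - 2 = (t - 2) * w" "v (w - (of_nat (Suc k))\<^sup>2) < 1"
      by blast
    define z where "z = 2 + 2 * w + (t - 2) * w - u"
    have du: "dickson t k = 2 + (t - 2) * u" and dw: "dickson t (Suc k) = 2 + (t - 2) * w"
      using u(1) w(1) by (simp_all add: algebra_simps)
    have "dickson t (Suc (Suc k)) - 2 = (t - 2) * z"
      unfolding z_def by (simp only: dickson.simps du dw) (simp add: algebra_simps)
    moreover have "v (z - (of_nat (Suc (Suc k)))\<^sup>2) < 1"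
    proof -
      have "v w \<le> 1"
        using v_add_le[of "w - (of_nat (Suc k))\<^sup>2" 1 "(of_nat (Suc k))\<^sup>2"] w(2) v_of_nat_le_1[of "Suc k"]
        by (simp add: power_le_one)
      hence a: "v ((t - 2) * w) < 1" using assms v_mult_less_1 by blast
      have "v (2 * (w - (of_nat (Suc k))\<^sup>2)) < 1"
        using v_mult_less_1[OF w(2) v_of_nat_le_1[of 2]] by (simp add: mult.commute)
      hence "v (2 * (w - (of_nat (Suc k))\<^sup>2) + (t - 2) * w - (u - (of_nat k)\<^sup>2)) < 1"
        using v_diff_less[OF v_add_less[OF _ a] u(2)] by blast
      moreover have "2 * (w - (of_nat (Suc k))\<^sup>2) + (t - 2) * w - (u - (of_nat k)\<^sup>2) = z - (of_nat (Suc (Suc k)))\<^sup>2"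
        unfolding z_def by (simp add: algebra_simps power2_eq_square)
      ultimately show ?thesis by simp
    qed
    ultimately show ?case by blast
  qed
  then obtain u where u: "dickson t k - 2 = (t - 2) * u" "v (u - (of_nat k)\<^sup>2) < 1" by blast
  moreover have "v u \<le> 1"
    using v_add_le[of "u - (of_nat k)\<^sup>2" 1 "(of_nat k)\<^sup>2"] u(2) v_of_nat_le_1[of k]
    by (simp add: power_le_one)
  ultimately show ?thesis using that by blast
qed

lemma v_dickson_near_2:
  assumes "v (t - 2) < 1"
  shows "v (dickson t k - 2) < 1"
proof -
  obtain u where "dickson t k - 2 = (t - 2) * u" "v u \<le> 1"
    using dickson_near_2[OF assms] by metis
  thus ?thesis using v_mult_less_1[OF assms] by metis
qed

text \<open>
  All factors of the product are divisible by \<open>2 - t\<close>, so \<open>v\<close> divides \<open>\<ell>\<close>.  For \<open>0 < k < \<ell>\<close> the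
  cofactor, which is congruent to \<open>k\<^sup>2\<close>, is then a unit.
\<close>

lemma ramification:
  assumes t: "v (t - 2) < 1" and l: "Factorial_Ring.prime (l::nat)"
    and prod: "(\<Prod>k=1..<l. 2 - dickson t k) = (of_nat l)\<^sup>2"
  shows "v (of_nat l) < 1" and "v (2 - t) ^ (l - 1) = (v (of_nat l))\<^sup>2"
proof -
  have l1: "l > 1" using l prime_gt_1_nat by blast
  have vprod: "(\<Prod>k=1..<l. v (2 - dickson t k)) = (v (of_nat l))\<^sup>2"
    using arg_cong[OF prod, of v] by simp
  have "(\<Prod>k=1..<l. v (2 - dickson t k)) < 1"
  proof -
    have "(\<Prod>k=1..<l. v (2 - dickson t k)) = v (2 - dickson t 1) * (\<Prod>k=2..<l. v (2 - dickson t k))"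
      using l1 by (metis numeral_2_eq_2 One_nat_def prod.atLeast_Suc_lessThan)
    moreover have "(\<Prod>k=2..<l. v (2 - dickson t k)) \<le> 1"
      using v_dickson_near_2[OF t] by (intro prod_le_1) (auto simp: v_diff_commute[of 2] less_imp_le)
    ultimately show ?thesis
      using v_mult_less_1[of "2 - dickson t 1" "\<Prod>k=2..<l. 2 - dickson t k"]
        v_dickson_near_2[OF t, of 1] by (simp add: v_diff_commute[of 2])
  qed
  hence "(v (of_nat l))\<^sup>2 < 1" using vprod by simp
  thus vl: "v (of_nat l) < 1" using v_nonneg by (simp add: power_less_one_iff)
  have "v (2 - dickson t k) = v (2 - t)" if k: "k \<in> {1..<l}" for k
  proof -
    obtain u where u: "dickson t k - 2 = (t - 2) * u" "v (u - (of_nat k)\<^sup>2) < 1"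
      using dickson_near_2[OF t] by metis
    have "coprime k l"
      using k l by (metis atLeastLessThan_iff coprime_commute not_less_zero nat_dvd_not_less prime_imp_coprime less_le_trans zero_less_one)
    hence "v ((of_nat k)\<^sup>2) = 1" using v_of_nat_eq_1[OF vl] by simp
    hence "v u = 1" using v_eq_1_if_close[OF u(2)] by blast
    thus ?thesis using arg_cong[OF u(1), of v] by (simp add: v_diff_commute[of 2])
  qed
  hence "(\<Prod>k=1..<l. v (2 - dickson t k)) = v (2 - t) ^ (l - 1)" by simp
  thus "v (2 - t) ^ (l - 1) = (v (of_nat l))\<^sup>2" using vprod by simp
qed

end

section \<open>Degrees of subrings generated by real cyclotomic integers\<close>

lemma rat_vector_space: "vector_space (\<lambda>q (x :: 'k::field_char_0). of_rat q * x)"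
  by unfold_locales (simp_all add: algebra_simps of_rat_mult of_rat_add)

lemma number_field_basis:
  assumes "number_field TYPE('k::field_char_0)"
  obtains B where "finite_dimensional_vector_space (\<lambda>q (x :: 'k). of_rat q * x) B"
proof -
  interpret V: vector_space "\<lambda>q (x :: 'k). of_rat q * x" by (rule rat_vector_space)
  obtain C where C: "finite C" "V.span C = (UNIV :: 'k set)"
    using assms unfolding number_field_def by blast
  obtain B where B: "B \<subseteq> C" "V.independent B" "C \<subseteq> V.span B"
    using V.maximal_independent_subset by blast
  have "V.span B = UNIV" using V.span_mono[OF B(3)] C(2) V.span_span[of B] by (simp only: top.extremum_unique)
  hence "finite_dimensional_vector_space (\<lambda>q (x :: 'k). of_rat q * x) B"
    using B C(1) finite_subset by unfold_locales auto
  thus ?thesis by (rule that)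
qed

text \<open>
  A subring \<open>F\<close> of finite dimension over \<open>\<rat>\<close> is a field, because multiplication by a nonzero element is
  injective on it.  If an \<open>F\<close>-stable subspace \<open>W\<close> does not contain \<open>b\<close>, then \<open>W \<inter> F b = 0\<close>, so that
  \<open>W + F b\<close> has dimension \<open>dim W + dim F\<close>.  Hence an \<open>F\<close>-stable subspace that is largest among those
  of dimension divisible by \<open>dim F\<close> is everything.
\<close>

lemma dim_subring_dvd_degree:
  fixes F :: "'k::field_char_0 set"
  assumes nf: "number_field TYPE('k)"
    and sub: "module.subspace (\<lambda>q x. of_rat q * x) F"
    and one: "1 \<in> F" and mult: "\<And>x y. x \<in> F \<Longrightarrow> y \<in> F \<Longrightarrow> x * y \<in> F"
  shows "vector_space.dim (\<lambda>q x. of_rat q * x) F dvd degree_over_rat TYPE('k)"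
proof -
  let ?sc = "\<lambda>q (x :: 'k). of_rat q * x"
  obtain B where "finite_dimensional_vector_space ?sc B" using number_field_basis[OF nf] .
  then interpret V: finite_dimensional_vector_space ?sc B .
  interpret VV: finite_dimensional_vector_space_pair_1 ?sc B ?sc ..
  have lin: "Vector_Spaces.linear ?sc ?sc (\<lambda>x. x * c)" for c
    by unfold_locales (simp_all add: algebra_simps)
  have image: "V.subspace ((\<lambda>x. x * c) ` F)" "c \<noteq> 0 \<Longrightarrow> V.dim ((\<lambda>x. x * c) ` F) = V.dim F" for c
    using VV.linear_subspace_image[OF lin sub] VV.dim_image_eq[OF lin, of c F]
    by (auto simp: inj_on_def)
  have inv: "\<exists>g\<in>F. g * f = 1" if "f \<in> F" "f \<noteq> 0" for f
  proof -
    have "(\<lambda>x. x * f) ` F = F"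
      using image[of f] that mult sub by (intro V.subspace_dim_equal) auto
    thus ?thesis using one by (metis (mono_tags, lifting) imageE)
  qed
  define P where "P W \<longleftrightarrow> V.subspace W \<and> (\<forall>f\<in>F. \<forall>w\<in>W. f * w \<in> W) \<and> V.dim F dvd V.dim W" for W
  have "P {0}" unfolding P_def by (simp add: V.subspace_0)
  moreover have "\<forall>W. P W \<longrightarrow> V.dim W < Suc V.dimension"
    using V.dim_subset_UNIV by (simp add: less_Suc_eq_le)
  ultimately obtain W where W: "P W" and max: "\<And>W'. P W' \<Longrightarrow> V.dim W' \<le> V.dim W"
    using ex_has_greatest_nat[of P "{0}" V.dim "Suc V.dimension"] by blast
  have subW: "V.subspace W" and modW: "\<And>f w. f \<in> F \<Longrightarrow> w \<in> W \<Longrightarrow> f * w \<in> W"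
    and dvdW: "V.dim F dvd V.dim W" using W unfolding P_def by auto
  have "W = UNIV"
  proof (rule ccontr)
    assume "W \<noteq> UNIV"
    then obtain b where b: "b \<notin> W" by blast
    hence b0: "b \<noteq> 0" using V.subspace_0[OF subW] by blast
    let ?Fb = "(\<lambda>x. x * b) ` F"
    define W' where "W' = {x + y | x y. x \<in> W \<and> y \<in> ?Fb}"
    have "W \<inter> ?Fb = {0}"
    proof -
      have "f = 0" if f: "f \<in> F" "f * b \<in> W" for f
      proof (rule ccontr)
        assume "f \<noteq> 0"
        then obtain g where "g \<in> F" "g * f = 1" using inv[of f] f(1) by blast
        hence "b \<in> W" using modW[OF _ f(2), of g] by (simp flip: mult.assoc)
        thus False using b by blast
      qed
      moreover have "0 \<in> W" "0 \<in> F" using V.subspace_0 subW sub by auto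
      ultimately show ?thesis by force
    qed
    hence dim: "V.dim W' = V.dim W + V.dim F"
      using V.dim_sums_Int[OF subW image(1)[of b]] image(2)[OF b0] unfolding W'_def by simp
    have "P W'"
      unfolding P_def
    proof (intro conjI ballI)
      show "V.subspace W'" unfolding W'_def by (rule V.subspace_sums[OF subW image(1)])
      show "V.dim F dvd V.dim W'" using dim dvdW by simp
      fix f w assume "f \<in> F" "w \<in> W'"
      then obtain x y where "x \<in> W" "y \<in> F" "w = x + y * b" unfolding W'_def by blast
      hence "f * w = f * x + (f * y) * b" "f * x \<in> W" "f * y \<in> F"
        using \<open>f \<in> F\<close> modW mult by (auto simp: algebra_simps)
      thus "f * w \<in> W'" unfolding W'_def by blast
    qed
    hence "V.dim F = 0" using max dim by fastforce
    hence "F \<subseteq> {0}" using V.dim_eq_0 by simp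
    thus False using one by auto
  qed
  thus ?thesis using dvdW unfolding degree_over_rat_def by simp
qed

context place begin

lemma v_of_nat_eq_power:
  assumes l: "Factorial_Ring.prime (l::nat)" and vl: "v (of_nat l) < 1" and m: "m > 0"
  obtains j where "v (of_nat m) = v (of_nat l) ^ j"
proof -
  obtain m' where m': "m = l ^ multiplicity l m * m'" "\<not> l dvd m'"
    using multiplicity_decompose'[of m l] m l by (metis not_prime_unit neq0_conv)
  have "coprime m' l" using m'(2) l by (metis coprime_commute prime_imp_coprime)
  hence "v (of_nat m') = 1" by (rule v_of_nat_eq_1[OF vl])
  hence "v (of_nat m) = v (of_nat l) ^ multiplicity l m"
    by (subst m'(1)) simp
  thus ?thesis by (rule that)
qed

lemma v_of_rat_eq_power_int:
  assumes l: "Factorial_Ring.prime (l::nat)" and vl: "v (of_nat l) < 1" and q: "q \<noteq> 0"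
  obtains j where "v (of_rat q) = v (of_nat l) powi j"
proof -
  define w where "w = v (of_nat l)"
  have w: "w \<noteq> 0" using l unfolding w_def by auto
  have int: "\<exists>j. v (of_int a) = w ^ j" if "a \<noteq> 0" for a
  proof -
    have "of_int a = (of_nat (nat \<bar>a\<bar>) :: 'k) \<or> of_int a = (- of_nat (nat \<bar>a\<bar>) :: 'k)"
      by (cases "a \<ge> 0") auto
    hence "v (of_int a) = v (of_nat (nat \<bar>a\<bar>))" by (metis v_minus)
    thus ?thesis using v_of_nat_eq_power[OF l vl, of "nat \<bar>a\<bar>"] that unfolding w_def
      by (metis zero_less_abs_iff zero_less_nat_eq)
  qed
  obtain a b where ab: "quotient_of q = (a, b)" by fastforce
  hence qab: "q = of_int a / of_int b" "b > 0"
    by (auto simp: quotient_of_div quotient_of_denom_pos)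
  hence "a \<noteq> 0" using q by auto
  then obtain i j where "v (of_int a) = w ^ i" "v (of_int b) = w ^ j"
    using int[of a] int[of b] qab(2) by auto
  hence "v (of_rat q) = w ^ i / w ^ j" by (simp add: qab(1) of_rat_divide)
  also have "\<dots> = w powi (int i - int j)" using w by (simp add: power_int_diff)
  finally show ?thesis using that unfolding w_def by blast
qed

text \<open>
  The powers \<open>1, x, \<dots>, x\<^sup>e\<^sup>-\<^sup>1\<close> of an element with \<open>v x\<^sup>e = v \<ell>\<close> have absolute values in different
  cosets of \<open>v \<rat>\<^sup>\<times>\<close>, so they are linearly independent over \<open>\<rat>\<close>.
\<close>

lemma e_le_dim_powers:
  fixes x :: 'k
  assumes nf: "number_field TYPE('k)"
    and l: "Factorial_Ring.prime (l::nat)" and vl: "v (of_nat l) < 1"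
    and vx: "v x ^ e = v (of_nat l)"
    and F: "\<And>i. x ^ i \<in> F"
  shows "e \<le> vector_space.dim (\<lambda>q x. of_rat q * x) F"
proof -
  let ?sc = "\<lambda>q (x :: 'k). of_rat q * x"
  obtain B where "finite_dimensional_vector_space ?sc B" using number_field_basis[OF nf] .
  then interpret V: finite_dimensional_vector_space ?sc B .
  define w where "w = v (of_nat l)"
  have w: "0 < w" "w < 1" using l vl v_nonneg[of "of_nat l"] unfolding w_def
    by (auto simp: less_le)
  have wx: "v x > 0"
  proof (rule ccontr)
    assume "\<not> v x > 0"
    hence "v x = 0" using v_nonneg[of x] by linarith
    hence "w = 0 ^ e" using vx unfolding w_def by simp
    thus False using w by (cases e) auto
  qed
  have val: "\<exists>j. v (of_rat q * x ^ i) ^ e = w powi (j * int e + int i)" if q: "q \<noteq> 0" for q i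
  proof -
    obtain j where "v (of_rat q) = w powi j" using v_of_rat_eq_power_int[OF l vl q] unfolding w_def .
    hence "v (of_rat q * x ^ i) ^ e = (w powi j) ^ e * (v x ^ e) ^ i"
      by (simp add: power_mult_distrib flip: power_mult) (simp add: mult.commute)
    also have "\<dots> = w powi (j * int e) * w powi int i"
      using vx unfolding w_def by (simp add: power_int_mult)
    also have "\<dots> = w powi (j * int e + int i)" using w by (simp add: power_int_add)
    finally show ?thesis by blast
  qed
  have inj_w: "i = j" if "w powi i = w powi j" for i j
  proof -
    have "\<not> i < j" "\<not> j < i"
      using power_int_strict_decreasing[of i j w] power_int_strict_decreasing[of j i w] that w by auto
    thus ?thesis by simp
  qed
  have distinct: "i = i'"
    if asm: "q \<noteq> 0" "q' \<noteq> 0" "i < e" "i' < e" "v (of_rat q * x ^ i) = v (of_rat q' * x ^ i')" for q q' i i'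
  proof -
    obtain j j' where "w powi (j * int e + int i) = w powi (j' * int e + int i')"
      using val[OF asm(1), of i] val[OF asm(2), of i'] asm(5) by metis
    hence "(j * int e + int i) mod int e = (j' * int e + int i') mod int e" using inj_w by metis
    thus ?thesis using that(3,4) by simp
  qed
  have inj: "inj_on (\<lambda>i. x ^ i) {..<e}"
  proof (rule inj_onI)
    fix i j assume "i \<in> {..<e}" "j \<in> {..<e}" "x ^ i = x ^ j"
    thus "i = j" using distinct[of 1 1 i j] arg_cong[of "x ^ i" "x ^ j" v] by simp
  qed
  have "V.independent ((\<lambda>i. x ^ i) ` {..<e})"
  proof
    assume "V.dependent ((\<lambda>i. x ^ i) ` {..<e})"
    then obtain u k where u: "k < e" "u (x ^ k) \<noteq> 0" "(\<Sum>i<e. of_rat (u (x ^ i)) * x ^ i) = 0"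
      by (auto simp: V.dependent_finite sum.reindex[OF inj])
    define A where "A = {i. i < e \<and> u (x ^ i) \<noteq> 0}"
    have "(\<Sum>i\<in>A. of_rat (u (x ^ i)) * x ^ i) \<noteq> 0"
    proof (rule sum_nonzero_if_distinct_values)
      show "inj_on (\<lambda>i. v (of_rat (u (x ^ i)) * x ^ i)) A"
        unfolding A_def by (rule inj_onI) (use distinct in blast)
      show "k \<in> A" "of_rat (u (x ^ k)) * x ^ k \<noteq> 0" using u(1,2) wx unfolding A_def by auto
    qed (simp add: A_def)
    moreover have "(\<Sum>i\<in>A. of_rat (u (x ^ i)) * x ^ i) = (\<Sum>i<e. of_rat (u (x ^ i)) * x ^ i)"
      unfolding A_def by (rule sum.mono_neutral_left) auto
    ultimately show False using u(3) by simp
  qed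
  hence "card ((\<lambda>i. x ^ i) ` {..<e}) \<le> V.dim F"
    using F by (intro V.independent_card_le_dim) auto
  thus ?thesis using inj by (simp add: card_image)
qed

text \<open>
  The relation expresses \<open>D\<^sub>e(t)\<close> by \<open>D\<^sub>0(t), \<dots>, D\<^sub>e\<^sub>-\<^sub>1(t)\<close>.  Since
  \<open>t D\<^sub>k = D\<^sub>k\<^sub>+\<^sub>1 + D\<^sub>k\<^sub>-\<^sub>1\<close>, these \<open>e\<close> elements span the ring \<open>\<rat>[t]\<close>; its dimension is not smaller
  than \<open>e\<close> because of the ramification.
\<close>

lemma ramification_dvd_degree:
  fixes t :: 'k
  assumes nf: "number_field TYPE('k)"
    and l: "Factorial_Ring.prime (l::nat)" and vl: "v (of_nat l) < 1"
    and vt: "v (2 - t) ^ e = v (of_nat l)"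
    and rel: "1 + (\<Sum>k=1..e. dickson t k) = 0"
  shows "e dvd degree_over_rat TYPE('k)"
proof -
  let ?sc = "\<lambda>q (x :: 'k). of_rat q * x"
  obtain B where "finite_dimensional_vector_space ?sc B" using number_field_basis[OF nf] .
  then interpret V: finite_dimensional_vector_space ?sc B .
  have e: "e > 0" using rel by (cases e) auto
  define x where "x = 2 - t"
  define F where "F = V.span (range (\<lambda>i. x ^ i))"
  define G where "G = V.span (dickson t ` {..<e})"
  have F_mult: "a * b \<in> F" if a: "a \<in> F" and b: "b \<in> F" for a b
  proof -
    have pow: "x ^ i * b \<in> F" for i
      using b unfolding F_def
    proof (induction rule: V.span_induct_alt)
      case (step c y z)
      then obtain j where "y = x ^ j" by blast
      hence "x ^ i * (of_rat c * y + z) = of_rat c * x ^ (i + j) + x ^ i * z"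
        by (simp add: algebra_simps power_add)
      moreover have "of_rat c * x ^ (i + j) \<in> V.span (range (\<lambda>i. x ^ i))"
        by (intro V.span_scale V.span_base) auto
      ultimately show ?case using step by (simp only: V.span_add)
    qed (simp add: V.span_zero)
    show ?thesis using a unfolding F_def
    proof (induction rule: V.span_induct_alt)
      case (step c y z)
      have "(of_rat c * y + z) * b = of_rat c * (y * b) + z * b" by (simp add: algebra_simps)
      moreover have "y * b \<in> V.span (range (\<lambda>i. x ^ i))"
        using step(1) pow unfolding F_def by auto
      ultimately show ?case using step by (simp only: V.span_add V.span_scale)
    qed (simp add: V.span_zero)
  qed
  have D_in_G: "dickson t k \<in> G" if "k \<le> e" for k
  proof (cases "k = e")
    case True
    have "(\<Sum>k=1..e. dickson t k) = (\<Sum>k=1..<e. dickson t k) + dickson t e"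
      using e by (simp add: sum.last_plus add.commute)
    hence "dickson t e = - 1 - (\<Sum>k=1..<e. dickson t k)" using rel
      by (metis (no_types, lifting) add_diff_cancel_left' add.commute diff_0 diff_diff_eq2 minus_diff_eq)
    also have "\<dots> = of_rat (- 1 / 2) * dickson t 0 - (\<Sum>k=1..<e. dickson t k)"
      by (simp add: of_rat_divide of_rat_minus)
    also have "\<dots> \<in> G" unfolding G_def using e
      by (intro V.span_diff V.span_scale V.span_sum V.span_base imageI) auto
    finally show ?thesis using True by simp
  qed (use that in \<open>auto simp: G_def intro: V.span_base\<close>)
  have G_mult: "x * a \<in> G" if "a \<in> G" for a
    using that unfolding G_def
  proof (induction rule: V.span_induct_alt)
    case (step c y z)
    then obtain k where k: "k < e" "y = dickson t k" by blast
    have "t * dickson t k \<in> G"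
    proof (cases k)
      case 0
      have "t * dickson t 0 = of_rat 2 * dickson t 1" by simp
      moreover have "dickson t 1 \<in> G" using e by (intro D_in_G) simp
      ultimately show ?thesis using 0 unfolding G_def by (metis V.span_scale)
    next
      case (Suc j)
      have "t * dickson t k = dickson t (Suc (Suc j)) + dickson t j" using Suc by simp
      moreover have "dickson t (Suc (Suc j)) \<in> G" "dickson t j \<in> G"
        using D_in_G[of "Suc (Suc j)"] D_in_G[of j] k(1) Suc by (simp_all del: dickson.simps)
      ultimately show ?thesis unfolding G_def by (simp only: V.span_add)
    qed
    moreover have "x * (of_rat c * y + z) = of_rat c * (of_rat 2 * y - t * dickson t k) + x * z"
      unfolding x_def k(2) by (simp add: algebra_simps)
    moreover have "y \<in> G" using D_in_G k by simp
    ultimately show ?case using step.IH unfolding G_def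
      by (simp only:) (intro V.span_add V.span_scale V.span_diff)
  qed (simp add: V.span_zero)
  have "x ^ i \<in> G" for i
  proof (induction i)
    case 0
    have "of_rat (1 / 2) * dickson t 0 \<in> G"
      unfolding G_def using e by (intro V.span_scale V.span_base imageI) auto
    thus ?case by (simp add: of_rat_divide)
  qed (simp add: G_mult)
  hence "V.dim F \<le> card (dickson t ` {..<e})"
    unfolding F_def G_def by (intro V.dim_le_card V.span_minimal) auto
  also have "\<dots> \<le> e" using card_image_le[of "{..<e}"] by fastforce
  finally have "V.dim F \<le> e" .
  moreover have "x ^ i \<in> F" for i unfolding F_def by (intro V.span_base) auto
  moreover from this have "e \<le> V.dim F"
    using vt by (intro e_le_dim_powers[OF nf l vl]) (auto simp: x_def)
  moreover have "V.dim F dvd degree_over_rat TYPE('k)"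
    using F_mult calculation(2)[of 0] by (intro dim_subring_dvd_degree[OF nf]) (auto simp: F_def)
  ultimately show ?thesis by (metis le_antisym)
qed

text \<open>
  It is enough to treat a power of \<open>r\<close> of prime order \<open>\<ell>\<close>, since congruence to \<open>2\<close> is preserved by
  Dickson polynomials.
\<close>

lemma exceptional_prime_if_finite_order:
  fixes r :: "'k alg_closure"
  assumes nf: "number_field TYPE('k)"
    and t: "to_ac t = r + inverse r" "v (t - 2) < 1"
    and r: "r \<noteq> 1" "r ^ m = 1" and m: "m > 0" "m dvd d * (d\<^sup>2 - 1)"
  shows "\<exists>p\<in>S0 TYPE('k) d. v (of_nat p) < 1"
proof -
  obtain n where n: "n > 0" "has_order r n" using has_order_exists[OF r(2) m(1)] .
  have "n \<noteq> 1" using has_orderD[OF n(2), of 1] r(1) by auto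
  then obtain l where l: "Factorial_Ring.prime l" "l dvd n"
    using prime_factor_nat by blast
  have l0: "l > 0" using l(1) prime_gt_0_nat by blast
  define s where "s = r ^ (n div l)"
  define u where "u = dickson t (n div l)"
  have s: "has_order s l" unfolding s_def by (rule has_order_power[OF n(2) l(2) n(1)])
  have r0: "r \<noteq> 0" using r(2) m(1) by (auto simp: power_0_left)
  have u: "to_ac u = s + inverse s"
    unfolding u_def s_def to_ac_dickson t(1) dickson_add_inverse[OF r0] by (simp add: power_inverse)
  have vu: "v (u - 2) < 1" unfolding u_def by (rule v_dickson_near_2[OF t(2)])
  have "to_ac (\<Prod>k=1..<l. 2 - dickson u k) = (\<Prod>k=1..<l. 2 - dickson (s + inverse s) k)"
    by (simp only: to_ac_prod to_ac_diff to_ac_dickson to_ac_numeral u)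
  also have "\<dots> = to_ac ((of_nat l)\<^sup>2)"
    by (subst prod_two_minus_dickson[OF s l0]) simp
  finally have prod: "(\<Prod>k=1..<l. 2 - dickson u k) = (of_nat l)\<^sup>2" by (simp only: to_ac_eq_iff)
  have vl: "v (of_nat l) < 1" and ram: "v (2 - u) ^ (l - 1) = (v (of_nat l))\<^sup>2"
    by (rule ramification[OF vu l(1) prod])+
  have "l \<in> S0 TYPE('k) d"
  proof (cases "l = 2")
    case True thus ?thesis unfolding S0_def by simp
  next
    case False
    hence "odd l" using l(1) prime_odd_nat[of l] prime_ge_2_nat[of l] by fastforce
    then obtain e where e: "l = 2 * e + 1" by (elim oddE)
    have "e > 0" using e l(1) by (cases e) auto
    have "(v (2 - u) ^ e)\<^sup>2 = (v (of_nat l))\<^sup>2"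
      using ram e by (simp add: mult.commute flip: power_mult)
    hence "v (2 - u) ^ e = v (of_nat l)" by (simp add: power2_eq_iff_nonneg)
    moreover have "to_ac (1 + (\<Sum>k=1..e. dickson u k)) = to_ac 0"
      using sum_dickson[of s e] s \<open>e > 0\<close> unfolding e
      by (simp only: to_ac_add to_ac_sum to_ac_dickson to_ac_1 to_ac_0 u)
    hence "1 + (\<Sum>k=1..e. dickson u k) = 0" by (simp only: to_ac_eq_iff)
    ultimately have "e dvd degree_over_rat TYPE('k)"
      by (rule ramification_dvd_degree[OF nf l(1) vl])
    moreover have "l dvd d * (d\<^sup>2 - 1)"
      using l(2) m(2) r(2) has_orderD[OF n(2), of m] dvd_trans by blast
    ultimately show ?thesis using l(1) \<open>odd l\<close> e unfolding S0_def by simp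
  qed
  thus ?thesis using vl by blast
qed

end

section \<open>Fractions in lowest terms\<close>

locale UP_field = UP + R?: field R

sublocale UP_field < UP_domain
  by intro_locales [1] (rule P_def)

context UP_field
begin

text \<open>
  A nonzero element of least degree in the ideal generated by \<open>A\<close> and \<open>B\<close> divides both of them, by
  division with remainder.
\<close>

lemma ideal_bezout:
  assumes A: "A \<in> carrier P" and B: "B \<in> carrier P" and nz: "A \<noteq> \<zero>\<^bsub>P\<^esub> \<or> B \<noteq> \<zero>\<^bsub>P\<^esub>"
  obtains G U V where "G \<in> carrier P" "U \<in> carrier P" "V \<in> carrier P" "G \<noteq> \<zero>\<^bsub>P\<^esub>"
    "G = U \<otimes>\<^bsub>P\<^esub> A \<oplus>\<^bsub>P\<^esub> V \<otimes>\<^bsub>P\<^esub> B" "G divides\<^bsub>P\<^esub> A" "G divides\<^bsub>P\<^esub> B"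
proof -
  define I where "I = (PIdl\<^bsub>P\<^esub> A) <+>\<^bsub>P\<^esub> (PIdl\<^bsub>P\<^esub> B)"
  interpret I: ideal I P
    unfolding I_def by (intro P.add_ideals P.cgenideal_ideal A B)
  have I_elem: "\<exists>U\<in>carrier P. \<exists>V\<in>carrier P. S = U \<otimes>\<^bsub>P\<^esub> A \<oplus>\<^bsub>P\<^esub> V \<otimes>\<^bsub>P\<^esub> B" if "S \<in> I" for S
    using that unfolding I_def set_add_def' cgenideal_def by blast
  have "A = A \<oplus>\<^bsub>P\<^esub> \<zero>\<^bsub>P\<^esub>" "B = \<zero>\<^bsub>P\<^esub> \<oplus>\<^bsub>P\<^esub> B" using A B by simp_all
  moreover have "A \<in> PIdl\<^bsub>P\<^esub> A" "B \<in> PIdl\<^bsub>P\<^esub> B" "\<zero>\<^bsub>P\<^esub> \<in> PIdl\<^bsub>P\<^esub> A" "\<zero>\<^bsub>P\<^esub> \<in> PIdl\<^bsub>P\<^esub> B"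
    using P.cgenideal_self P.cgenideal_ideal[OF A] P.cgenideal_ideal[OF B] A B
    by (auto intro: additive_subgroup.zero_closed ideal.axioms)
  ultimately have "\<exists>h\<in>PIdl\<^bsub>P\<^esub> A. \<exists>k\<in>PIdl\<^bsub>P\<^esub> B. A = h \<oplus>\<^bsub>P\<^esub> k"
    "\<exists>h\<in>PIdl\<^bsub>P\<^esub> A. \<exists>k\<in>PIdl\<^bsub>P\<^esub> B. B = h \<oplus>\<^bsub>P\<^esub> k" by metis+
  hence AB: "A \<in> I" "B \<in> I"
    unfolding I_def set_add_def' by simp_all
  define good where "good = (\<lambda>G. G \<in> I \<and> G \<noteq> \<zero>\<^bsub>P\<^esub>)"
  have "good A \<or> good B" using AB nz unfolding good_def by auto
  then obtain G where "good G" "\<forall>S. good S \<longrightarrow> deg R G \<le> deg R S"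
    using ex_has_least_nat[of good _ "deg R"] by metis
  hence G: "G \<in> I" "G \<noteq> \<zero>\<^bsub>P\<^esub>"
    and min: "\<And>S. S \<in> I \<Longrightarrow> S \<noteq> \<zero>\<^bsub>P\<^esub> \<Longrightarrow> deg R G \<le> deg R S"
    unfolding good_def by auto
  have GP: "G \<in> carrier P" using G(1) I.a_subset by blast
  have dvd: "G divides\<^bsub>P\<^esub> S" if S: "S \<in> I" for S
  proof -
    have SP: "S \<in> carrier P" using S I.a_subset by blast
    obtain q r k where qr: "q \<in> carrier P" "r \<in> carrier P"
      "up_ring.coeff P G (deg R G) [^] (k::nat) \<odot>\<^bsub>P\<^esub> S = G \<otimes>\<^bsub>P\<^esub> q \<oplus>\<^bsub>P\<^esub> r"
      "r = \<zero>\<^bsub>P\<^esub> \<or> deg R r < deg R G"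
      using long_div_theorem[OF GP SP G(2)] by blast
    define c where "c = up_ring.coeff P G (deg R G) [^] k"
    have "up_ring.coeff P G (deg R G) \<noteq> \<zero>" using GP G(2) lcoeff_nonzero by simp
    hence "up_ring.coeff P G (deg R G) \<in> Units R" using GP field_Units by simp
    hence "c \<in> Units R" unfolding c_def by (rule R.Units_pow_closed)
    hence c: "c \<in> carrier R" "c \<noteq> \<zero>" using field_Units by auto
    hence inv_c: "inv c \<in> carrier R" "inv c \<otimes> c = \<one>"
      using field_Units by auto
    have cS: "c \<odot>\<^bsub>P\<^esub> S = up_ring.monom P c 0 \<otimes>\<^bsub>P\<^esub> S" using c SP by (simp add: monom_mult_is_smult)
    have "r = up_ring.coeff P G (deg R G) [^] k \<odot>\<^bsub>P\<^esub> S \<ominus>\<^bsub>P\<^esub> G \<otimes>\<^bsub>P\<^esub> q"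
      using qr(1,2) GP unfolding qr(3)
      by (simp add: P.minus_eq P.a_comm[of "G \<otimes>\<^bsub>P\<^esub> q" r] P.a_assoc P.r_neg)
    hence "r = c \<odot>\<^bsub>P\<^esub> S \<ominus>\<^bsub>P\<^esub> G \<otimes>\<^bsub>P\<^esub> q" unfolding c_def .
    moreover have "c \<odot>\<^bsub>P\<^esub> S \<in> I" unfolding cS using c S by (simp add: I.I_l_closed)
    moreover have "G \<otimes>\<^bsub>P\<^esub> q \<in> I" using G qr by (simp add: I.I_r_closed)
    ultimately have "r \<in> I" by (simp add: P.minus_eq)
    hence "r = \<zero>\<^bsub>P\<^esub>" using qr(4) min[of r] by force
    hence "c \<odot>\<^bsub>P\<^esub> S = G \<otimes>\<^bsub>P\<^esub> q" using qr GP unfolding c_def by simp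
    hence "inv c \<odot>\<^bsub>P\<^esub> (c \<odot>\<^bsub>P\<^esub> S) = inv c \<odot>\<^bsub>P\<^esub> (G \<otimes>\<^bsub>P\<^esub> q)" by simp
    hence "S = G \<otimes>\<^bsub>P\<^esub> (inv c \<odot>\<^bsub>P\<^esub> q)"
      using c inv_c SP GP qr(1) by (simp add: smult_assoc1[symmetric] UP_smult_assoc2 P.m_comm[of G])
    thus ?thesis using inv_c qr(1) by (intro dividesI) auto
  qed
  obtain U V where UV: "U \<in> carrier P" "V \<in> carrier P" "G = U \<otimes>\<^bsub>P\<^esub> A \<oplus>\<^bsub>P\<^esub> V \<otimes>\<^bsub>P\<^esub> B"
    using I_elem[OF G(1)] by blast
  show ?thesis by (rule that[OF GP UV(1,2) G(2) UV(3) dvd[OF AB(1)] dvd[OF AB(2)]])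
qed

lemma Units_imp_constant:
  assumes "H \<in> Units P"
  obtains c where "c \<in> carrier R" "c \<noteq> \<zero>" "H = up_ring.monom P c 0"
proof -
  obtain J where J: "H \<in> carrier P" "J \<in> carrier P" "H \<otimes>\<^bsub>P\<^esub> J = \<one>\<^bsub>P\<^esub>"
    using assms unfolding Units_def by auto
  hence nz: "H \<noteq> \<zero>\<^bsub>P\<^esub>" "J \<noteq> \<zero>\<^bsub>P\<^esub>" by auto
  hence "deg R H + deg R J = deg R \<one>\<^bsub>P\<^esub>" using deg_mult[OF nz J(1,2)] J(3) by simp
  hence "deg R H = 0" by simp
  hence H: "H = up_ring.monom P (up_ring.coeff P H 0) 0" using deg_zero_impl_monom J(1) by blast
  moreover have "up_ring.coeff P H 0 \<noteq> \<zero>"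
    using nz(1) H by (metis monom_zero)
  ultimately show ?thesis using that[of "up_ring.coeff P H 0"] coeff_closed[OF J(1)] by blast
qed

lemma lowest_termsI:
  assumes "A \<in> carrier P" "B \<in> carrier P" "U \<in> carrier P" "V \<in> carrier P"
    and UV: "U \<otimes>\<^bsub>P\<^esub> A \<oplus>\<^bsub>P\<^esub> V \<otimes>\<^bsub>P\<^esub> B \<in> Units P"
  shows "lowest_terms R A B"
  unfolding lowest_terms_def P_def[symmetric]
proof (intro conjI ballI impI)
  fix H assume H: "H \<in> carrier P" "H divides\<^bsub>P\<^esub> A \<and> H divides\<^bsub>P\<^esub> B"
  then obtain a b where ab: "a \<in> carrier P" "b \<in> carrier P" "A = H \<otimes>\<^bsub>P\<^esub> a" "B = H \<otimes>\<^bsub>P\<^esub> b"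
    unfolding factor_def by blast
  have "U \<otimes>\<^bsub>P\<^esub> A \<oplus>\<^bsub>P\<^esub> V \<otimes>\<^bsub>P\<^esub> B = H \<otimes>\<^bsub>P\<^esub> (U \<otimes>\<^bsub>P\<^esub> a \<oplus>\<^bsub>P\<^esub> V \<otimes>\<^bsub>P\<^esub> b)"
    using H ab assms(3,4) by (simp add: P.r_distr P.m_lcomm)
  hence "H \<otimes>\<^bsub>P\<^esub> (U \<otimes>\<^bsub>P\<^esub> a \<oplus>\<^bsub>P\<^esub> V \<otimes>\<^bsub>P\<^esub> b) \<in> Units P" using UV by simp
  moreover have "U \<otimes>\<^bsub>P\<^esub> a \<oplus>\<^bsub>P\<^esub> V \<otimes>\<^bsub>P\<^esub> b \<in> carrier P" using ab assms(3,4) by simp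
  ultimately show "H \<in> Units P" using H(1) P.unit_factor by blast
qed (use assms in auto)

lemma lowest_terms_bezout:
  assumes "lowest_terms R A B"
  obtains U V where "U \<in> carrier P" "V \<in> carrier P" "U \<otimes>\<^bsub>P\<^esub> A \<oplus>\<^bsub>P\<^esub> V \<otimes>\<^bsub>P\<^esub> B = \<one>\<^bsub>P\<^esub>"
proof -
  have AB: "A \<in> carrier P" "B \<in> carrier P"
    and low: "\<And>H. H \<in> carrier P \<Longrightarrow> H divides\<^bsub>P\<^esub> A \<Longrightarrow> H divides\<^bsub>P\<^esub> B \<Longrightarrow> H \<in> Units P"
    using assms unfolding lowest_terms_def P_def[symmetric] by auto
  have "A \<noteq> \<zero>\<^bsub>P\<^esub> \<or> B \<noteq> \<zero>\<^bsub>P\<^esub>"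
  proof (rule ccontr)
    assume "\<not> ?thesis"
    hence "A = \<zero>\<^bsub>P\<^esub>" "B = \<zero>\<^bsub>P\<^esub>" by simp_all
    hence "\<zero>\<^bsub>P\<^esub> divides\<^bsub>P\<^esub> A" "\<zero>\<^bsub>P\<^esub> divides\<^bsub>P\<^esub> B"
      unfolding factor_def by (auto intro!: bexI[of _ "\<zero>\<^bsub>P\<^esub>"])
    hence "\<zero>\<^bsub>P\<^esub> \<in> Units P" using low P.zero_closed by blast
    hence "\<zero>\<^bsub>P\<^esub> \<otimes>\<^bsub>P\<^esub> inv\<^bsub>P\<^esub> \<zero>\<^bsub>P\<^esub> = \<one>\<^bsub>P\<^esub>" by (rule P.Units_r_inv)
    thus False using P.Units_inv_closed[OF \<open>\<zero>\<^bsub>P\<^esub> \<in> Units P\<close>] P.l_null UP_one_not_zero by simp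
  qed
  then obtain G U V where G: "G \<in> carrier P" "U \<in> carrier P" "V \<in> carrier P"
    "G = U \<otimes>\<^bsub>P\<^esub> A \<oplus>\<^bsub>P\<^esub> V \<otimes>\<^bsub>P\<^esub> B" "G divides\<^bsub>P\<^esub> A" "G divides\<^bsub>P\<^esub> B"
    using ideal_bezout[OF AB] by metis
  hence GU: "G \<in> Units P" using low by blast
  have "(inv\<^bsub>P\<^esub> G \<otimes>\<^bsub>P\<^esub> U) \<otimes>\<^bsub>P\<^esub> A \<oplus>\<^bsub>P\<^esub> (inv\<^bsub>P\<^esub> G \<otimes>\<^bsub>P\<^esub> V) \<otimes>\<^bsub>P\<^esub> B = inv\<^bsub>P\<^esub> G \<otimes>\<^bsub>P\<^esub> G"
    using G AB GU by (subst (3) G(4)) (simp add: P.r_distr P.m_assoc)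
  also have "\<dots> = \<one>\<^bsub>P\<^esub>" using GU by simp
  finally show ?thesis using that[of "inv\<^bsub>P\<^esub> G \<otimes>\<^bsub>P\<^esub> U" "inv\<^bsub>P\<^esub> G \<otimes>\<^bsub>P\<^esub> V"] G GU by simp
qed

lemma lowest_terms_closed:
  assumes "lowest_terms R A B"
  shows "A \<in> carrier P" "B \<in> carrier P"
  using assms unfolding lowest_terms_def P_def[symmetric] by auto

lemma lowest_terms_nonzero:
  assumes "lowest_terms R A B"
  shows "A \<noteq> \<zero>\<^bsub>P\<^esub> \<or> B \<noteq> \<zero>\<^bsub>P\<^esub>"
proof -
  obtain U V where "U \<in> carrier P" "V \<in> carrier P" "U \<otimes>\<^bsub>P\<^esub> A \<oplus>\<^bsub>P\<^esub> V \<otimes>\<^bsub>P\<^esub> B = \<one>\<^bsub>P\<^esub>"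
    using lowest_terms_bezout[OF assms] .
  thus ?thesis by auto
qed

text \<open>With \<open>U A + V B = 1\<close>, the common factor is \<open>U S + V T\<close>.\<close>

lemma lowest_terms_factor:
  assumes low: "lowest_terms R A B" and ST: "S \<in> carrier P" "T \<in> carrier P"
    and eq: "S \<otimes>\<^bsub>P\<^esub> B = A \<otimes>\<^bsub>P\<^esub> T"
  obtains H where "H \<in> carrier P" "S = A \<otimes>\<^bsub>P\<^esub> H" "T = B \<otimes>\<^bsub>P\<^esub> H"
proof -
  note AB = lowest_terms_closed[OF low]
  obtain U V where UV: "U \<in> carrier P" "V \<in> carrier P" "U \<otimes>\<^bsub>P\<^esub> A \<oplus>\<^bsub>P\<^esub> V \<otimes>\<^bsub>P\<^esub> B = \<one>\<^bsub>P\<^esub>"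
    using lowest_terms_bezout[OF low] .
  define H where "H = U \<otimes>\<^bsub>P\<^esub> S \<oplus>\<^bsub>P\<^esub> V \<otimes>\<^bsub>P\<^esub> T"
  have "S = S \<otimes>\<^bsub>P\<^esub> (U \<otimes>\<^bsub>P\<^esub> A \<oplus>\<^bsub>P\<^esub> V \<otimes>\<^bsub>P\<^esub> B)" unfolding UV(3) using ST by simp
  also have "\<dots> = A \<otimes>\<^bsub>P\<^esub> (U \<otimes>\<^bsub>P\<^esub> S) \<oplus>\<^bsub>P\<^esub> V \<otimes>\<^bsub>P\<^esub> (S \<otimes>\<^bsub>P\<^esub> B)"
    using AB ST UV(1,2) by (simp add: P.r_distr P.m_ac)
  also have "\<dots> = A \<otimes>\<^bsub>P\<^esub> H"
    unfolding H_def eq using AB ST UV(1,2) by (simp add: P.r_distr P.m_ac)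
  finally have S: "S = A \<otimes>\<^bsub>P\<^esub> H" .
  have "T = T \<otimes>\<^bsub>P\<^esub> (U \<otimes>\<^bsub>P\<^esub> A \<oplus>\<^bsub>P\<^esub> V \<otimes>\<^bsub>P\<^esub> B)" unfolding UV(3) using ST by simp
  also have "\<dots> = U \<otimes>\<^bsub>P\<^esub> (A \<otimes>\<^bsub>P\<^esub> T) \<oplus>\<^bsub>P\<^esub> B \<otimes>\<^bsub>P\<^esub> (V \<otimes>\<^bsub>P\<^esub> T)"
    using AB ST UV(1,2) by (simp add: P.r_distr P.m_ac)
  also have "\<dots> = B \<otimes>\<^bsub>P\<^esub> H"
    unfolding H_def eq[symmetric] using AB ST UV(1,2) by (simp add: P.r_distr P.m_ac)
  finally have "T = B \<otimes>\<^bsub>P\<^esub> H" .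
  thus ?thesis using that[of H] S UV ST unfolding H_def by simp
qed

lemma lowest_terms_smult:
  assumes low: "lowest_terms R A B" and c: "c \<in> carrier R" "c \<noteq> \<zero>"
  shows "lowest_terms R (c \<odot>\<^bsub>P\<^esub> A) (c \<odot>\<^bsub>P\<^esub> B)"
proof -
  note AB = lowest_terms_closed[OF low]
  obtain U V where UV: "U \<in> carrier P" "V \<in> carrier P" "U \<otimes>\<^bsub>P\<^esub> A \<oplus>\<^bsub>P\<^esub> V \<otimes>\<^bsub>P\<^esub> B = \<one>\<^bsub>P\<^esub>"
    using lowest_terms_bezout[OF low] .
  have c': "inv c \<in> carrier R" "inv c \<otimes> c = \<one>" using c field_Units by auto
  show ?thesis
  proof (rule lowest_termsI)
    have "(inv c \<odot>\<^bsub>P\<^esub> W) \<otimes>\<^bsub>P\<^esub> (c \<odot>\<^bsub>P\<^esub> S) = W \<otimes>\<^bsub>P\<^esub> S" if "W \<in> carrier P" "S \<in> carrier P" for W S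
    proof -
      have "(inv c \<odot>\<^bsub>P\<^esub> W) \<otimes>\<^bsub>P\<^esub> (c \<odot>\<^bsub>P\<^esub> S) = inv c \<odot>\<^bsub>P\<^esub> (c \<odot>\<^bsub>P\<^esub> (W \<otimes>\<^bsub>P\<^esub> S))"
        using that c c' by (simp add: UP_smult_assoc2 P.m_comm[of W])
      also have "\<dots> = (inv c \<otimes> c) \<odot>\<^bsub>P\<^esub> (W \<otimes>\<^bsub>P\<^esub> S)"
        using that c c'(1) by (simp only: UP_smult_assoc1 P.m_closed)
      finally show ?thesis using that c'(2) by simp
    qed
    thus "(inv c \<odot>\<^bsub>P\<^esub> U) \<otimes>\<^bsub>P\<^esub> (c \<odot>\<^bsub>P\<^esub> A) \<oplus>\<^bsub>P\<^esub> (inv c \<odot>\<^bsub>P\<^esub> V) \<otimes>\<^bsub>P\<^esub> (c \<odot>\<^bsub>P\<^esub> B) \<in> Units P"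
      using UV AB by simp
  qed (use AB UV c c' in auto)
qed

text \<open>
  The representatives of a fraction are unique up to nonzero constants.  Everything that is defined by a
  union over representatives is evaluated by means of this description.
\<close>

lemma rat_frac_lowest:
  assumes low: "lowest_terms R A B"
  shows "rat_frac R A B = {(c \<odot>\<^bsub>P\<^esub> A, c \<odot>\<^bsub>P\<^esub> B) | c. c \<in> carrier R \<and> c \<noteq> \<zero>}"
proof (intro equalityI subsetI)
  note AB = lowest_terms_closed[OF low]
  fix z assume "z \<in> rat_frac R A B"
  then obtain S T where z: "z = (S, T)" and ST: "lowest_terms R S T" "A \<otimes>\<^bsub>P\<^esub> T = S \<otimes>\<^bsub>P\<^esub> B"
    unfolding rat_frac_def P_def[symmetric] by auto
  note STP = lowest_terms_closed[OF ST(1)]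
  obtain H where H: "H \<in> carrier P" "S = A \<otimes>\<^bsub>P\<^esub> H" "T = B \<otimes>\<^bsub>P\<^esub> H"
    using lowest_terms_factor[OF low STP ST(2)[symmetric]] by blast
  have "H divides\<^bsub>P\<^esub> S" "H divides\<^bsub>P\<^esub> T" using H AB by (auto simp: P.m_comm[of _ H])
  hence "H \<in> Units P" using ST(1) H(1) unfolding lowest_terms_def P_def[symmetric] by blast
  then obtain c where c: "c \<in> carrier R" "c \<noteq> \<zero>" "H = up_ring.monom P c 0" by (rule Units_imp_constant)
  have "S = c \<odot>\<^bsub>P\<^esub> A" "T = c \<odot>\<^bsub>P\<^esub> B"
    using monom_mult_is_smult[OF c(1), of A] monom_mult_is_smult[OF c(1), of B] H AB
    unfolding c(3) by (simp_all add: P.m_comm)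
  thus "z \<in> {(c \<odot>\<^bsub>P\<^esub> A, c \<odot>\<^bsub>P\<^esub> B) | c. c \<in> carrier R \<and> c \<noteq> \<zero>}" using z c by blast
next
  note AB = lowest_terms_closed[OF low]
  fix z assume "z \<in> {(c \<odot>\<^bsub>P\<^esub> A, c \<odot>\<^bsub>P\<^esub> B) | c. c \<in> carrier R \<and> c \<noteq> \<zero>}"
  then obtain c where c: "z = (c \<odot>\<^bsub>P\<^esub> A, c \<odot>\<^bsub>P\<^esub> B)" "c \<in> carrier R" "c \<noteq> \<zero>" by blast
  have "A \<otimes>\<^bsub>P\<^esub> (c \<odot>\<^bsub>P\<^esub> B) = (c \<odot>\<^bsub>P\<^esub> A) \<otimes>\<^bsub>P\<^esub> B"
    using AB c by (simp add: P.m_comm[of A] UP_smult_assoc2)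
  thus "z \<in> rat_frac R A B"
    using c lowest_terms_smult[OF low] unfolding rat_frac_def P_def[symmetric] by simp
qed

lemma lowest_terms_mem_rat_frac: "lowest_terms R A B \<Longrightarrow> (A, B) \<in> rat_frac R A B"
  using lowest_terms_closed unfolding rat_frac_def P_def[symmetric] by (auto simp: P.m_comm)

lemma rat_frac_cancel:
  assumes "A \<in> carrier P" "B \<in> carrier P" "H \<in> carrier P" "H \<noteq> \<zero>\<^bsub>P\<^esub>"
  shows "rat_frac R (H \<otimes>\<^bsub>P\<^esub> A) (H \<otimes>\<^bsub>P\<^esub> B) = rat_frac R A B"
proof -
  have "H \<otimes>\<^bsub>P\<^esub> A \<otimes>\<^bsub>P\<^esub> T = S \<otimes>\<^bsub>P\<^esub> (H \<otimes>\<^bsub>P\<^esub> B) \<longleftrightarrow> A \<otimes>\<^bsub>P\<^esub> T = S \<otimes>\<^bsub>P\<^esub> B"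
    if "S \<in> carrier P" "T \<in> carrier P" for S T
  proof -
    have "H \<otimes>\<^bsub>P\<^esub> A \<otimes>\<^bsub>P\<^esub> T = H \<otimes>\<^bsub>P\<^esub> (A \<otimes>\<^bsub>P\<^esub> T)" "S \<otimes>\<^bsub>P\<^esub> (H \<otimes>\<^bsub>P\<^esub> B) = H \<otimes>\<^bsub>P\<^esub> (S \<otimes>\<^bsub>P\<^esub> B)"
      using that assms by (simp_all add: P.m_ac)
    thus ?thesis using that assms domain.m_lcancel[OF UP_domain, of H "A \<otimes>\<^bsub>P\<^esub> T" "S \<otimes>\<^bsub>P\<^esub> B"] by simp
  qed
  thus ?thesis
    using lowest_terms_closed unfolding rat_frac_def P_def[symmetric] by blast
qed

lemma rat_frac_smult:
  assumes "A \<in> carrier P" "B \<in> carrier P" "c \<in> carrier R" "c \<noteq> \<zero>"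
  shows "rat_frac R (c \<odot>\<^bsub>P\<^esub> A) (c \<odot>\<^bsub>P\<^esub> B) = rat_frac R A B"
proof -
  have "up_ring.monom P c 0 \<noteq> \<zero>\<^bsub>P\<^esub>"
  proof
    assume "up_ring.monom P c 0 = \<zero>\<^bsub>P\<^esub>"
    hence "up_ring.coeff P (up_ring.monom P c 0) 0 = up_ring.coeff P \<zero>\<^bsub>P\<^esub> 0" by simp
    thus False using assms by simp
  qed
  thus ?thesis
    using rat_frac_cancel[of A B "up_ring.monom P c 0"] assms by (simp add: monom_mult_is_smult)
qed

lemma rat_degree_lowest:
  assumes low: "lowest_terms R A B"
  shows "rat_degree R (rat_frac R A B) = max (deg R A) (deg R B)"
proof -
  note AB = lowest_terms_closed[OF low]
  let ?d = "\<lambda>(P, Q). max (deg R P) (deg R Q)"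
  have "?d z = max (deg R A) (deg R B)" if "z \<in> rat_frac R A B" for z
    using that AB unfolding rat_frac_lowest[OF low] by auto
  moreover have "?d (A, B) \<in> ?d ` rat_frac R A B"
    using lowest_terms_mem_rat_frac[OF low] by (rule imageI)
  ultimately have "?d ` rat_frac R A B = {max (deg R A) (deg R B)}" by auto
  thus ?thesis unfolding rat_degree_def by simp
qed

lemma lowest_terms_exists:
  assumes "S \<in> carrier P" "T \<in> carrier P" "S \<noteq> \<zero>\<^bsub>P\<^esub> \<or> T \<noteq> \<zero>\<^bsub>P\<^esub>"
  obtains A B G where "lowest_terms R A B" "G \<in> carrier P" "G \<noteq> \<zero>\<^bsub>P\<^esub>"
    "S = G \<otimes>\<^bsub>P\<^esub> A" "T = G \<otimes>\<^bsub>P\<^esub> B" "rat_frac R S T = rat_frac R A B"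
proof -
  obtain G U V where G: "G \<in> carrier P" "U \<in> carrier P" "V \<in> carrier P" "G \<noteq> \<zero>\<^bsub>P\<^esub>"
    "G = U \<otimes>\<^bsub>P\<^esub> S \<oplus>\<^bsub>P\<^esub> V \<otimes>\<^bsub>P\<^esub> T" "G divides\<^bsub>P\<^esub> S" "G divides\<^bsub>P\<^esub> T"
    using ideal_bezout[OF assms] .
  then obtain A B where AB: "A \<in> carrier P" "B \<in> carrier P" "S = G \<otimes>\<^bsub>P\<^esub> A" "T = G \<otimes>\<^bsub>P\<^esub> B"
    unfolding factor_def by blast
  have "G \<otimes>\<^bsub>P\<^esub> (U \<otimes>\<^bsub>P\<^esub> A \<oplus>\<^bsub>P\<^esub> V \<otimes>\<^bsub>P\<^esub> B) =
      U \<otimes>\<^bsub>P\<^esub> (G \<otimes>\<^bsub>P\<^esub> A) \<oplus>\<^bsub>P\<^esub> V \<otimes>\<^bsub>P\<^esub> (G \<otimes>\<^bsub>P\<^esub> B)"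
    using G(1-3) AB(1,2) by (simp add: P.r_distr P.m_lcomm)
  also have "\<dots> = G" using G(5) unfolding AB(3,4) by (rule sym)
  also have "G = G \<otimes>\<^bsub>P\<^esub> \<one>\<^bsub>P\<^esub>" using G(1) by simp
  finally have "U \<otimes>\<^bsub>P\<^esub> A \<oplus>\<^bsub>P\<^esub> V \<otimes>\<^bsub>P\<^esub> B = \<one>\<^bsub>P\<^esub>"
    using domain.m_lcancel[OF UP_domain G(4), of "U \<otimes>\<^bsub>P\<^esub> A \<oplus>\<^bsub>P\<^esub> V \<otimes>\<^bsub>P\<^esub> B" "\<one>\<^bsub>P\<^esub>"]
      G(1-3) AB(1,2) by simp
  hence "lowest_terms R A B"
    using lowest_termsI[OF AB(1,2) G(2,3)] by simp
  moreover have "rat_frac R S T = rat_frac R A B"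
    using rat_frac_cancel[OF AB(1,2) G(1,4)] unfolding AB(3,4) .
  ultimately show ?thesis using that[of A B G] G(1,4) AB(3,4) by metis
qed

text \<open>
  Cancelling a common factor lowers the degree of both entries by the degree of the factor, so only
  constants can be cancelled here.  The second conclusion says that there is no common zero at
  infinity either.
\<close>

lemma lowest_terms_if_full_degree:
  assumes ST: "S \<in> carrier P" "T \<in> carrier P" "S \<noteq> \<zero>\<^bsub>P\<^esub> \<or> T \<noteq> \<zero>\<^bsub>P\<^esub>"
    and deg: "deg R S \<le> n" "deg R T \<le> n" "rat_degree R (rat_frac R S T) = n"
  shows "lowest_terms R S T" "max (deg R S) (deg R T) = n"
proof -
  obtain A B G where low: "lowest_terms R A B" and G: "G \<in> carrier P" "G \<noteq> \<zero>\<^bsub>P\<^esub>"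
    and S: "S = G \<otimes>\<^bsub>P\<^esub> A" and T: "T = G \<otimes>\<^bsub>P\<^esub> B" and eq: "rat_frac R S T = rat_frac R A B"
    using lowest_terms_exists[OF ST] .
  note AB = lowest_terms_closed[OF low]
  have max: "max (deg R A) (deg R B) = n" using deg(3) eq rat_degree_lowest[OF low] by simp
  have "deg R G + n \<le> n"
  proof (cases "deg R A = n \<and> A \<noteq> \<zero>\<^bsub>P\<^esub>")
    case True thus ?thesis using deg(1) G AB unfolding S by simp
  next
    case False
    hence "deg R B = n \<and> B \<noteq> \<zero>\<^bsub>P\<^esub>"
      using max lowest_terms_nonzero[OF low] by (auto simp: max_def split: if_splits)
    thus ?thesis using deg(2) G AB unfolding T by simp
  qed
  hence "deg R G = 0" by simp
  hence G0: "G = up_ring.monom P (up_ring.coeff P G 0) 0" using G(1) by (rule deg_zero_impl_monom[rotated])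
  define g where "g = up_ring.coeff P G 0"
  have g: "g \<in> carrier R" "g \<noteq> \<zero>" unfolding g_def using G G0 by (auto simp del: coeff_monom)
  have "S = g \<odot>\<^bsub>P\<^esub> A" "T = g \<odot>\<^bsub>P\<^esub> B"
    using G0 AB g unfolding S T g_def[symmetric] by (simp_all add: monom_mult_is_smult)
  thus low': "lowest_terms R S T" using lowest_terms_smult[OF low g] by simp
  show "max (deg R S) (deg R T) = n" using rat_degree_lowest[OF low'] deg(3) by simp
qed

end

lemma rat_functions_lowest:
  assumes "field R" "\<phi> \<in> rat_functions R"
  obtains A B where "lowest_terms R A B" "\<phi> = rat_frac R A B"
proof -
  interpret UP_field R "UP R" by (intro UP_field.intro assms(1))
  obtain S T where ST: "\<phi> = rat_frac R S T" "S \<in> carrier (UP R)" "T \<in> carrier (UP R)" "T \<noteq> \<zero>\<^bsub>UP R\<^esub>"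
    using assms(2) unfolding rat_functions_def by blast
  obtain A B G where "lowest_terms R A B" "rat_frac R S T = rat_frac R A B"
    by (rule lowest_terms_exists[of S T]) (use ST in auto)
  thus ?thesis using that ST(1) by simp
qed

section \<open>Change of coefficient ring\<close>

lemma UP_apply:
  assumes "cring R"
  shows "F \<in> carrier (UP R) \<Longrightarrow> up_ring.coeff (UP R) F i = F i"
    and "a \<in> carrier R \<Longrightarrow> up_ring.monom (UP R) a n i = (if i = n then a else \<zero>\<^bsub>R\<^esub>)"
    and "F \<in> carrier (UP R) \<Longrightarrow> G \<in> carrier (UP R) \<Longrightarrow> (F \<oplus>\<^bsub>UP R\<^esub> G) i = F i \<oplus>\<^bsub>R\<^esub> G i"
    and "a \<in> carrier R \<Longrightarrow> F \<in> carrier (UP R) \<Longrightarrow> (a \<odot>\<^bsub>UP R\<^esub> F) i = a \<otimes>\<^bsub>R\<^esub> F i"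
    and "F \<in> carrier (UP R) \<Longrightarrow> G \<in> carrier (UP R) \<Longrightarrow>
      (F \<otimes>\<^bsub>UP R\<^esub> G) i = (\<Oplus>\<^bsub>R\<^esub>j\<in>{..i}. F j \<otimes>\<^bsub>R\<^esub> G (i - j))"
    and "F \<in> carrier (UP R) \<Longrightarrow> F i \<in> carrier R"
  by (simp_all add: UP_def mem_upD)

lemma lin_poly_closed:
  assumes "cring R" "a \<in> carrier R" "b \<in> carrier R"
  shows "lin_poly R a b \<in> carrier (UP R)"
proof -
  interpret UP_cring R "UP R" by (intro UP_cring.intro assms(1))
  show ?thesis using assms(2,3) unfolding lin_poly_def by simp
qed

lemma lin_poly_apply:
  assumes "cring R" "a \<in> carrier R" "b \<in> carrier R"
  shows "lin_poly R a b i = (if i = 0 then b else if i = 1 then a else \<zero>\<^bsub>R\<^esub>)"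
proof -
  interpret UP_cring R "UP R" by (intro UP_cring.intro assms(1))
  show ?thesis using assms(2,3) unfolding lin_poly_def
    by (simp add: UP_apply[OF assms(1)])
qed

text \<open>
  Two instances matter: the residue map of a valuation ring, and its inclusion into the field.  The
  second one makes identities over the field available over the valuation ring, where the first one can
  be applied to them.
\<close>

locale coeff_hom = R: cring R + S: cring S for R (structure) and S (structure) +
  fixes h
  assumes h: "h \<in> ring_hom R S"

sublocale coeff_hom \<subseteq> H: ring_hom_cring R S h
  by unfold_locales (rule h)

sublocale coeff_hom \<subseteq> PR: UP_cring R "UP R"
  by (intro UP_cring.intro R.is_cring)

sublocale coeff_hom \<subseteq> PS: UP_cring S "UP S"
  by (intro UP_cring.intro S.is_cring)

context coeff_hom
begin

lemma comp_closed:
  assumes "F \<in> carrier (UP R)"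
  shows "h \<circ> F \<in> carrier (UP S)"
proof -
  have "F \<in> up R" using assms unfolding UP_def by simp
  then obtain n where n: "bound \<zero>\<^bsub>R\<^esub> n F" "\<And>i. F i \<in> carrier R" unfolding up_def by auto
  have "bound \<zero>\<^bsub>S\<^esub> n (h \<circ> F)"
  proof
    fix m assume "n < m"
    hence "F m = \<zero>\<^bsub>R\<^esub>" using n(1) by (simp add: bound.bound)
    thus "(h \<circ> F) m = \<zero>\<^bsub>S\<^esub>" by simp
  qed
  hence "h \<circ> F \<in> up S" using n(2) by (intro mem_upI) auto
  thus ?thesis unfolding UP_def by simp
qed

lemma comp_ring_hom: "(\<lambda>F. h \<circ> F) \<in> ring_hom (UP R) (UP S)"
proof (rule ring_hom_memI)
  fix F G assume FG: "F \<in> carrier (UP R)" "G \<in> carrier (UP R)"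
  note closed = UP_apply(6)[OF R.is_cring FG(1)] UP_apply(6)[OF R.is_cring FG(2)]
  show "h \<circ> (F \<otimes>\<^bsub>UP R\<^esub> G) = (h \<circ> F) \<otimes>\<^bsub>UP S\<^esub> (h \<circ> G)"
  proof
    fix i
    have "(h \<circ> (F \<otimes>\<^bsub>UP R\<^esub> G)) i = h (\<Oplus>\<^bsub>R\<^esub>j\<in>{..i}. F j \<otimes>\<^bsub>R\<^esub> G (i - j))"
      using FG by (simp add: UP_apply(5)[OF R.is_cring])
    also have "\<dots> = (\<Oplus>\<^bsub>S\<^esub>j\<in>{..i}. (h \<circ> F) j \<otimes>\<^bsub>S\<^esub> (h \<circ> G) (i - j))"
      using closed by (subst H.hom_finsum) (auto intro!: S.finsum_cong simp: Pi_def)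
    also have "\<dots> = ((h \<circ> F) \<otimes>\<^bsub>UP S\<^esub> (h \<circ> G)) i"
      using FG by (simp only: UP_apply(5)[OF S.is_cring comp_closed comp_closed])
    finally show "(h \<circ> (F \<otimes>\<^bsub>UP R\<^esub> G)) i = ((h \<circ> F) \<otimes>\<^bsub>UP S\<^esub> (h \<circ> G)) i" .
  qed
  show "h \<circ> (F \<oplus>\<^bsub>UP R\<^esub> G) = (h \<circ> F) \<oplus>\<^bsub>UP S\<^esub> (h \<circ> G)"
  proof
    fix i
    show "(h \<circ> (F \<oplus>\<^bsub>UP R\<^esub> G)) i = ((h \<circ> F) \<oplus>\<^bsub>UP S\<^esub> (h \<circ> G)) i"
      using FG closed by (simp add: UP_apply(3)[OF R.is_cring] UP_apply(3)[OF S.is_cring] comp_closed)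
  qed
next
  show "h \<circ> \<one>\<^bsub>UP R\<^esub> = \<one>\<^bsub>UP S\<^esub>" by (rule ext) (simp add: UP_def)
qed (rule comp_closed)

lemma comp_smult:
  assumes "a \<in> carrier R" "F \<in> carrier (UP R)"
  shows "h \<circ> (a \<odot>\<^bsub>UP R\<^esub> F) = h a \<odot>\<^bsub>UP S\<^esub> (h \<circ> F)"
proof
  fix i
  show "(h \<circ> (a \<odot>\<^bsub>UP R\<^esub> F)) i = (h a \<odot>\<^bsub>UP S\<^esub> (h \<circ> F)) i"
    using assms UP_apply(6)[OF R.is_cring assms(2)]
    by (simp add: UP_apply(4)[OF R.is_cring] UP_apply(4)[OF S.is_cring] comp_closed)
qed

lemma comp_lin_poly:
  assumes "a \<in> carrier R" "b \<in> carrier R"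
  shows "h \<circ> lin_poly R a b = lin_poly S (h a) (h b)"
  by (rule ext) (simp add: lin_poly_apply R.is_cring S.is_cring assms)

lemma comp_hom_subst:
  assumes ABC: "A \<in> carrier (UP R)" "B \<in> carrier (UP R)" "C \<in> carrier (UP R)"
  shows "h \<circ> hom_subst R n A B C = hom_subst S n (h \<circ> A) (h \<circ> B) (h \<circ> C)"
proof -
  interpret M: ring_hom_cring "UP R" "UP S" "\<lambda>F. h \<circ> F"
    by (intro ring_hom_cringI PR.UP_cring PS.UP_cring comp_ring_hom)
  have A: "up_ring.coeff (UP R) A i = A i" "A i \<in> carrier R" for i
    using ABC(1) UP_apply(1,6)[OF R.is_cring] by auto
  have hA: "up_ring.coeff (UP S) (h \<circ> A) i = h (A i)" for i
    using comp_closed[OF ABC(1)] UP_apply(1)[OF S.is_cring] by auto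
  have closed: "B [^]\<^bsub>UP R\<^esub> i \<otimes>\<^bsub>UP R\<^esub> C [^]\<^bsub>UP R\<^esub> j \<in> carrier (UP R)" for i j :: nat
    using ABC by simp
  have "h \<circ> hom_subst R n A B C = (\<Oplus>\<^bsub>UP S\<^esub>i\<in>{..n}.
      h \<circ> (A i \<odot>\<^bsub>UP R\<^esub> (B [^]\<^bsub>UP R\<^esub> i \<otimes>\<^bsub>UP R\<^esub> C [^]\<^bsub>UP R\<^esub> (n - i))))"
    unfolding hom_subst_def A(1)
    by (subst M.hom_finsum) (use A(2) closed in \<open>auto simp: comp_def\<close>)
  also have "\<dots> = (\<Oplus>\<^bsub>UP S\<^esub>i\<in>{..n}.
      h (A i) \<odot>\<^bsub>UP S\<^esub> ((h \<circ> B) [^]\<^bsub>UP S\<^esub> i \<otimes>\<^bsub>UP S\<^esub> (h \<circ> C) [^]\<^bsub>UP S\<^esub> (n - i)))"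
    using ABC A(2) closed by (simp add: comp_smult)
  also have "\<dots> = hom_subst S n (h \<circ> A) (h \<circ> B) (h \<circ> C)"
    unfolding hom_subst_def hA ..
  finally show ?thesis .
qed

end

section \<open>Projective linear groups\<close>

lemma GL2_group:
  assumes "cring R"
  shows "group (GL2 R)"
proof (rule groupI)
  interpret cring R by fact
  show "\<one>\<^bsub>GL2 R\<^esub> \<in> carrier (GL2 R)" unfolding GL2_def by (simp add: a_minus_def)
  have det: "(a \<otimes>\<^bsub>R\<^esub> a' \<oplus>\<^bsub>R\<^esub> b \<otimes>\<^bsub>R\<^esub> c') \<otimes>\<^bsub>R\<^esub> (c \<otimes>\<^bsub>R\<^esub> b' \<oplus>\<^bsub>R\<^esub> d \<otimes>\<^bsub>R\<^esub> d') \<ominus>\<^bsub>R\<^esub>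
      (a \<otimes>\<^bsub>R\<^esub> b' \<oplus>\<^bsub>R\<^esub> b \<otimes>\<^bsub>R\<^esub> d') \<otimes>\<^bsub>R\<^esub> (c \<otimes>\<^bsub>R\<^esub> a' \<oplus>\<^bsub>R\<^esub> d \<otimes>\<^bsub>R\<^esub> c') =
      (a \<otimes>\<^bsub>R\<^esub> d \<ominus>\<^bsub>R\<^esub> b \<otimes>\<^bsub>R\<^esub> c) \<otimes>\<^bsub>R\<^esub> (a' \<otimes>\<^bsub>R\<^esub> d' \<ominus>\<^bsub>R\<^esub> b' \<otimes>\<^bsub>R\<^esub> c')"
    if "a \<in> carrier R" "b \<in> carrier R" "c \<in> carrier R" "d \<in> carrier R"
       "a' \<in> carrier R" "b' \<in> carrier R" "c' \<in> carrier R" "d' \<in> carrier R" for a b c d a' b' c' d'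
    using that by algebra
  show "M \<otimes>\<^bsub>GL2 R\<^esub> N \<in> carrier (GL2 R)"
    if "M \<in> carrier (GL2 R)" "N \<in> carrier (GL2 R)" for M N
    using that unfolding GL2_def by (auto simp: det)
  show "M \<otimes>\<^bsub>GL2 R\<^esub> N \<otimes>\<^bsub>GL2 R\<^esub> L = M \<otimes>\<^bsub>GL2 R\<^esub> (N \<otimes>\<^bsub>GL2 R\<^esub> L)"
    if "M \<in> carrier (GL2 R)" "N \<in> carrier (GL2 R)" "L \<in> carrier (GL2 R)" for M N L
    using that unfolding GL2_def by (auto simp: l_distr r_distr m_assoc a_ac)
  show "\<one>\<^bsub>GL2 R\<^esub> \<otimes>\<^bsub>GL2 R\<^esub> M = M" if "M \<in> carrier (GL2 R)" for M
    using that unfolding GL2_def by auto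
  show "\<exists>N\<in>carrier (GL2 R). N \<otimes>\<^bsub>GL2 R\<^esub> M = \<one>\<^bsub>GL2 R\<^esub>" if M: "M \<in> carrier (GL2 R)" for M
  proof -
    obtain a b c d where M_eq: "M = (a, b, c, d)" by (cases M)
    define e where "e = inv\<^bsub>R\<^esub> (a \<otimes>\<^bsub>R\<^esub> d \<ominus>\<^bsub>R\<^esub> b \<otimes>\<^bsub>R\<^esub> c)"
    have abcd: "a \<in> carrier R" "b \<in> carrier R" "c \<in> carrier R" "d \<in> carrier R"
      and u: "a \<otimes>\<^bsub>R\<^esub> d \<ominus>\<^bsub>R\<^esub> b \<otimes>\<^bsub>R\<^esub> c \<in> Units R"
      using M unfolding M_eq GL2_def by auto
    have e: "e \<in> Units R" "e \<in> carrier R" "e \<otimes>\<^bsub>R\<^esub> (a \<otimes>\<^bsub>R\<^esub> d \<ominus>\<^bsub>R\<^esub> b \<otimes>\<^bsub>R\<^esub> c) = \<one>\<^bsub>R\<^esub>"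
      using u unfolding e_def by auto
    have "e \<otimes>\<^bsub>R\<^esub> d \<otimes>\<^bsub>R\<^esub> (e \<otimes>\<^bsub>R\<^esub> a) \<ominus>\<^bsub>R\<^esub> \<ominus>\<^bsub>R\<^esub> (e \<otimes>\<^bsub>R\<^esub> b) \<otimes>\<^bsub>R\<^esub> \<ominus>\<^bsub>R\<^esub> (e \<otimes>\<^bsub>R\<^esub> c) =
        e \<otimes>\<^bsub>R\<^esub> (e \<otimes>\<^bsub>R\<^esub> (a \<otimes>\<^bsub>R\<^esub> d \<ominus>\<^bsub>R\<^esub> b \<otimes>\<^bsub>R\<^esub> c))"
      using abcd e(2) by algebra
    hence det': "e \<otimes>\<^bsub>R\<^esub> d \<otimes>\<^bsub>R\<^esub> (e \<otimes>\<^bsub>R\<^esub> a) \<ominus>\<^bsub>R\<^esub> \<ominus>\<^bsub>R\<^esub> (e \<otimes>\<^bsub>R\<^esub> b) \<otimes>\<^bsub>R\<^esub> \<ominus>\<^bsub>R\<^esub> (e \<otimes>\<^bsub>R\<^esub> c) = e"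
      using e by simp
    have prods:
      "e \<otimes>\<^bsub>R\<^esub> d \<otimes>\<^bsub>R\<^esub> a \<oplus>\<^bsub>R\<^esub> \<ominus>\<^bsub>R\<^esub> (e \<otimes>\<^bsub>R\<^esub> b) \<otimes>\<^bsub>R\<^esub> c = e \<otimes>\<^bsub>R\<^esub> (a \<otimes>\<^bsub>R\<^esub> d \<ominus>\<^bsub>R\<^esub> b \<otimes>\<^bsub>R\<^esub> c)"
      "e \<otimes>\<^bsub>R\<^esub> d \<otimes>\<^bsub>R\<^esub> b \<oplus>\<^bsub>R\<^esub> \<ominus>\<^bsub>R\<^esub> (e \<otimes>\<^bsub>R\<^esub> b) \<otimes>\<^bsub>R\<^esub> d = \<zero>\<^bsub>R\<^esub>"
      "\<ominus>\<^bsub>R\<^esub> (e \<otimes>\<^bsub>R\<^esub> c) \<otimes>\<^bsub>R\<^esub> a \<oplus>\<^bsub>R\<^esub> e \<otimes>\<^bsub>R\<^esub> a \<otimes>\<^bsub>R\<^esub> c = \<zero>\<^bsub>R\<^esub>"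
      "\<ominus>\<^bsub>R\<^esub> (e \<otimes>\<^bsub>R\<^esub> c) \<otimes>\<^bsub>R\<^esub> b \<oplus>\<^bsub>R\<^esub> e \<otimes>\<^bsub>R\<^esub> a \<otimes>\<^bsub>R\<^esub> d = e \<otimes>\<^bsub>R\<^esub> (a \<otimes>\<^bsub>R\<^esub> d \<ominus>\<^bsub>R\<^esub> b \<otimes>\<^bsub>R\<^esub> c)"
      using abcd e(2) by algebra+
    show ?thesis
      using abcd e det' unfolding M_eq GL2_def
      by (intro bexI[of _ "(e \<otimes>\<^bsub>R\<^esub> d, \<ominus>\<^bsub>R\<^esub> (e \<otimes>\<^bsub>R\<^esub> b), \<ominus>\<^bsub>R\<^esub> (e \<otimes>\<^bsub>R\<^esub> c), e \<otimes>\<^bsub>R\<^esub> a)"])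
        (auto simp: prods)
  qed
qed

lemma GL2_mult_eq:
  "(a, b, c, d) \<otimes>\<^bsub>GL2 R\<^esub> (a', b', c', d') =
     (a \<otimes>\<^bsub>R\<^esub> a' \<oplus>\<^bsub>R\<^esub> b \<otimes>\<^bsub>R\<^esub> c', a \<otimes>\<^bsub>R\<^esub> b' \<oplus>\<^bsub>R\<^esub> b \<otimes>\<^bsub>R\<^esub> d',
      c \<otimes>\<^bsub>R\<^esub> a' \<oplus>\<^bsub>R\<^esub> d \<otimes>\<^bsub>R\<^esub> c', c \<otimes>\<^bsub>R\<^esub> b' \<oplus>\<^bsub>R\<^esub> d \<otimes>\<^bsub>R\<^esub> d')"
  unfolding GL2_def by simp

lemma GL2_one_eq: "\<one>\<^bsub>GL2 R\<^esub> = (\<one>\<^bsub>R\<^esub>, \<zero>\<^bsub>R\<^esub>, \<zero>\<^bsub>R\<^esub>, \<one>\<^bsub>R\<^esub>)"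
  unfolding GL2_def by simp

lemma GL2_carrier_iff:
  "(a, b, c, d) \<in> carrier (GL2 R) \<longleftrightarrow>
     a \<in> carrier R \<and> b \<in> carrier R \<and> c \<in> carrier R \<and> d \<in> carrier R \<and>
     a \<otimes>\<^bsub>R\<^esub> d \<ominus>\<^bsub>R\<^esub> b \<otimes>\<^bsub>R\<^esub> c \<in> Units R"
  unfolding GL2_def by simp

lemma scalar_mats_normal:
  assumes "cring R"
  shows "scalar_mats R \<lhd> GL2 R"
proof -
  interpret cring R by fact
  interpret G: group "GL2 R" by (rule GL2_group[OF assms])
  have sub: "scalar_mats R \<subseteq> carrier (GL2 R)"
    unfolding scalar_mats_def by (auto simp: GL2_carrier_iff a_minus_def Units_closed)
  have subgroup: "subgroup (scalar_mats R) (GL2 R)"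
  proof (rule G.subgroupI[OF sub])
    show "scalar_mats R \<noteq> {}" unfolding scalar_mats_def by auto
    show "M \<otimes>\<^bsub>GL2 R\<^esub> N \<in> scalar_mats R" if "M \<in> scalar_mats R" "N \<in> scalar_mats R" for M N
      using that unfolding scalar_mats_def by (auto simp: GL2_mult_eq Units_closed)
    show "inv\<^bsub>GL2 R\<^esub> M \<in> scalar_mats R" if M: "M \<in> scalar_mats R" for M
    proof -
      obtain u where u: "u \<in> Units R" "M = (u, \<zero>\<^bsub>R\<^esub>, \<zero>\<^bsub>R\<^esub>, u)"
        using M unfolding scalar_mats_def by blast
      define N where "N = (inv\<^bsub>R\<^esub> u, \<zero>\<^bsub>R\<^esub>, \<zero>\<^bsub>R\<^esub>, inv\<^bsub>R\<^esub> u)"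
      have N: "N \<in> scalar_mats R" using u unfolding N_def scalar_mats_def by auto
      have "N \<otimes>\<^bsub>GL2 R\<^esub> M = \<one>\<^bsub>GL2 R\<^esub>"
        using u unfolding N_def by (simp add: GL2_mult_eq GL2_one_eq Units_closed)
      thus ?thesis using G.inv_equality[of N M] N sub M by auto
    qed
  qed
  show ?thesis
  proof (rule G.normal_invI[OF subgroup])
    fix M N assume M: "M \<in> carrier (GL2 R)" and N: "N \<in> scalar_mats R"
    have "M \<otimes>\<^bsub>GL2 R\<^esub> N = N \<otimes>\<^bsub>GL2 R\<^esub> M"
      using M N unfolding scalar_mats_def
      by (cases M) (auto simp: GL2_mult_eq GL2_carrier_iff m_comm Units_closed)
    hence "M \<otimes>\<^bsub>GL2 R\<^esub> N \<otimes>\<^bsub>GL2 R\<^esub> inv\<^bsub>GL2 R\<^esub> M = N"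
      using M subsetD[OF sub N] by (simp add: G.m_assoc)
    thus "M \<otimes>\<^bsub>GL2 R\<^esub> N \<otimes>\<^bsub>GL2 R\<^esub> inv\<^bsub>GL2 R\<^esub> M \<in> scalar_mats R" using N by simp
  qed
qed

definition proj_class :: "('a, 'm) ring_scheme \<Rightarrow> 'a mat2 \<Rightarrow> 'a mat2 set" where
  "proj_class R M = scalar_mats R #>\<^bsub>GL2 R\<^esub> M"

lemma PGL2_group: "cring R \<Longrightarrow> group (PGL2 R)"
  unfolding PGL2_def by (rule normal.factorgroup_is_group[OF scalar_mats_normal])

lemma PGL2_carrier: "carrier (PGL2 R) = proj_class R ` carrier (GL2 R)"
  unfolding PGL2_def FactGroup_def RCOSETS_def proj_class_def by auto

lemma proj_class_eq:
  assumes "cring R" "(a, b, c, d) \<in> carrier (GL2 R)"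
  shows "proj_class R (a, b, c, d) =
    {(u \<otimes>\<^bsub>R\<^esub> a, u \<otimes>\<^bsub>R\<^esub> b, u \<otimes>\<^bsub>R\<^esub> c, u \<otimes>\<^bsub>R\<^esub> d) | u. u \<in> Units R}"
proof -
  interpret cring R by fact
  have "(u, \<zero>\<^bsub>R\<^esub>, \<zero>\<^bsub>R\<^esub>, u) \<otimes>\<^bsub>GL2 R\<^esub> (a, b, c, d) =
      (u \<otimes>\<^bsub>R\<^esub> a, u \<otimes>\<^bsub>R\<^esub> b, u \<otimes>\<^bsub>R\<^esub> c, u \<otimes>\<^bsub>R\<^esub> d)" if "u \<in> Units R" for u
    using assms(2) that by (simp add: GL2_mult_eq GL2_carrier_iff Units_closed)
  hence "(\<lambda>u. (u, \<zero>\<^bsub>R\<^esub>, \<zero>\<^bsub>R\<^esub>, u) \<otimes>\<^bsub>GL2 R\<^esub> (a, b, c, d)) ` Units R =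
      (\<lambda>u. (u \<otimes>\<^bsub>R\<^esub> a, u \<otimes>\<^bsub>R\<^esub> b, u \<otimes>\<^bsub>R\<^esub> c, u \<otimes>\<^bsub>R\<^esub> d)) ` Units R"
    by (intro image_cong) auto
  thus ?thesis
    unfolding proj_class_def r_coset_def scalar_mats_def Setcompr_eq_image by (simp only: UN_simps UN_singleton)
      (simp add: UNION_singleton_eq_range)
qed

lemma proj_class_mult:
  assumes "cring R" "M \<in> carrier (GL2 R)" "N \<in> carrier (GL2 R)"
  shows "proj_class R M \<otimes>\<^bsub>PGL2 R\<^esub> proj_class R N = proj_class R (M \<otimes>\<^bsub>GL2 R\<^esub> N)"
  using normal.rcos_sum[OF scalar_mats_normal[OF assms(1)] assms(2,3)]
  unfolding PGL2_def FactGroup_def proj_class_def by simp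

lemma proj_class_self: "cring R \<Longrightarrow> M \<in> carrier (GL2 R) \<Longrightarrow> M \<in> proj_class R M"
  unfolding proj_class_def
  by (rule group.rcos_self[OF GL2_group _ normal_imp_subgroup[OF scalar_mats_normal]])

lemma proj_class_eqI:
  assumes "cring R" "M \<in> carrier (GL2 R)" "N \<in> proj_class R M"
  shows "proj_class R N = proj_class R M"
  using group.repr_independence[OF GL2_group[OF assms(1)] assms(3)[unfolded proj_class_def] assms(2)
      normal_imp_subgroup[OF scalar_mats_normal[OF assms(1)]]]
  unfolding proj_class_def by (rule sym)

text \<open>
  The adjugate represents the inverse in \<open>PGL\<^sub>2\<close>.  Unlike the inverse matrix it involves no division, so
  it commutes with coefficientwise reduction.
\<close>

fun adj_mat :: "('a, 'm) ring_scheme \<Rightarrow> 'a mat2 \<Rightarrow> 'a mat2" where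
  "adj_mat R (a, b, c, d) = (d, \<ominus>\<^bsub>R\<^esub> b, \<ominus>\<^bsub>R\<^esub> c, a)"

lemma adj_mat_closed:
  assumes "cring R" "M \<in> carrier (GL2 R)"
  shows "adj_mat R M \<in> carrier (GL2 R)"
proof -
  interpret cring R by fact
  obtain a b c d where M: "M = (a, b, c, d)" by (cases M)
  have abcd: "a \<in> carrier R" "b \<in> carrier R" "c \<in> carrier R" "d \<in> carrier R"
    using assms(2) unfolding M by (auto simp: GL2_carrier_iff)
  have "d \<otimes>\<^bsub>R\<^esub> a \<ominus>\<^bsub>R\<^esub> \<ominus>\<^bsub>R\<^esub> b \<otimes>\<^bsub>R\<^esub> \<ominus>\<^bsub>R\<^esub> c = a \<otimes>\<^bsub>R\<^esub> d \<ominus>\<^bsub>R\<^esub> b \<otimes>\<^bsub>R\<^esub> c"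
    using abcd by algebra
  thus ?thesis using assms(2) abcd unfolding M by (simp add: GL2_carrier_iff)
qed

lemma proj_class_inv:
  assumes "cring R" "M \<in> carrier (GL2 R)"
  shows "inv\<^bsub>PGL2 R\<^esub> (proj_class R M) = proj_class R (adj_mat R M)"
proof -
  interpret cring R by fact
  interpret G: group "GL2 R" by (rule GL2_group[OF assms(1)])
  interpret PG: group "PGL2 R" by (rule PGL2_group[OF assms(1)])
  obtain a b c d where M: "M = (a, b, c, d)" by (cases M)
  have abcd: "a \<in> carrier R" "b \<in> carrier R" "c \<in> carrier R" "d \<in> carrier R"
    and det: "a \<otimes>\<^bsub>R\<^esub> d \<ominus>\<^bsub>R\<^esub> b \<otimes>\<^bsub>R\<^esub> c \<in> Units R"
    using assms(2) unfolding M by (auto simp: GL2_carrier_iff)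
  have eqs: "d \<otimes>\<^bsub>R\<^esub> a \<oplus>\<^bsub>R\<^esub> \<ominus>\<^bsub>R\<^esub> b \<otimes>\<^bsub>R\<^esub> c = a \<otimes>\<^bsub>R\<^esub> d \<ominus>\<^bsub>R\<^esub> b \<otimes>\<^bsub>R\<^esub> c"
    "d \<otimes>\<^bsub>R\<^esub> b \<oplus>\<^bsub>R\<^esub> \<ominus>\<^bsub>R\<^esub> b \<otimes>\<^bsub>R\<^esub> d = \<zero>\<^bsub>R\<^esub>"
    "\<ominus>\<^bsub>R\<^esub> c \<otimes>\<^bsub>R\<^esub> a \<oplus>\<^bsub>R\<^esub> a \<otimes>\<^bsub>R\<^esub> c = \<zero>\<^bsub>R\<^esub>"
    "\<ominus>\<^bsub>R\<^esub> c \<otimes>\<^bsub>R\<^esub> b \<oplus>\<^bsub>R\<^esub> a \<otimes>\<^bsub>R\<^esub> d = a \<otimes>\<^bsub>R\<^esub> d \<ominus>\<^bsub>R\<^esub> b \<otimes>\<^bsub>R\<^esub> c"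
    using abcd by algebra+
  have scalar: "adj_mat R M \<otimes>\<^bsub>GL2 R\<^esub> M \<in> scalar_mats R"
    using det unfolding M scalar_mats_def by (auto simp: GL2_mult_eq eqs)
  have "proj_class R (adj_mat R M) \<otimes>\<^bsub>PGL2 R\<^esub> proj_class R M = proj_class R (adj_mat R M \<otimes>\<^bsub>GL2 R\<^esub> M)"
    by (rule proj_class_mult[OF assms(1) adj_mat_closed[OF assms] assms(2)])
  also have "\<dots> = scalar_mats R"
    unfolding proj_class_def
    using normal_imp_subgroup[OF scalar_mats_normal[OF assms(1)]] G.coset_join2 scalar
      subgroup.subset by blast
  also have "\<dots> = \<one>\<^bsub>PGL2 R\<^esub>" unfolding PGL2_def FactGroup_def by simp
  finally show ?thesis
    using assms adj_mat_closed[OF assms]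
    by (intro PG.inv_equality) (auto simp: PGL2_carrier)
qed

section \<open>Composition with Moebius transformations\<close>

context UP_field
begin

lemma lin_closed: "a \<in> carrier R \<Longrightarrow> b \<in> carrier R \<Longrightarrow> lin_poly R a b \<in> carrier P"
  unfolding P_def by (rule lin_poly_closed[OF R.is_cring])

lemma lin_coeff:
  "a \<in> carrier R \<Longrightarrow> b \<in> carrier R \<Longrightarrow>
    up_ring.coeff P (lin_poly R a b) i = (if i = 0 then b else if i = 1 then a else \<zero>)"
  using lin_closed lin_poly_apply[OF R.is_cring] UP_apply(1)[OF R.is_cring] unfolding P_def by simp

lemma deg_lin_le: "a \<in> carrier R \<Longrightarrow> b \<in> carrier R \<Longrightarrow> deg R (lin_poly R a b) \<le> 1"
  by (rule deg_aboveI) (auto simp: lin_coeff lin_closed)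

lemma smult_lin:
  assumes "u \<in> carrier R" "a \<in> carrier R" "b \<in> carrier R"
  shows "u \<odot>\<^bsub>P\<^esub> lin_poly R a b = lin_poly R (u \<otimes> a) (u \<otimes> b)"
  by (rule up_eqI) (use assms in \<open>auto simp: lin_closed lin_coeff\<close>)

lemma lowest_terms_lin:
  assumes M: "(a, b, c, d) \<in> carrier (GL2 R)"
  shows "lowest_terms R (lin_poly R a b) (lin_poly R c d)"
    and "max (deg R (lin_poly R a b)) (deg R (lin_poly R c d)) = 1"
proof -
  have abcd: "a \<in> carrier R" "b \<in> carrier R" "c \<in> carrier R" "d \<in> carrier R"
    and det: "a \<otimes> d \<ominus> b \<otimes> c \<in> Units R"
    using M by (auto simp: GL2_carrier_iff)
  let ?\<delta> = "a \<otimes> d \<ominus> b \<otimes> c"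
  have eq: "(\<ominus> c) \<odot>\<^bsub>P\<^esub> lin_poly R a b \<oplus>\<^bsub>P\<^esub> a \<odot>\<^bsub>P\<^esub> lin_poly R c d = up_ring.monom P ?\<delta> 0"
  proof (rule up_eqI)
    fix i
    have "\<ominus> c \<otimes> a \<oplus> a \<otimes> c = \<zero>" "\<ominus> c \<otimes> b \<oplus> a \<otimes> d = ?\<delta>" using abcd by algebra+
    thus "up_ring.coeff P ((\<ominus> c) \<odot>\<^bsub>P\<^esub> lin_poly R a b \<oplus>\<^bsub>P\<^esub> a \<odot>\<^bsub>P\<^esub> lin_poly R c d) i =
        up_ring.coeff P (up_ring.monom P ?\<delta> 0) i"
      using abcd by (simp add: lin_closed lin_coeff)
  qed (use abcd in \<open>auto simp: lin_closed\<close>)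
  have "up_ring.monom P ?\<delta> 0 \<otimes>\<^bsub>P\<^esub> up_ring.monom P (inv ?\<delta>) 0 = up_ring.monom P (?\<delta> \<otimes> inv ?\<delta>) (0 + 0)"
    using det by (intro monom_mult[symmetric]) auto
  also have "\<dots> = \<one>\<^bsub>P\<^esub>" using det by simp
  finally have "up_ring.monom P ?\<delta> 0 \<in> Units P"
    using det abcd P.m_comm[of "up_ring.monom P ?\<delta> 0" "up_ring.monom P (inv ?\<delta>) 0"]
    unfolding Units_def[of P] by (auto intro!: bexI[of _ "up_ring.monom P (inv ?\<delta>) 0"])
  thus "lowest_terms R (lin_poly R a b) (lin_poly R c d)"
    using eq abcd monom_mult_is_smult[of "\<ominus> c" "lin_poly R a b"] monom_mult_is_smult[of a "lin_poly R c d"]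
    by (intro lowest_termsI[of _ _ "up_ring.monom P (\<ominus> c) 0" "up_ring.monom P a 0"])
      (simp_all add: lin_closed del: monom_a_inv)
  have "a \<noteq> \<zero> \<or> c \<noteq> \<zero>"
  proof (rule ccontr)
    assume "\<not> ?thesis"
    hence "?\<delta> = \<zero>" using abcd by (simp add: a_minus_def)
    thus False using det field_Units by auto
  qed
  moreover have "1 \<le> deg R (lin_poly R x y)" if "x \<noteq> \<zero>" "x \<in> carrier R" "y \<in> carrier R" for x y
    using that by (intro deg_belowI) (auto simp: lin_coeff lin_closed)
  ultimately show "max (deg R (lin_poly R a b)) (deg R (lin_poly R c d)) = 1"
    using deg_lin_le[of a b] deg_lin_le[of c d] abcd by (metis le_antisym max.absorb1 max.absorb2 max.cobounded2 max.cobounded1)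
qed

lemma moebius_proj_class:
  assumes M: "(a, b, c, d) \<in> carrier (GL2 R)"
  shows "moebius R (proj_class R (a, b, c, d)) = rat_frac R (lin_poly R a b) (lin_poly R c d)"
proof -
  have abcd: "a \<in> carrier R" "b \<in> carrier R" "c \<in> carrier R" "d \<in> carrier R"
    using M by (auto simp: GL2_carrier_iff)
  have "rat_frac R (lin_poly R (u \<otimes> a) (u \<otimes> b)) (lin_poly R (u \<otimes> c) (u \<otimes> d)) =
      rat_frac R (lin_poly R a b) (lin_poly R c d)" if "u \<in> Units R" for u
    using rat_frac_smult[of "lin_poly R a b" "lin_poly R c d" u] that abcd field_Units
    by (simp add: smult_lin lin_closed)
  moreover have "\<one> \<in> Units R" by simp
  ultimately show ?thesis
    unfolding moebius_def proj_class_eq[OF R.is_cring M] by (auto simp del: R.Units_one_closed)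
qed

lemma hom_subst_closed:
  assumes "A \<in> carrier P" "S \<in> carrier P" "T \<in> carrier P"
  shows "hom_subst R n A S T \<in> carrier P"
  unfolding hom_subst_def P_def[symmetric] using assms
  by (intro P.finsum_closed) auto

lemma smult_pow:
  assumes "s \<in> carrier R" "S \<in> carrier P"
  shows "(s \<odot>\<^bsub>P\<^esub> S) [^]\<^bsub>P\<^esub> (i::nat) = (s [^] i) \<odot>\<^bsub>P\<^esub> (S [^]\<^bsub>P\<^esub> i)"
proof (induction i)
  case (Suc i)
  have "(s \<odot>\<^bsub>P\<^esub> S) [^]\<^bsub>P\<^esub> Suc i = ((s [^] i) \<odot>\<^bsub>P\<^esub> (S [^]\<^bsub>P\<^esub> i)) \<otimes>\<^bsub>P\<^esub> (s \<odot>\<^bsub>P\<^esub> S)"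
    using Suc by simp
  also have "\<dots> = (s [^] i) \<odot>\<^bsub>P\<^esub> (s \<odot>\<^bsub>P\<^esub> ((S [^]\<^bsub>P\<^esub> i) \<otimes>\<^bsub>P\<^esub> S))"
    using assms by (simp add: UP_smult_assoc2 P.m_comm[of "S [^]\<^bsub>P\<^esub> i"])
  also have "\<dots> = (s [^] Suc i) \<odot>\<^bsub>P\<^esub> (S [^]\<^bsub>P\<^esub> Suc i)"
    using assms by (simp add: smult_assoc1)
  finally show ?case .
qed (use assms in simp)

lemma hom_subst_smult:
  assumes "c \<in> carrier R" "s \<in> carrier R" "A \<in> carrier P" "S \<in> carrier P" "T \<in> carrier P"
  shows "hom_subst R n (c \<odot>\<^bsub>P\<^esub> A) (s \<odot>\<^bsub>P\<^esub> S) (s \<odot>\<^bsub>P\<^esub> T) = (c \<otimes> s [^] n) \<odot>\<^bsub>P\<^esub> hom_subst R n A S T"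
proof -
  have "up_ring.coeff P (c \<odot>\<^bsub>P\<^esub> A) i \<odot>\<^bsub>P\<^esub> ((s \<odot>\<^bsub>P\<^esub> S) [^]\<^bsub>P\<^esub> i \<otimes>\<^bsub>P\<^esub> (s \<odot>\<^bsub>P\<^esub> T) [^]\<^bsub>P\<^esub> (n - i)) =
      (c \<otimes> s [^] n) \<odot>\<^bsub>P\<^esub> (up_ring.coeff P A i \<odot>\<^bsub>P\<^esub> (S [^]\<^bsub>P\<^esub> i \<otimes>\<^bsub>P\<^esub> T [^]\<^bsub>P\<^esub> (n - i)))"
    if "i \<le> n" for i
  proof -
    define W where "W = S [^]\<^bsub>P\<^esub> i \<otimes>\<^bsub>P\<^esub> T [^]\<^bsub>P\<^esub> (n - i)"
    have W: "W \<in> carrier P" unfolding W_def using assms by simp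
    have "(s \<odot>\<^bsub>P\<^esub> S) [^]\<^bsub>P\<^esub> i \<otimes>\<^bsub>P\<^esub> (s \<odot>\<^bsub>P\<^esub> T) [^]\<^bsub>P\<^esub> (n - i) =
        (s [^] i) \<odot>\<^bsub>P\<^esub> ((s [^] (n - i)) \<odot>\<^bsub>P\<^esub> W)"
      unfolding W_def using assms
      by (simp add: smult_pow UP_smult_assoc2 P.m_comm[of "S [^]\<^bsub>P\<^esub> i"])
    also have "\<dots> = (s [^] i \<otimes> s [^] (n - i)) \<odot>\<^bsub>P\<^esub> W"
      using assms W by (simp add: smult_assoc1)
    also have "s [^] i \<otimes> s [^] (n - i) = s [^] n" using assms that by (simp add: R.nat_pow_mult)
    finally have "up_ring.coeff P (c \<odot>\<^bsub>P\<^esub> A) i \<odot>\<^bsub>P\<^esub> ((s \<odot>\<^bsub>P\<^esub> S) [^]\<^bsub>P\<^esub> i \<otimes>\<^bsub>P\<^esub> (s \<odot>\<^bsub>P\<^esub> T) [^]\<^bsub>P\<^esub> (n - i)) =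
        (c \<otimes> up_ring.coeff P A i \<otimes> s [^] n) \<odot>\<^bsub>P\<^esub> W"
      using assms W by (simp add: smult_assoc1[symmetric])
    also have "c \<otimes> up_ring.coeff P A i \<otimes> s [^] n = c \<otimes> s [^] n \<otimes> up_ring.coeff P A i"
      using assms by (simp add: R.m_ac)
    finally show ?thesis
      using assms W unfolding W_def[symmetric] by (simp add: smult_assoc1)
  qed
  hence "hom_subst R n (c \<odot>\<^bsub>P\<^esub> A) (s \<odot>\<^bsub>P\<^esub> S) (s \<odot>\<^bsub>P\<^esub> T) =
      (\<Oplus>\<^bsub>P\<^esub>i\<in>{..n}. (c \<otimes> s [^] n) \<odot>\<^bsub>P\<^esub> (up_ring.coeff P A i \<odot>\<^bsub>P\<^esub> (S [^]\<^bsub>P\<^esub> i \<otimes>\<^bsub>P\<^esub> T [^]\<^bsub>P\<^esub> (n - i))))"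
    unfolding hom_subst_def P_def[symmetric] using assms
    by (intro P.finsum_cong') auto
  also have "\<dots> = (c \<otimes> s [^] n) \<odot>\<^bsub>P\<^esub> hom_subst R n A S T"
    unfolding hom_subst_def P_def[symmetric] using assms
    by (intro finsum_smult_ldistr[symmetric]) auto
  finally show ?thesis .
qed

lemma hom_subst_lin:
  assumes "a \<in> carrier R" "b \<in> carrier R" "S \<in> carrier P" "T \<in> carrier P"
  shows "hom_subst R 1 (lin_poly R a b) S T = a \<odot>\<^bsub>P\<^esub> S \<oplus>\<^bsub>P\<^esub> b \<odot>\<^bsub>P\<^esub> T"
proof -
  have "hom_subst R (Suc 0) (lin_poly R a b) S T = a \<odot>\<^bsub>P\<^esub> S \<oplus>\<^bsub>P\<^esub> b \<odot>\<^bsub>P\<^esub> T"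
    unfolding hom_subst_def P_def[symmetric] using assms by (simp add: lin_coeff)
  thus ?thesis by simp
qed

lemma deg_lincomb_le:
  assumes "a \<in> carrier R" "b \<in> carrier R" "S \<in> carrier P" "T \<in> carrier P"
  shows "deg R (a \<odot>\<^bsub>P\<^esub> S \<oplus>\<^bsub>P\<^esub> b \<odot>\<^bsub>P\<^esub> T) \<le> max (deg R S) (deg R T)"
proof -
  have "deg R (a \<odot>\<^bsub>P\<^esub> S \<oplus>\<^bsub>P\<^esub> b \<odot>\<^bsub>P\<^esub> T) \<le> max (deg R (a \<odot>\<^bsub>P\<^esub> S)) (deg R (b \<odot>\<^bsub>P\<^esub> T))"
    using assms by (intro deg_add) auto
  also have "\<dots> \<le> max (deg R S) (deg R T)"
    using deg_smult_decr[OF assms(1,3)] deg_smult_decr[OF assms(2,4)] by (intro max.mono)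
  finally show ?thesis .
qed

lemma deg_pow_le: "S \<in> carrier P \<Longrightarrow> deg R (S [^]\<^bsub>P\<^esub> (i::nat)) \<le> i * deg R S"
proof (induction i)
  case (Suc i)
  have "deg R (S [^]\<^bsub>P\<^esub> Suc i) \<le> deg R (S [^]\<^bsub>P\<^esub> i) + deg R S"
    using deg_mult_ring[of "S [^]\<^bsub>P\<^esub> i" S] Suc.prems by simp
  thus ?case using Suc by simp
qed simp

lemma deg_hom_subst_le:
  assumes "A \<in> carrier P" "S \<in> carrier P" "T \<in> carrier P" "deg R S \<le> 1" "deg R T \<le> 1"
  shows "deg R (hom_subst R n A S T) \<le> n"
proof (rule deg_aboveI)
  fix m assume m: "n < m"
  have "up_ring.coeff P (up_ring.coeff P A i \<odot>\<^bsub>P\<^esub> (S [^]\<^bsub>P\<^esub> i \<otimes>\<^bsub>P\<^esub> T [^]\<^bsub>P\<^esub> (n - i))) m = \<zero>" if "i \<le> n" for i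
  proof -
    have "deg R (S [^]\<^bsub>P\<^esub> i \<otimes>\<^bsub>P\<^esub> T [^]\<^bsub>P\<^esub> (n - i)) \<le> deg R (S [^]\<^bsub>P\<^esub> i) + deg R (T [^]\<^bsub>P\<^esub> (n - i))"
      using assms by (intro deg_mult_ring) auto
    also have "\<dots> \<le> i * deg R S + (n - i) * deg R T"
      using assms by (intro add_mono deg_pow_le)
    also have "\<dots> \<le> i * 1 + (n - i) * 1" using assms(4,5) by (intro add_mono mult_le_mono) auto
    also have "\<dots> = n" using that by simp
    finally have "up_ring.coeff P (S [^]\<^bsub>P\<^esub> i \<otimes>\<^bsub>P\<^esub> T [^]\<^bsub>P\<^esub> (n - i)) m = \<zero>"
      using assms m by (intro deg_aboveD) auto
    thus ?thesis using assms by (simp del: coeff_mult)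
  qed
  thus "up_ring.coeff P (hom_subst R n A S T) m = \<zero>"
    unfolding hom_subst_def P_def[symmetric] using assms
    by (subst coeff_finsum) (auto intro!: R.add.finprod_one_eqI simp del: coeff_mult coeff_smult)
qed (use assms in \<open>auto intro: hom_subst_closed\<close>)

text \<open>
  Scaling the representatives by \<open>c\<close> and \<open>s\<close> multiplies the substituted pair by the constant
  \<open>c s\<^sup>n\<close>, so every member of the union is the same class.
\<close>

lemma rat_comp_lowest:
  assumes AB: "lowest_terms R A B" and ST: "lowest_terms R S T"
  defines "n \<equiv> max (deg R A) (deg R B)"
  shows "rat_comp R (rat_frac R A B) (rat_frac R S T) =
    rat_frac R (hom_subst R n A S T) (hom_subst R n B S T)"
proof -
  note closed = lowest_terms_closed[OF AB] lowest_terms_closed[OF ST]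
  have eq: "rat_frac R (hom_subst R (max (deg R A') (deg R B')) A' S' T')
        (hom_subst R (max (deg R A') (deg R B')) B' S' T') =
      rat_frac R (hom_subst R n A S T) (hom_subst R n B S T)"
    if mem: "(A', B') \<in> rat_frac R A B" "(S', T') \<in> rat_frac R S T" for A' B' S' T'
  proof -
    obtain c where c: "A' = c \<odot>\<^bsub>P\<^esub> A" "B' = c \<odot>\<^bsub>P\<^esub> B" "c \<in> carrier R" "c \<noteq> \<zero>"
      using mem(1) unfolding rat_frac_lowest[OF AB] by blast
    obtain s where s: "S' = s \<odot>\<^bsub>P\<^esub> S" "T' = s \<odot>\<^bsub>P\<^esub> T" "s \<in> carrier R" "s \<noteq> \<zero>"
      using mem(2) unfolding rat_frac_lowest[OF ST] by blast
    have "max (deg R A') (deg R B') = n" unfolding n_def c(1,2) using c(3,4) closed by simp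
    moreover have "c \<otimes> s [^] n \<in> Units R"
      using c(3,4) s(3,4) field_Units by (intro R.Units_m_closed R.Units_pow_closed) auto
    hence "c \<otimes> s [^] n \<in> carrier R" "c \<otimes> s [^] n \<noteq> \<zero>" using field_Units by auto
    ultimately show ?thesis
      using closed rat_frac_smult[of "hom_subst R n A S T" "hom_subst R n B S T" "c \<otimes> s [^] n"]
      unfolding c(1,2) s(1,2)
      by (simp only: hom_subst_smult c(3) s(3) hom_subst_closed simp_thms)
  qed
  have mem: "(A, B) \<in> rat_frac R A B" "(S, T) \<in> rat_frac R S T"
    using AB ST by (auto intro: lowest_terms_mem_rat_frac)
  show ?thesis
  proof
    show "rat_comp R (rat_frac R A B) (rat_frac R S T) \<subseteq>
        rat_frac R (hom_subst R n A S T) (hom_subst R n B S T)"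
    proof
      fix z assume "z \<in> rat_comp R (rat_frac R A B) (rat_frac R S T)"
      then obtain A' B' S' T' where mem': "(A', B') \<in> rat_frac R A B" "(S', T') \<in> rat_frac R S T"
        and z: "z \<in> rat_frac R (hom_subst R (max (deg R A') (deg R B')) A' S' T')
          (hom_subst R (max (deg R A') (deg R B')) B' S' T')"
        unfolding rat_comp_def Let_def by fast
      show "z \<in> rat_frac R (hom_subst R n A S T) (hom_subst R n B S T)"
        using z unfolding eq[OF mem'] .
    qed
    show "rat_frac R (hom_subst R n A S T) (hom_subst R n B S T) \<subseteq>
        rat_comp R (rat_frac R A B) (rat_frac R S T)"
    proof
      fix z assume "z \<in> rat_frac R (hom_subst R n A S T) (hom_subst R n B S T)"
      thus "z \<in> rat_comp R (rat_frac R A B) (rat_frac R S T)"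
        unfolding rat_comp_def Let_def n_def
        by (intro UN_I[OF mem(1)]) (simp, rule bexI[OF _ mem(2)], simp)
    qed
  qed
qed

text \<open>
  A matrix acts on a pair of polynomials, regarded as a column vector, by linear combinations.
  Since the matrix is invertible, neither common factors nor a drop of the degree can arise.
\<close>

lemma lincomb_lowest:
  assumes M: "(a, b, c, d) \<in> carrier (GL2 R)" and low: "lowest_terms R A B"
  defines "S \<equiv> a \<odot>\<^bsub>P\<^esub> A \<oplus>\<^bsub>P\<^esub> b \<odot>\<^bsub>P\<^esub> B" and "T \<equiv> c \<odot>\<^bsub>P\<^esub> A \<oplus>\<^bsub>P\<^esub> d \<odot>\<^bsub>P\<^esub> B"
  shows "lowest_terms R S T" and "max (deg R S) (deg R T) = max (deg R A) (deg R B)"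
proof -
  note AB = lowest_terms_closed[OF low]
  have abcd: "a \<in> carrier R" "b \<in> carrier R" "c \<in> carrier R" "d \<in> carrier R"
    using M by (auto simp: GL2_carrier_iff)
  have ST: "S \<in> carrier P" "T \<in> carrier P" unfolding S_def T_def using abcd AB by auto
  interpret G: group "GL2 R" by (rule GL2_group[OF R.is_cring])
  obtain a' b' c' d' where N: "inv\<^bsub>GL2 R\<^esub> (a, b, c, d) = (a', b', c', d')"
    by (cases "inv\<^bsub>GL2 R\<^esub> (a, b, c, d)")
  have abcd': "a' \<in> carrier R" "b' \<in> carrier R" "c' \<in> carrier R" "d' \<in> carrier R"
    using G.inv_closed[OF M] unfolding N by (auto simp: GL2_carrier_iff)
  have one: "a' \<otimes> a \<oplus> b' \<otimes> c = \<one>" "a' \<otimes> b \<oplus> b' \<otimes> d = \<zero>"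
    "c' \<otimes> a \<oplus> d' \<otimes> c = \<zero>" "c' \<otimes> b \<oplus> d' \<otimes> d = \<one>"
    using G.l_inv[OF M] unfolding N GL2_mult_eq GL2_one_eq by auto
  have recombine: "x \<odot>\<^bsub>P\<^esub> S \<oplus>\<^bsub>P\<^esub> y \<odot>\<^bsub>P\<^esub> T =
      (x \<otimes> a \<oplus> y \<otimes> c) \<odot>\<^bsub>P\<^esub> A \<oplus>\<^bsub>P\<^esub> (x \<otimes> b \<oplus> y \<otimes> d) \<odot>\<^bsub>P\<^esub> B"
    if "x \<in> carrier R" "y \<in> carrier R" for x y
    unfolding S_def T_def using that abcd AB
    by (simp add: smult_r_distr smult_l_distr smult_assoc1 P.a_ac)
  have A: "A = a' \<odot>\<^bsub>P\<^esub> S \<oplus>\<^bsub>P\<^esub> b' \<odot>\<^bsub>P\<^esub> T" and B: "B = c' \<odot>\<^bsub>P\<^esub> S \<oplus>\<^bsub>P\<^esub> d' \<odot>\<^bsub>P\<^esub> T"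
    using AB abcd' by (simp_all add: recombine one)
  show "max (deg R S) (deg R T) = max (deg R A) (deg R B)"
  proof (rule antisym)
    show "max (deg R S) (deg R T) \<le> max (deg R A) (deg R B)"
      unfolding S_def T_def by (intro max.boundedI deg_lincomb_le abcd AB)
    have "deg R A \<le> max (deg R S) (deg R T)" "deg R B \<le> max (deg R S) (deg R T)"
      using deg_lincomb_le[OF abcd'(1,2) ST] deg_lincomb_le[OF abcd'(3,4) ST] A B by simp_all
    thus "max (deg R A) (deg R B) \<le> max (deg R S) (deg R T)" by simp
  qed
  obtain U V where UV: "U \<in> carrier P" "V \<in> carrier P" "U \<otimes>\<^bsub>P\<^esub> A \<oplus>\<^bsub>P\<^esub> V \<otimes>\<^bsub>P\<^esub> B = \<one>\<^bsub>P\<^esub>"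
    using lowest_terms_bezout[OF low] .
  show "lowest_terms R S T"
  proof (rule lowest_termsI[OF ST])
    have "(a' \<odot>\<^bsub>P\<^esub> U \<oplus>\<^bsub>P\<^esub> c' \<odot>\<^bsub>P\<^esub> V) \<otimes>\<^bsub>P\<^esub> S \<oplus>\<^bsub>P\<^esub> (b' \<odot>\<^bsub>P\<^esub> U \<oplus>\<^bsub>P\<^esub> d' \<odot>\<^bsub>P\<^esub> V) \<otimes>\<^bsub>P\<^esub> T =
        U \<otimes>\<^bsub>P\<^esub> (a' \<odot>\<^bsub>P\<^esub> S \<oplus>\<^bsub>P\<^esub> b' \<odot>\<^bsub>P\<^esub> T) \<oplus>\<^bsub>P\<^esub> V \<otimes>\<^bsub>P\<^esub> (c' \<odot>\<^bsub>P\<^esub> S \<oplus>\<^bsub>P\<^esub> d' \<odot>\<^bsub>P\<^esub> T)"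
      using UV(1,2) abcd' ST
      by (simp add: P.r_distr P.l_distr UP_smult_assoc2 P.m_comm[of U] P.m_comm[of V] P.a_ac)
    also have "\<dots> = \<one>\<^bsub>P\<^esub>" using UV(3) unfolding A[symmetric] B[symmetric] .
    finally show "(a' \<odot>\<^bsub>P\<^esub> U \<oplus>\<^bsub>P\<^esub> c' \<odot>\<^bsub>P\<^esub> V) \<otimes>\<^bsub>P\<^esub> S \<oplus>\<^bsub>P\<^esub> (b' \<odot>\<^bsub>P\<^esub> U \<oplus>\<^bsub>P\<^esub> d' \<odot>\<^bsub>P\<^esub> V) \<otimes>\<^bsub>P\<^esub> T \<in> Units P"
      by simp
  qed (use UV abcd' in auto)
qed

text \<open>
  Composition on the left acts by linear combinations; composition on the right with the inverse
  substitutes the linear forms of the adjugate.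
\<close>

lemma conjugate_eq:
  assumes M: "(a, b, c, d) \<in> carrier (GL2 R)" and low: "lowest_terms R A B"
  defines "n \<equiv> max (deg R A) (deg R B)"
  defines "f \<equiv> proj_class R (a, b, c, d)"
  defines "Z \<equiv> hom_subst R n (a \<odot>\<^bsub>P\<^esub> A \<oplus>\<^bsub>P\<^esub> b \<odot>\<^bsub>P\<^esub> B) (lin_poly R d (\<ominus> b)) (lin_poly R (\<ominus> c) a)"
  defines "W \<equiv> hom_subst R n (c \<odot>\<^bsub>P\<^esub> A \<oplus>\<^bsub>P\<^esub> d \<odot>\<^bsub>P\<^esub> B) (lin_poly R d (\<ominus> b)) (lin_poly R (\<ominus> c) a)"
  shows "rat_comp R (rat_comp R (moebius R f) (rat_frac R A B)) (moebius R (inv\<^bsub>PGL2 R\<^esub> f)) = rat_frac R Z W"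
proof -
  note AB = lowest_terms_closed[OF low]
  have abcd: "a \<in> carrier R" "b \<in> carrier R" "c \<in> carrier R" "d \<in> carrier R"
    using M by (auto simp: GL2_carrier_iff)
  have N: "(d, \<ominus> b, \<ominus> c, a) \<in> carrier (GL2 R)"
    using adj_mat_closed[OF R.is_cring M] by simp
  have inv: "inv\<^bsub>PGL2 R\<^esub> f = proj_class R (d, \<ominus> b, \<ominus> c, a)"
    unfolding f_def using proj_class_inv[OF R.is_cring M] by simp
  have "rat_comp R (moebius R f) (rat_frac R A B) =
      rat_frac R (a \<odot>\<^bsub>P\<^esub> A \<oplus>\<^bsub>P\<^esub> b \<odot>\<^bsub>P\<^esub> B) (c \<odot>\<^bsub>P\<^esub> A \<oplus>\<^bsub>P\<^esub> d \<odot>\<^bsub>P\<^esub> B)"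
    unfolding f_def moebius_proj_class[OF M] rat_comp_lowest[OF lowest_terms_lin(1)[OF M] low]
      lowest_terms_lin(2)[OF M]
    using abcd AB by (simp only: hom_subst_lin)
  thus ?thesis
    unfolding inv moebius_proj_class[OF N]
    by (simp only: rat_comp_lowest[OF lincomb_lowest(1)[OF M low] lowest_terms_lin(1)[OF N]]
        lincomb_lowest(2)[OF M low] Z_def W_def n_def)
qed

lemma conjugate_fixedI:
  assumes M: "(a, b, c, d) \<in> carrier (GL2 R)" and low: "lowest_terms R A B"
  defines "n \<equiv> max (deg R A) (deg R B)"
  defines "f \<equiv> proj_class R (a, b, c, d)"
  assumes s: "s \<in> carrier R" "s \<noteq> \<zero>"
  and "hom_subst R n (a \<odot>\<^bsub>P\<^esub> A \<oplus>\<^bsub>P\<^esub> b \<odot>\<^bsub>P\<^esub> B) (lin_poly R d (\<ominus> b)) (lin_poly R (\<ominus> c) a) = s \<odot>\<^bsub>P\<^esub> A"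
  and "hom_subst R n (c \<odot>\<^bsub>P\<^esub> A \<oplus>\<^bsub>P\<^esub> d \<odot>\<^bsub>P\<^esub> B) (lin_poly R d (\<ominus> b)) (lin_poly R (\<ominus> c) a) = s \<odot>\<^bsub>P\<^esub> B"
  shows "rat_comp R (rat_comp R (moebius R f) (rat_frac R A B)) (moebius R (inv\<^bsub>PGL2 R\<^esub> f)) = rat_frac R A B"
  using conjugate_eq[OF M low] assms rat_frac_smult[OF lowest_terms_closed[OF low] s] by simp

text \<open>
  A pair that represents the lowest-terms fraction \<open>A / B\<close> is a polynomial multiple \<open>(A H, B H)\<close>.  Here
  its degree is at most \<open>n = max (deg A) (deg B)\<close>, so \<open>H\<close> is constant.
\<close>

lemma conjugate_fixedD:
  assumes M: "(a, b, c, d) \<in> carrier (GL2 R)" and low: "lowest_terms R A B"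
  defines "n \<equiv> max (deg R A) (deg R B)"
  defines "f \<equiv> proj_class R (a, b, c, d)"
  assumes fixed: "rat_comp R (rat_comp R (moebius R f) (rat_frac R A B)) (moebius R (inv\<^bsub>PGL2 R\<^esub> f)) = rat_frac R A B"
  obtains s where "s \<in> carrier R" "s \<noteq> \<zero>"
  "hom_subst R n (a \<odot>\<^bsub>P\<^esub> A \<oplus>\<^bsub>P\<^esub> b \<odot>\<^bsub>P\<^esub> B) (lin_poly R d (\<ominus> b)) (lin_poly R (\<ominus> c) a) = s \<odot>\<^bsub>P\<^esub> A"
  "hom_subst R n (c \<odot>\<^bsub>P\<^esub> A \<oplus>\<^bsub>P\<^esub> d \<odot>\<^bsub>P\<^esub> B) (lin_poly R d (\<ominus> b)) (lin_poly R (\<ominus> c) a) = s \<odot>\<^bsub>P\<^esub> B"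
proof -
  note AB = lowest_terms_closed[OF low]
  have abcd: "a \<in> carrier R" "b \<in> carrier R" "c \<in> carrier R" "d \<in> carrier R"
    using M by (auto simp: GL2_carrier_iff)
  define l1 where "l1 = lin_poly R d (\<ominus> b)"
  define l2 where "l2 = lin_poly R (\<ominus> c) a"
  define Z where "Z = hom_subst R n (a \<odot>\<^bsub>P\<^esub> A \<oplus>\<^bsub>P\<^esub> b \<odot>\<^bsub>P\<^esub> B) l1 l2"
  define W where "W = hom_subst R n (c \<odot>\<^bsub>P\<^esub> A \<oplus>\<^bsub>P\<^esub> d \<odot>\<^bsub>P\<^esub> B) l1 l2"
  have l: "l1 \<in> carrier P" "l2 \<in> carrier P" "deg R l1 \<le> 1" "deg R l2 \<le> 1"
    unfolding l1_def l2_def using abcd by (simp_all add: lin_closed deg_lin_le[unfolded One_nat_def])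
  have ZW: "Z \<in> carrier P" "W \<in> carrier P" "deg R Z \<le> n" "deg R W \<le> n"
    unfolding Z_def W_def using abcd AB l by (auto intro!: hom_subst_closed deg_hom_subst_le)
  have eq: "rat_frac R Z W = rat_frac R A B"
    using conjugate_eq[OF M low] fixed unfolding Z_def W_def l1_def l2_def n_def f_def by simp
  hence "(A, B) \<in> rat_frac R Z W" using lowest_terms_mem_rat_frac[OF low] by simp
  hence "Z \<otimes>\<^bsub>P\<^esub> B = A \<otimes>\<^bsub>P\<^esub> W" unfolding rat_frac_def P_def[symmetric] by simp
  then obtain H where H: "H \<in> carrier P" "Z = A \<otimes>\<^bsub>P\<^esub> H" "W = B \<otimes>\<^bsub>P\<^esub> H"
    using lowest_terms_factor[OF low ZW(1,2)] by blast
  have H0: "H \<noteq> \<zero>\<^bsub>P\<^esub>"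
  proof
    \<comment> \<open>the pair \<open>(0, 0)\<close> would represent every fraction, in particular both \<open>1 / 0\<close> and \<open>0 / 1\<close>\<close>
    assume "H = \<zero>\<^bsub>P\<^esub>"
    hence ZW0: "Z = \<zero>\<^bsub>P\<^esub>" "W = \<zero>\<^bsub>P\<^esub>" using H AB by simp_all
    have "lowest_terms R \<one>\<^bsub>P\<^esub> \<zero>\<^bsub>P\<^esub>" "lowest_terms R \<zero>\<^bsub>P\<^esub> \<one>\<^bsub>P\<^esub>"
      by (rule lowest_termsI[of _ _ "\<one>\<^bsub>P\<^esub>" "\<one>\<^bsub>P\<^esub>"]; simp)+
    hence "(\<one>\<^bsub>P\<^esub>, \<zero>\<^bsub>P\<^esub>) \<in> rat_frac R Z W" "(\<zero>\<^bsub>P\<^esub>, \<one>\<^bsub>P\<^esub>) \<in> rat_frac R Z W"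
      unfolding rat_frac_def P_def[symmetric] ZW0 by auto
    hence 10: "(\<one>\<^bsub>P\<^esub>, \<zero>\<^bsub>P\<^esub>) \<in> rat_frac R A B" and 01: "(\<zero>\<^bsub>P\<^esub>, \<one>\<^bsub>P\<^esub>) \<in> rat_frac R A B"
      unfolding eq by auto
    have eqs: "A \<otimes>\<^bsub>P\<^esub> \<zero>\<^bsub>P\<^esub> = \<one>\<^bsub>P\<^esub> \<otimes>\<^bsub>P\<^esub> B" "A \<otimes>\<^bsub>P\<^esub> \<one>\<^bsub>P\<^esub> = \<zero>\<^bsub>P\<^esub> \<otimes>\<^bsub>P\<^esub> B"
      using 10 01 unfolding rat_frac_def P_def[symmetric] by auto
    have "\<zero>\<^bsub>P\<^esub> = B" using eqs(1) unfolding P.r_null[OF AB(1)] P.l_one[OF AB(2)] .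
    moreover have "A = \<zero>\<^bsub>P\<^esub>" using eqs(2) unfolding P.r_one[OF AB(1)] P.l_null[OF AB(2)] .
    ultimately show False using lowest_terms_nonzero[OF low] by simp
  qed
  have "deg R H = 0"
  proof (cases "deg R A = n \<and> A \<noteq> \<zero>\<^bsub>P\<^esub>")
    case True
    hence "deg R Z = n + deg R H" unfolding H(2) using deg_mult[of A H] H0 H(1) AB(1) by metis
    thus ?thesis using ZW(3) by linarith
  next
    case False
    moreover have "deg R A \<le> n" "deg R B \<le> n" "deg R A = n \<or> deg R B = n"
      unfolding n_def by linarith+
    moreover have "A = \<zero>\<^bsub>P\<^esub> \<Longrightarrow> deg R A = 0" "B = \<zero>\<^bsub>P\<^esub> \<Longrightarrow> deg R B = 0" by simp_all
    ultimately have "deg R B = n \<and> B \<noteq> \<zero>\<^bsub>P\<^esub>"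
      using lowest_terms_nonzero[OF low] by (metis le_0_eq)
    hence "deg R W = n + deg R H" unfolding H(3) using deg_mult[of B H] H0 H(1) AB(2) by metis
    thus ?thesis using ZW(4) by linarith
  qed
  hence Hc: "H = up_ring.monom P (up_ring.coeff P H 0) 0" using H(1) by (rule deg_zero_impl_monom[rotated])
  define s where "s = up_ring.coeff P H 0"
  have s: "s \<in> carrier R" "s \<noteq> \<zero>"
    unfolding s_def using H(1) H0 Hc by (auto simp del: coeff_monom)
  have "Z = s \<odot>\<^bsub>P\<^esub> A" "W = s \<odot>\<^bsub>P\<^esub> B"
    using monom_mult_is_smult[OF s(1) AB(1)] monom_mult_is_smult[OF s(1) AB(2)] Hc H AB
    unfolding s_def[symmetric] by (metis P.m_comm)+
  thus ?thesis using that s unfolding Z_def W_def l1_def l2_def by blast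
qed

end

section \<open>Reduction at a place\<close>

lemma type_ring_simps [simp]:
  "carrier (ring_of_type_algebra :: 'a::field ring) = UNIV"
  "x \<otimes>\<^bsub>ring_of_type_algebra\<^esub> y = x * (y :: 'a)"
  "x \<oplus>\<^bsub>ring_of_type_algebra\<^esub> y = x + (y :: 'a)"
  "\<one>\<^bsub>ring_of_type_algebra\<^esub> = (1 :: 'a)"
  "\<zero>\<^bsub>ring_of_type_algebra\<^esub> = (0 :: 'a)"
  unfolding ring_of_type_algebra_def by simp_all

lemma type_ring_field: "field (ring_of_type_algebra :: 'a::field ring)"
  by (rule field_from_type_algebra)

lemma type_ring_cring: "cring (ring_of_type_algebra :: 'a::field ring)"
  by (rule cring_from_type_algebra)

lemma type_ring_uminus [simp]: "\<ominus>\<^bsub>ring_of_type_algebra\<^esub> (x :: 'a::field) = - x"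
proof -
  interpret cring "ring_of_type_algebra :: 'a ring" by (rule type_ring_cring)
  show ?thesis using minus_equality[of "- x" x] by simp
qed

lemma type_ring_minus [simp]: "x \<ominus>\<^bsub>ring_of_type_algebra\<^esub> y = x - (y :: 'a::field)"
  by (simp add: a_minus_def)

lemma type_ring_Units [simp]: "Units (ring_of_type_algebra :: 'a::field ring) = {x. x \<noteq> 0}"
  using field.field_Units[OF type_ring_field[where ?'a='a]] by auto

lemma (in ring_hom_cring) hom_minus:
  "x \<in> carrier R \<Longrightarrow> y \<in> carrier R \<Longrightarrow> h (x \<ominus>\<^bsub>R\<^esub> y) = h x \<ominus>\<^bsub>S\<^esub> h y"
  by (simp add: a_minus_def)

context place begin

abbreviation "KK \<equiv> ring_of_type_algebra :: 'k ring"
abbreviation "Ov \<equiv> val_ring v"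
abbreviation "Fv \<equiv> residue_field v"

lemma val_ring_simps [simp]:
  "x \<in> carrier Ov \<longleftrightarrow> v x \<le> 1"
  "x \<otimes>\<^bsub>Ov\<^esub> y = x * y" "x \<oplus>\<^bsub>Ov\<^esub> y = x + y" "\<one>\<^bsub>Ov\<^esub> = 1" "\<zero>\<^bsub>Ov\<^esub> = 0"
  unfolding val_ring_def by (simp_all add: ring_of_type_algebra_def)

lemma val_ring_cring: "cring Ov"
proof (intro cringI abelian_groupI comm_monoidI)
  show "\<exists>y\<in>carrier Ov. y \<oplus>\<^bsub>Ov\<^esub> x = \<zero>\<^bsub>Ov\<^esub>" if "x \<in> carrier Ov" for x
    using that by (intro bexI[of _ "- x"]) auto
qed (auto intro: v_add_le v_mult_le_1 simp: algebra_simps mult_le_one)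

lemma val_ring_uminus [simp]: "v x \<le> 1 \<Longrightarrow> \<ominus>\<^bsub>Ov\<^esub> x = - x"
proof -
  interpret cring Ov by (rule val_ring_cring)
  show "v x \<le> 1 \<Longrightarrow> ?thesis" using minus_equality[of "- x" x] by simp
qed

lemma val_ring_minus [simp]: "v y \<le> 1 \<Longrightarrow> x \<ominus>\<^bsub>Ov\<^esub> y = x - y"
  by (simp add: a_minus_def)

lemma val_ring_Units [simp]: "x \<in> Units Ov \<longleftrightarrow> v x = 1"
proof
  assume "x \<in> Units Ov"
  then obtain y where "v x \<le> 1" "v y \<le> 1" "x * y = 1" unfolding Units_def by auto
  moreover from this have "v x * v y = 1" by (metis v_1 v_mult)
  ultimately show "v x = 1"
    using mult_left_le[of "v y" "v x"] by simp
next
  assume "v x = 1"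
  moreover from this have "x \<noteq> 0" by auto
  ultimately have "v (inverse x) \<le> 1" "inverse x * x = 1" "x * inverse x = 1" by auto
  thus "x \<in> Units Ov" using \<open>v x = 1\<close> unfolding Units_def by auto
qed

lemma max_ideal_maximal: "maximalideal (max_ideal v) Ov"
proof (rule maximalidealI)
  interpret cring Ov by (rule val_ring_cring)
  show "ideal (max_ideal v) Ov"
  proof (rule idealI)
    show "subgroup (max_ideal v) (add_monoid Ov)"
    proof
      show "inv\<^bsub>add_monoid Ov\<^esub> x \<in> max_ideal v" if "x \<in> max_ideal v" for x
        using that val_ring_uminus[of x] unfolding a_inv_def max_ideal_def by simp
    qed (auto simp: max_ideal_def v_add_less)
  qed (use val_ring_cring v_mult_less_1 in \<open>auto simp: max_ideal_def cring_def mult.commute\<close>)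
  show "carrier Ov \<noteq> max_ideal v"
    using v_1 unfolding max_ideal_def by (metis less_irrefl mem_Collect_eq order_refl val_ring_simps(1))
next
  fix J assume J: "ideal J Ov" "max_ideal v \<subseteq> J" "J \<subseteq> carrier Ov"
  show "J = max_ideal v \<or> J = carrier Ov"
  proof (rule disjCI)
    assume "J \<noteq> carrier Ov"
    have "v x < 1" if "x \<in> J" for x
    proof (rule ccontr)
      assume "\<not> v x < 1"
      hence "v x = 1" using that J(3) by force
      hence "inverse x * x \<in> J"
        using ideal.I_l_closed[OF J(1) that, of "inverse x"] by simp
      moreover have "x \<noteq> 0" using \<open>v x = 1\<close> by auto
      hence "inverse x * x = 1" by simp
      ultimately have "\<one>\<^bsub>Ov\<^esub> \<in> J" by simp
      thus False using ideal.one_imp_carrier[OF J(1)] \<open>J \<noteq> carrier Ov\<close> by blast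
    qed
    thus "J = max_ideal v" using J(2) unfolding max_ideal_def by auto
  qed
qed

lemma residue_field: "field Fv"
  unfolding residue_field_def
  by (rule maximalideal.quotient_is_field[OF max_ideal_maximal val_ring_cring])

lemma residue_cring: "cring Fv"
  using residue_field unfolding field_def domain_def by blast

lemma residue_hom: "residue v \<in> ring_hom Ov Fv"
proof -
  have "residue v = (+>\<^bsub>Ov\<^esub>) (max_ideal v)" unfolding residue_def by (rule ext) simp
  thus ?thesis
    unfolding residue_field_def
    using ideal.rcos_ring_hom maximalideal.axioms(1)[OF max_ideal_maximal] by metis
qed

lemma coeff_hom_residue: "coeff_hom Ov Fv (residue v)"
  by (intro coeff_hom.intro coeff_hom_axioms.intro val_ring_cring residue_cring residue_hom)

lemma coeff_hom_inclusion: "coeff_hom Ov KK id"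
  by (intro coeff_hom.intro coeff_hom_axioms.intro val_ring_cring type_ring_cring)
    (auto simp: ring_hom_def)

lemma residue_eq_0_iff:
  assumes "v x \<le> 1"
  shows "residue v x = \<zero>\<^bsub>Fv\<^esub> \<longleftrightarrow> v x < 1"
proof -
  interpret ideal "max_ideal v" Ov by (rule maximalideal.axioms(1)[OF max_ideal_maximal])
  have "residue v x = max_ideal v \<longleftrightarrow> x \<in> max_ideal v"
    unfolding residue_def using rcos_const_imp_mem[of x] a_rcos_const assms by auto
  thus ?thesis unfolding residue_field_def FactRing_def max_ideal_def by simp
qed

lemma residue_eq_iff:
  assumes "v x \<le> 1" "v y \<le> 1"
  shows "residue v x = residue v y \<longleftrightarrow> v (x - y) < 1"
proof -
  interpret coeff_hom Ov Fv "residue v" by (rule coeff_hom_residue)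
  have "residue v (x \<ominus>\<^bsub>Ov\<^esub> y) = residue v x \<ominus>\<^bsub>Fv\<^esub> residue v y"
    using assms by (intro H.hom_minus) auto
  hence "residue v (x - y) = residue v x \<ominus>\<^bsub>Fv\<^esub> residue v y" using assms by simp
  moreover have "residue v x \<ominus>\<^bsub>Fv\<^esub> residue v y = \<zero>\<^bsub>Fv\<^esub> \<longleftrightarrow> residue v x = residue v y"
    using assms by (intro S.r_right_minus_eq) auto
  ultimately show ?thesis using residue_eq_0_iff[of "x - y"] v_diff_le assms by simp
qed

lemma residue_carrier: "carrier Fv = residue v ` {x. v x \<le> 1}"
  unfolding residue_field_def FactRing_def A_RCOSETS_def' residue_def by auto

lemma residue_closed: "v x \<le> 1 \<Longrightarrow> residue v x \<in> carrier Fv"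
  unfolding residue_carrier by blast

lemma residue_Units: "v x = 1 \<Longrightarrow> residue v x \<in> Units Fv"
  using residue_eq_0_iff[of x] residue_closed[of x] field.field_Units[OF residue_field] by auto

text \<open>Polynomials with coefficients integral at \<open>v\<close> may be computed with over either ring.\<close>

lemma UP_val_ring_iff: "F \<in> carrier (UP Ov) \<longleftrightarrow> F \<in> carrier (UP KK) \<and> (\<forall>i. v (F i) \<le> 1)"
  unfolding UP_def up_def by (auto simp: Pi_def)

lemma UP_val_ring_eqs:
  assumes "F \<in> carrier (UP Ov)" "G \<in> carrier (UP Ov)"
  shows "F \<oplus>\<^bsub>UP Ov\<^esub> G = F \<oplus>\<^bsub>UP KK\<^esub> G"
    and "v a \<le> 1 \<Longrightarrow> a \<odot>\<^bsub>UP Ov\<^esub> F = a \<odot>\<^bsub>UP KK\<^esub> F"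
    and "H \<in> carrier (UP Ov) \<Longrightarrow> hom_subst Ov n H F G = hom_subst KK n H F G"
proof -
  interpret coeff_hom Ov KK id by (rule coeff_hom_inclusion)
  show "F \<oplus>\<^bsub>UP Ov\<^esub> G = F \<oplus>\<^bsub>UP KK\<^esub> G"
    using ring_hom_add[OF comp_ring_hom assms] by simp
  show "v a \<le> 1 \<Longrightarrow> a \<odot>\<^bsub>UP Ov\<^esub> F = a \<odot>\<^bsub>UP KK\<^esub> F"
    using comp_smult[of a F] assms by simp
  show "H \<in> carrier (UP Ov) \<Longrightarrow> hom_subst Ov n H F G = hom_subst KK n H F G"
    using comp_hom_subst[of H F G n] assms by simp
qed

lemma lin_poly_val_ring:
  assumes "v a \<le> 1" "v b \<le> 1"
  shows "lin_poly Ov a b = lin_poly KK a b"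
proof -
  interpret coeff_hom Ov KK id by (rule coeff_hom_inclusion)
  show ?thesis using comp_lin_poly[of a b] assms by simp
qed

text \<open>
  An identity of the form occurring in \<open>conjugate_fixedD\<close> with integral coefficients holds over the
  valuation ring, and may therefore be reduced.
\<close>

lemma residue_identity:
  assumes AB: "A \<in> carrier (UP Ov)" "B \<in> carrier (UP Ov)" "C \<in> carrier (UP Ov)"
    and abs: "v a \<le> 1" "v b \<le> 1" "v s \<le> 1" "v p \<le> 1" "v q \<le> 1" "v p' \<le> 1" "v q' \<le> 1"
    and eq: "hom_subst KK n (a \<odot>\<^bsub>UP KK\<^esub> A \<oplus>\<^bsub>UP KK\<^esub> b \<odot>\<^bsub>UP KK\<^esub> B) (lin_poly KK p q) (lin_poly KK p' q') =
      s \<odot>\<^bsub>UP KK\<^esub> C"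
  shows "hom_subst Fv n (residue v a \<odot>\<^bsub>UP Fv\<^esub> (residue v \<circ> A) \<oplus>\<^bsub>UP Fv\<^esub> residue v b \<odot>\<^bsub>UP Fv\<^esub> (residue v \<circ> B))
      (lin_poly Fv (residue v p) (residue v q)) (lin_poly Fv (residue v p') (residue v q')) =
      residue v s \<odot>\<^bsub>UP Fv\<^esub> (residue v \<circ> C)"
proof -
  interpret coeff_hom Ov Fv "residue v" by (rule coeff_hom_residue)
  let ?L = "a \<odot>\<^bsub>UP Ov\<^esub> A \<oplus>\<^bsub>UP Ov\<^esub> b \<odot>\<^bsub>UP Ov\<^esub> B"
  have abs': "a \<in> carrier Ov" "b \<in> carrier Ov" "s \<in> carrier Ov" "p \<in> carrier Ov" "q \<in> carrier Ov"
    "p' \<in> carrier Ov" "q' \<in> carrier Ov"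
    using abs by auto
  have closed: "a \<odot>\<^bsub>UP Ov\<^esub> A \<in> carrier (UP Ov)" "b \<odot>\<^bsub>UP Ov\<^esub> B \<in> carrier (UP Ov)" "?L \<in> carrier (UP Ov)"
    using AB abs' by auto
  have lin: "lin_poly Ov p q \<in> carrier (UP Ov)" "lin_poly Ov p' q' \<in> carrier (UP Ov)"
    using abs' by (auto intro: lin_poly_closed[OF val_ring_cring])
  have "hom_subst Ov n ?L (lin_poly Ov p q) (lin_poly Ov p' q') = s \<odot>\<^bsub>UP Ov\<^esub> C"
    using eq UP_val_ring_eqs(1)[OF closed(1,2)] UP_val_ring_eqs(2)[OF AB(1) AB(1) abs(1)]
      UP_val_ring_eqs(2)[OF AB(2) AB(2) abs(2)] UP_val_ring_eqs(2)[OF AB(3) AB(3) abs(3)]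
      UP_val_ring_eqs(3)[OF lin closed(3)] lin_poly_val_ring abs by simp
  hence "residue v \<circ> hom_subst Ov n ?L (lin_poly Ov p q) (lin_poly Ov p' q') = residue v \<circ> (s \<odot>\<^bsub>UP Ov\<^esub> C)"
    by simp
  thus ?thesis
    using AB abs' closed lin ring_hom_add[OF comp_ring_hom closed(1,2)]
    by (simp only: comp_hom_subst comp_smult comp_lin_poly)
qed

definition normalized :: "(nat \<Rightarrow> 'k) \<Rightarrow> (nat \<Rightarrow> 'k) \<Rightarrow> bool" where
  "normalized A B \<longleftrightarrow> (\<forall>i. v (A i) \<le> 1 \<and> v (B i) \<le> 1) \<and> (\<exists>i. v (A i) = 1 \<or> v (B i) = 1)"

lemma normalized_exists:
  assumes low: "lowest_terms KK A B"
  obtains A' B' where "lowest_terms KK A' B'" "rat_frac KK A' B' = rat_frac KK A B" "normalized A' B'"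
proof -
  interpret K: UP_field KK "UP KK" by (intro UP_field.intro type_ring_field)
  note AB = K.lowest_terms_closed[OF low]
  have "finite (range F)" if F: "F \<in> carrier (UP KK)" for F
  proof -
    obtain n where "bound (0::'k) n F" using F unfolding UP_def up_def by auto
    hence "range F \<subseteq> insert 0 (F ` {..n})" by (auto simp: bound_def image_iff not_le[symmetric])
    thus ?thesis by (rule finite_subset) simp
  qed
  hence fin: "finite (range A \<union> range B)" using AB by simp
  have "\<exists>x\<in>range A \<union> range B. x \<noteq> 0"
  proof (rule ccontr)
    assume "\<not> ?thesis"
    hence "A = (\<lambda>_. 0)" "B = (\<lambda>_. 0)" by auto
    thus False using K.lowest_terms_nonzero[OF low] unfolding UP_def by simp
  qed
  then obtain x0 where x0: "x0 \<in> range A \<union> range B" "x0 \<noteq> 0" by blast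
  define m where "m = Max (v ` (range A \<union> range B))"
  have "m \<in> v ` (range A \<union> range B)" unfolding m_def using fin x0 by (intro Max_in) auto
  then obtain x where x: "x \<in> range A \<union> range B" "v x = m" by auto
  have le: "v y \<le> v x" if "y \<in> range A \<union> range B" for y
    unfolding x(2) m_def using fin that by (intro Max_ge) auto
  have "v x > 0" using le[OF x0(1)] x0(2) v_nonneg[of x0] v_eq_0[of x0] by linarith
  hence x_nz: "x \<noteq> 0" by auto
  let ?A = "inverse x \<odot>\<^bsub>UP KK\<^esub> A" and ?B = "inverse x \<odot>\<^bsub>UP KK\<^esub> B"
  have coeffs: "?A i = inverse x * A i" "?B i = inverse x * B i" for i
    using AB by (simp_all add: UP_apply(4)[OF type_ring_cring])
  have "v (?A i) \<le> 1 \<and> v (?B i) \<le> 1" for i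
    using le[of "A i"] le[of "B i"] \<open>v x > 0\<close> unfolding coeffs by (simp add: field_simps)
  moreover have "\<exists>i. v (?A i) = 1 \<or> v (?B i) = 1"
    using x(1) x_nz unfolding coeffs by (auto simp: field_simps)
  ultimately have "normalized ?A ?B" unfolding normalized_def by blast
  thus ?thesis
    using that[of ?A ?B] K.lowest_terms_smult[OF low, of "inverse x"] K.rat_frac_smult[OF AB, of "inverse x"] x_nz
    by simp
qed

lemma normalized_closed:
  assumes "lowest_terms KK A B" "normalized A B"
  shows "A \<in> carrier (UP Ov)" "B \<in> carrier (UP Ov)"
  using assms unfolding lowest_terms_def normalized_def UP_val_ring_iff by auto

text \<open>Two normalized representatives differ by a constant of absolute value \<open>1\<close>, which reduces to a unit.\<close>

lemma reduction_eq:
  assumes low: "lowest_terms KK A B" and norm: "normalized A B"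
  shows "reduction v (rat_frac KK A B) = rat_frac Fv (residue v \<circ> A) (residue v \<circ> B)"
proof -
  interpret K: UP_field KK "UP KK" by (intro UP_field.intro type_ring_field)
  interpret F: UP_field Fv "UP Fv" by (intro UP_field.intro residue_field)
  interpret C: coeff_hom Ov Fv "residue v" by (rule coeff_hom_residue)
  note AB = normalized_closed[OF assms]
  have eq: "rat_frac Fv (residue v \<circ> A') (residue v \<circ> B') = rat_frac Fv (residue v \<circ> A) (residue v \<circ> B)"
    if mem: "(A', B') \<in> rat_frac KK A B" and norm': "normalized A' B'" for A' B'
  proof -
    obtain c where c: "A' = c \<odot>\<^bsub>UP KK\<^esub> A" "B' = c \<odot>\<^bsub>UP KK\<^esub> B" "c \<noteq> 0"
      using mem unfolding K.rat_frac_lowest[OF low] by auto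
    have coeffs: "A' i = c * A i" "B' i = c * B i" for i
      using K.lowest_terms_closed[OF low] unfolding c(1,2) by (simp_all add: UP_apply(4)[OF type_ring_cring])
    obtain i where "v (A i) = 1 \<or> v (B i) = 1" using norm unfolding normalized_def by blast
    hence "v c = v (A' i) \<or> v c = v (B' i)" unfolding coeffs by auto
    hence "v c \<le> 1" using norm' unfolding normalized_def by metis
    moreover have "v c \<ge> 1"
    proof -
      obtain j where "v (A' j) = 1 \<or> v (B' j) = 1" using norm' unfolding normalized_def by blast
      hence "v c * v (A j) = 1 \<or> v c * v (B j) = 1" unfolding coeffs by auto
      moreover have "v c * v (A j) \<le> v c" "v c * v (B j) \<le> v c"
        using norm unfolding normalized_def by (auto intro!: mult_left_le)
      ultimately show ?thesis by auto
    qed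
    ultimately have vc: "v c = 1" by simp
    have "A' = c \<odot>\<^bsub>UP Ov\<^esub> A" "B' = c \<odot>\<^bsub>UP Ov\<^esub> B"
      unfolding c(1,2) using UP_val_ring_eqs(2)[OF AB(1,1), of c] UP_val_ring_eqs(2)[OF AB(2,2), of c] vc by auto
    hence "residue v \<circ> A' = residue v c \<odot>\<^bsub>UP Fv\<^esub> (residue v \<circ> A)"
      "residue v \<circ> B' = residue v c \<odot>\<^bsub>UP Fv\<^esub> (residue v \<circ> B)"
      using C.comp_smult AB vc by auto
    thus ?thesis
      using F.rat_frac_smult[OF C.comp_closed[OF AB(1)] C.comp_closed[OF AB(2)], of "residue v c"]
        residue_eq_0_iff[of c] residue_closed[of c] vc by simp
  qed
  have "reduction v (rat_frac KK A B) =
      (\<Union>(P, Q) \<in> {(P, Q) \<in> rat_frac KK A B. normalized P Q}. rat_frac Fv (residue v \<circ> P) (residue v \<circ> Q))"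
    unfolding reduction_def normalized_def by simp
  also have "\<dots> = (\<Union>(P, Q) \<in> {(P, Q) \<in> rat_frac KK A B. normalized P Q}. rat_frac Fv (residue v \<circ> A) (residue v \<circ> B))"
    by (rule SUP_cong[OF refl]) (use eq in auto)
  also have "\<dots> = rat_frac Fv (residue v \<circ> A) (residue v \<circ> B)"
    using K.lowest_terms_mem_rat_frac[OF low] norm by auto
  finally show ?thesis .
qed

text \<open>
  The reduced pair has degree at most \<open>n\<close>, and any common factor would make the degree of the reduced
  fraction smaller.
\<close>

lemma good_reduction_lowest:
  assumes low: "lowest_terms KK A B" and norm: "normalized A B"
    and good: "good_reduction v (rat_frac KK A B)"
  defines "n \<equiv> max (deg KK A) (deg KK B)"
  shows "lowest_terms Fv (residue v \<circ> A) (residue v \<circ> B)"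
    and "max (deg Fv (residue v \<circ> A)) (deg Fv (residue v \<circ> B)) = n"
proof -
  interpret K: UP_field KK "UP KK" by (intro UP_field.intro type_ring_field)
  interpret F: UP_field Fv "UP Fv" by (intro UP_field.intro residue_field)
  interpret C: coeff_hom Ov Fv "residue v" by (rule coeff_hom_residue)
  note AB = normalized_closed[OF low norm]
  have degree: "rat_degree Fv (rat_frac Fv (residue v \<circ> A) (residue v \<circ> B)) = n"
    using good unfolding good_reduction_def reduction_eq[OF low norm] n_def K.rat_degree_lowest[OF low] .
  have deg: "deg Fv (residue v \<circ> C) \<le> n" if "C \<in> carrier (UP Ov)" "deg KK C \<le> n" for C
  proof (rule F.deg_aboveI[OF _ C.comp_closed[OF that(1)]])
    fix m assume "n < m"
    hence "up_ring.coeff (UP KK) C m = 0"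
      using K.deg_aboveD[of C m] that by (simp add: UP_val_ring_iff)
    hence "C m = 0" using that(1) UP_apply(1)[OF type_ring_cring, of C m] by (simp add: UP_val_ring_iff)
    thus "up_ring.coeff (UP Fv) (residue v \<circ> C) m = \<zero>\<^bsub>Fv\<^esub>"
      using C.comp_closed[OF that(1)] UP_apply(1)[OF residue_cring] residue_eq_0_iff[of 0] by simp
  qed
  have nz: "residue v \<circ> A \<noteq> \<zero>\<^bsub>UP Fv\<^esub> \<or> residue v \<circ> B \<noteq> \<zero>\<^bsub>UP Fv\<^esub>"
  proof -
    obtain i where "v (A i) = 1 \<or> v (B i) = 1" using norm unfolding normalized_def by blast
    hence "(residue v \<circ> A) i \<noteq> \<zero>\<^bsub>Fv\<^esub> \<or> (residue v \<circ> B) i \<noteq> \<zero>\<^bsub>Fv\<^esub>"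
      using residue_eq_0_iff[of "A i"] residue_eq_0_iff[of "B i"] by auto
    moreover have "\<zero>\<^bsub>UP Fv\<^esub> = (\<lambda>_. \<zero>\<^bsub>Fv\<^esub>)" unfolding UP_def by simp
    ultimately show ?thesis by metis
  qed
  show "lowest_terms Fv (residue v \<circ> A) (residue v \<circ> B)"
    and "max (deg Fv (residue v \<circ> A)) (deg Fv (residue v \<circ> B)) = n"
    using F.lowest_terms_if_full_degree[OF C.comp_closed[OF AB(1)] C.comp_closed[OF AB(2)] nz deg[OF AB(1)] deg[OF AB(2)] degree]
    by (auto simp: n_def)
qed

end

section \<open>Binary forms\<close>

text \<open>
  The binary form of degree \<open>n\<close> that homogenizes the polynomial with coefficients \<open>A\<close>; it can also be
  evaluated at the point at infinity \<open>y = 0\<close>.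
\<close>

definition hval :: "nat \<Rightarrow> (nat \<Rightarrow> 'a::comm_ring_1) \<Rightarrow> 'a \<Rightarrow> 'a \<Rightarrow> 'a" where
  "hval n A x y = (\<Sum>i\<le>n. A i * x ^ i * y ^ (n - i))"

lemma hval_scale: "hval n A (k * x) (k * y) = k ^ n * hval n A x y"
proof -
  have "A i * (k * x) ^ i * (k * y) ^ (n - i) = k ^ n * (A i * x ^ i * y ^ (n - i))" if "i \<le> n" for i
  proof -
    have "k ^ n = k ^ i * k ^ (n - i)" using that by (simp flip: power_add)
    thus ?thesis by (simp add: power_mult_distrib algebra_simps)
  qed
  thus ?thesis unfolding hval_def by (simp add: sum_distrib_left)
qed

lemma hval_at_infinity: "hval n A x 0 = A n * x ^ n"
proof -
  have "hval n A x 0 = (\<Sum>i\<in>{n}. A i * x ^ i * 0 ^ (n - i))"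
    unfolding hval_def by (rule sum.mono_neutral_right) (auto simp: power_0_left)
  thus ?thesis by simp
qed

lemma hval_lincomb: "hval n (\<lambda>i. a * A i + b * B i) x y = a * hval n A x y + b * hval n B x y"
  unfolding hval_def by (simp add: sum_distrib_left sum.distrib algebra_simps)

lemma to_ac_hval: "to_ac (hval n A x y) = hval n (to_ac \<circ> A) (to_ac x) (to_ac y)"
  unfolding hval_def by (simp add: to_ac_sum)

text \<open>Along a line, a binary form is a polynomial function of the parameter.\<close>

definition line_poly :: "nat \<Rightarrow> (nat \<Rightarrow> 'a::comm_ring_1) \<Rightarrow> 'a \<Rightarrow> 'a \<Rightarrow> 'a \<Rightarrow> 'a \<Rightarrow> 'a poly" where
  "line_poly n A x0 x1 y0 y1 = (\<Sum>i\<le>n. Polynomial.smult (A i) ([:x0, x1:] ^ i * [:y0, y1:] ^ (n - i)))"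

lemma poly_line_poly: "poly (line_poly n A x0 x1 y0 y1) u = hval n A (x0 + u * x1) (y0 + u * y1)"
  unfolding line_poly_def hval_def by (simp add: Polynomial.poly_sum mult.assoc)

lemma poly_eq_if_infinite:
  fixes p q :: "'a::idom poly"
  assumes "infinite {u. poly p u = poly q u}"
  shows "p = q"
proof -
  have "{u. poly p u = poly q u} = {u. poly (p - q) u = 0}" by simp
  hence "p - q = 0" using assms poly_roots_finite[of "p - q"] by metis
  thus ?thesis by simp
qed

section \<open>Self-maps of the line commuting with a linear map\<close>

text \<open>
  With \<open>\<Phi>\<close> the pair of binary forms \<open>A\<close> and \<open>B\<close>, this is \<open>\<Phi>(M w) = t M \<Phi>(w)\<close> for all vectors \<open>w\<close>.
  The factor \<open>t\<close> accounts for the scaling of homogeneous coordinates.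
\<close>

definition commuting ::
  "nat \<Rightarrow> (nat \<Rightarrow> 'a) \<Rightarrow> (nat \<Rightarrow> 'a) \<Rightarrow> 'a::field mat2 \<Rightarrow> 'a \<Rightarrow> bool" where
  "commuting n A B M t \<longleftrightarrow> (case M of (a, b, c, d) \<Rightarrow>
     \<forall>x y. hval n A (a * x + b * y) (c * x + d * y) = t * (a * hval n A x y + b * hval n B x y) \<and>
           hval n B (a * x + b * y) (c * x + d * y) = t * (c * hval n A x y + d * hval n B x y))"

lemma commutingD:
  assumes "commuting n A B (a, b, c, d) t"
  shows "hval n A (a * x + b * y) (c * x + d * y) = t * (a * hval n A x y + b * hval n B x y)"
    and "hval n B (a * x + b * y) (c * x + d * y) = t * (c * hval n A x y + d * hval n B x y)"
  using assms unfolding commuting_def by auto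

lemma commuting_mult:
  assumes "commuting n A B (a, b, c, d) t" "commuting n A B (a', b', c', d') t'"
  shows "commuting n A B (a * a' + b * c', a * b' + b * d', c * a' + d * c', c * b' + d * d') (t * t')"
proof -
  have eqs: "(a * a' + b * c') * x + (a * b' + b * d') * y = a * (a' * x + b' * y) + b * (c' * x + d' * y)"
    "(c * a' + d * c') * x + (c * b' + d * d') * y = c * (a' * x + b' * y) + d * (c' * x + d' * y)" for x y
    by (simp_all add: algebra_simps)
  show ?thesis
    unfolding commuting_def prod.case eqs commutingD[OF assms(1)] commutingD[OF assms(2)]
    by (simp add: algebra_simps)
qed

text \<open>Substitute \<open>adj(M) w\<close> for \<open>w\<close> and use \<open>M adj(M) = det M\<close>.\<close>

lemma commuting_adj:
  fixes t :: "'a::field"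
  assumes M: "commuting n A B (a, b, c, d) t" and "t \<noteq> 0" and det: "a * d - b * c \<noteq> 0"
  shows "commuting n A B (d, - b, - c, a) ((a * d - b * c) ^ n / (t * (a * d - b * c)))"
proof -
  define e where "e = a * d - b * c"
  have e: "e \<noteq> 0" using det unfolding e_def .
  have "hval n A (d * x + - b * y) (- c * x + a * y) = e ^ n / (t * e) * (d * hval n A x y + - b * hval n B x y)"
    and "hval n B (d * x + - b * y) (- c * x + a * y) = e ^ n / (t * e) * (- c * hval n A x y + a * hval n B x y)"
    for x y
  proof -
    define u where "u = hval n A (d * x + - b * y) (- c * x + a * y)"
    define w where "w = hval n B (d * x + - b * y) (- c * x + a * y)"
    have adj: "a * (d * x + - b * y) + b * (- c * x + a * y) = e * x"
      "c * (d * x + - b * y) + d * (- c * x + a * y) = e * y"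
      unfolding e_def by (simp_all add: algebra_simps)
    have eqs: "e ^ n * hval n A x y = t * (a * u + b * w)" "e ^ n * hval n B x y = t * (c * u + d * w)"
      using commutingD[OF M, of "d * x + - b * y" "- c * x + a * y"]
      unfolding adj hval_scale u_def w_def by simp_all
    have "e ^ n * (d * hval n A x y + - b * hval n B x y) = d * (e ^ n * hval n A x y) - b * (e ^ n * hval n B x y)"
      by (simp add: algebra_simps)
    also have "\<dots> = t * e * u" unfolding eqs by (simp add: e_def algebra_simps)
    finally show "u = e ^ n / (t * e) * (d * hval n A x y + - b * hval n B x y)"
      using e assms(2) by (simp add: field_simps)
    have "e ^ n * (- c * hval n A x y + a * hval n B x y) = - c * (e ^ n * hval n A x y) + a * (e ^ n * hval n B x y)"
      by (simp add: algebra_simps)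
    also have "\<dots> = t * e * w" unfolding eqs by (simp add: e_def algebra_simps)
    finally show "w = e ^ n / (t * e) * (- c * hval n A x y + a * hval n B x y)"
      using e assms(2) by (simp add: field_simps)
  qed
  thus ?thesis unfolding commuting_def e_def by simp
qed

definition no_common_zero :: "nat \<Rightarrow> (nat \<Rightarrow> 'a::comm_ring_1) \<Rightarrow> (nat \<Rightarrow> 'a) \<Rightarrow> bool" where
  "no_common_zero n A B \<longleftrightarrow>
     (\<forall>x y. x \<noteq> 0 \<or> y \<noteq> 0 \<longrightarrow> hval n A x y \<noteq> 0 \<or> hval n B x y \<noteq> 0)"

lemma kernel_vector:
  fixes a b c d :: "'a::field"
  assumes "a * d - b * c = 0"
  obtains x y where "x \<noteq> 0 \<or> y \<noteq> 0" "a * x + b * y = 0" "c * x + d * y = 0"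
proof (cases "a = 0 \<and> b = 0")
  case True
  show ?thesis
  proof (cases "c = 0 \<and> d = 0")
    case True thus ?thesis using \<open>a = 0 \<and> b = 0\<close> that[of 1 0] by simp
  next
    case False thus ?thesis using True that[of d "- c"] by (auto simp: algebra_simps)
  qed
next
  case False
  thus ?thesis using assms that[of b "- a"] by (auto simp: algebra_simps)
qed

lemma eigenvalue_root:
  fixes a b c d :: "'a::field"
  assumes "x \<noteq> 0 \<or> y \<noteq> 0" "a * x + b * y = k * x" "c * x + d * y = k * y"
  shows "(k - a) * (k - d) = b * c"
proof -
  have 1: "(k - a) * x = b * y" "(k - d) * y = c * x" using assms(2,3) by (simp_all add: algebra_simps)
  have "((k - a) * (k - d) - b * c) * x = 0" "((k - a) * (k - d) - b * c) * y = 0"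
  proof -
    have "((k - a) * (k - d) - b * c) * x = (k - d) * ((k - a) * x) - b * (c * x)"
      by (simp add: algebra_simps)
    also have "\<dots> = b * ((k - d) * y) - b * (c * x)" unfolding 1(1) by (simp add: algebra_simps)
    finally show "((k - a) * (k - d) - b * c) * x = 0" unfolding 1(2) by simp
    have "((k - a) * (k - d) - b * c) * y = (k - a) * ((k - d) * y) - c * (b * y)"
      by (simp add: algebra_simps)
    also have "\<dots> = c * ((k - a) * x) - c * (b * y)" unfolding 1(2) by (simp add: algebra_simps)
    finally show "((k - a) * (k - d) - b * c) * y = 0" unfolding 1(1) by simp
  qed
  thus ?thesis using assms(1) by auto
qed

text \<open>
  The map sends an eigenvector \<open>w\<close> of \<open>M\<close> with eigenvalue \<open>k\<close> to an eigenvector with eigenvalue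
  \<open>k\<^sup>n / t\<close>, because \<open>k\<^sup>n \<Phi>(w) = \<Phi>(M w) = t M \<Phi>(w)\<close>.
\<close>

lemma commuting_eigenvalue:
  fixes t :: "'a::field"
  assumes M: "commuting n A B (a, b, c, d) t" and t: "t \<noteq> 0" and nz: "no_common_zero n A B"
    and k: "(k - a) * (k - d) = b * c"
  shows "(k ^ n / t - a) * (k ^ n / t - d) = b * c"
proof -
  have "(a - k) * (d - k) - b * c = 0" using k by (simp add: algebra_simps)
  then obtain x y where xy: "x \<noteq> 0 \<or> y \<noteq> 0" "(a - k) * x + b * y = 0" "c * x + (d - k) * y = 0"
    by (rule kernel_vector)
  have w: "a * x + b * y = k * x" "c * x + d * y = k * y"
    using xy(2,3) by (simp_all add: algebra_simps)
  have "k ^ n * hval n A x y = t * (a * hval n A x y + b * hval n B x y)"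
    "k ^ n * hval n B x y = t * (c * hval n A x y + d * hval n B x y)"
    using commutingD[OF M, of x y] unfolding w hval_scale by simp_all
  hence "a * hval n A x y + b * hval n B x y = k ^ n / t * hval n A x y"
    "c * hval n A x y + d * hval n B x y = k ^ n / t * hval n B x y"
    using t by (simp_all add: field_simps)
  moreover have "hval n A x y \<noteq> 0 \<or> hval n B x y \<noteq> 0" using nz xy(1) unfolding no_common_zero_def by blast
  ultimately show ?thesis using eigenvalue_root[of "hval n A x y" "hval n B x y"] by blast
qed

text \<open>
  If \<open>M\<close> is not semisimple, it is a multiple of \<open>1 + N\<close> with \<open>N\<^sup>2 = 0\<close>.  Along the line \<open>w + u N w\<close> the
  map is then affine in \<open>u\<close>, since it is so at the multiples of a fixed \<open>u \<noteq> 0\<close>, which are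
  infinitely many in characteristic \<open>0\<close>.  This is impossible for degree at least \<open>2\<close>: the point at
  infinity of the line would be a common zero.
\<close>

lemma commuting_not_unipotent:
  fixes t :: "'a::field_char_0"
  assumes M: "commuting n A B (a, b, c, d) t" and t: "t \<noteq> 0" and nz: "no_common_zero n A B"
    and n: "n \<ge> 2" and k: "k \<noteq> 0" "a + d = 2 * k" "a * d - b * c = k\<^sup>2"
  shows "b = 0 \<and> c = 0 \<and> a = d"
proof (rule ccontr)
  assume nonscalar: "\<not> ?thesis"
  define e where "e = a - k"
  have a: "a = k + e" and d: "d = k - e" using k(2) unfolding e_def by (simp_all add: algebra_simps)
  have ee: "e * e + b * c = 0" using k(3) unfolding a d by (simp add: algebra_simps power2_eq_square)
  obtain w1 w2 where w: "e * w1 + b * w2 \<noteq> 0 \<or> c * w1 - e * w2 \<noteq> 0"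
  proof (cases "b = 0 \<and> e = 0")
    case True
    hence "c \<noteq> 0" using nonscalar a d by auto
    thus ?thesis using that[of 1 0] by simp
  next
    case False
    thus ?thesis using that[of 1 0] that[of 0 1] by auto
  qed
  define z1 where "z1 = e * w1 + b * w2"
  define z2 where "z2 = c * w1 - e * w2"
  have z0: "z1 \<noteq> 0 \<or> z2 \<noteq> 0" using w unfolding z1_def z2_def .
  have "e * z1 + b * z2 = (e * e + b * c) * w1" "c * z1 - e * z2 = (e * e + b * c) * w2"
    unfolding z1_def z2_def by (simp_all add: algebra_simps)
  hence Nz: "e * z1 + b * z2 = 0" "c * z1 - e * z2 = 0" unfolding ee by simp_all
  have Mz: "a * z1 + b * z2 = k * z1" "c * z1 + d * z2 = k * z2"
    using Nz unfolding a d by (simp_all add: algebra_simps)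
  \<comment> \<open>the double eigenvalue \<open>k\<close> is the only candidate for the eigenvalue of the image of \<open>z\<close>\<close>
  have "(k ^ n / t - a) * (k ^ n / t - d) = b * c"
    by (rule commuting_eigenvalue[OF M t nz]) (use ee in \<open>simp add: a d algebra_simps add_eq_0_iff\<close>)
  moreover have "(x - k)\<^sup>2 = (x - a) * (x - d) + e * e" for x
    unfolding a d by (simp add: algebra_simps power2_eq_square)
  ultimately have "(k ^ n / t - k)\<^sup>2 = e * e + b * c" by simp
  hence "k ^ n / t = k" using ee by simp
  hence tk: "k ^ n = t * k" using t by (simp add: field_simps)
  define P where "P = (\<lambda>u. hval n A (w1 + u * z1) (w2 + u * z2))"
  define Q where "Q = (\<lambda>u. hval n B (w1 + u * z1) (w2 + u * z2))"
  have step: "P (u + 1 / k) = P u + 1 / k * (e * P u + b * Q u)"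
    "Q (u + 1 / k) = Q u + 1 / k * (c * P u - e * Q u)" for u
  proof -
    have "a * (w1 + u * z1) + b * (w2 + u * z2) = k * (w1 + (u + 1 / k) * z1)"
      "c * (w1 + u * z1) + d * (w2 + u * z2) = k * (w2 + (u + 1 / k) * z2)"
    proof -
      have "a * (w1 + u * z1) + b * (w2 + u * z2) = (a * w1 + b * w2) + u * (a * z1 + b * z2)"
        by (simp add: algebra_simps)
      also have "\<dots> = k * (w1 + (u + 1 / k) * z1)"
        unfolding Mz using k(1) by (simp add: a z1_def field_simps)
      finally show "a * (w1 + u * z1) + b * (w2 + u * z2) = k * (w1 + (u + 1 / k) * z1)" .
      have "c * (w1 + u * z1) + d * (w2 + u * z2) = (c * w1 + d * w2) + u * (c * z1 + d * z2)"
        by (simp add: algebra_simps)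
      also have "\<dots> = k * (w2 + (u + 1 / k) * z2)"
        unfolding Mz using k(1) by (simp add: d z2_def field_simps)
      finally show "c * (w1 + u * z1) + d * (w2 + u * z2) = k * (w2 + (u + 1 / k) * z2)" .
    qed
    hence "k ^ n * P (u + 1 / k) = t * (a * P u + b * Q u)" "k ^ n * Q (u + 1 / k) = t * (c * P u + d * Q u)"
      using commutingD[OF M, of "w1 + u * z1" "w2 + u * z2"] unfolding P_def Q_def
      by (simp_all add: hval_scale)
    thus "P (u + 1 / k) = P u + 1 / k * (e * P u + b * Q u)" "Q (u + 1 / k) = Q u + 1 / k * (c * P u - e * Q u)"
    proof -
      have "t * (k * P (u + 1 / k)) = t * (a * P u + b * Q u)" "t * (k * Q (u + 1 / k)) = t * (c * P u + d * Q u)"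
        using \<open>k ^ n * P (u + 1 / k) = _\<close> \<open>k ^ n * Q (u + 1 / k) = _\<close> unfolding tk by (simp_all add: mult.assoc)
      hence "k * P (u + 1 / k) = a * P u + b * Q u" "k * Q (u + 1 / k) = c * P u + d * Q u"
        by (metis mult_left_cancel[OF t])+
      hence "P (u + 1 / k) = (a * P u + b * Q u) / k" "Q (u + 1 / k) = (c * P u + d * Q u) / k"
        using k(1) by (simp_all add: nonzero_eq_divide_eq mult.commute)
      thus "P (u + 1 / k) = P u + 1 / k * (e * P u + b * Q u)" "Q (u + 1 / k) = Q u + 1 / k * (c * P u - e * Q u)"
        unfolding a d using k(1) by (simp_all add: add_divide_distrib diff_divide_distrib distrib_right left_diff_distrib)
    qed
  qed
  define p where "p = e * P 0 + b * Q 0"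
  define q where "q = c * P 0 - e * Q 0"
  have N2: "e * p + b * q = 0" "c * p - e * q = 0"
  proof -
    have "e * p + b * q = (e * e + b * c) * P 0" "c * p - e * q = (e * e + b * c) * Q 0"
      unfolding p_def q_def by (simp_all add: algebra_simps)
    thus "e * p + b * q = 0" "c * p - e * q = 0" unfolding ee by simp_all
  qed
  have affine: "P (of_nat m / k) = P 0 + of_nat m / k * p \<and> Q (of_nat m / k) = Q 0 + of_nat m / k * q" for m
  proof (induction m)
    case (Suc m)
    define x where "x = of_nat m / k"
    have x: "of_nat (Suc m) / k = x + 1 / k" unfolding x_def by (simp add: add_divide_distrib)
    have IH: "P x = P 0 + x * p" "Q x = Q 0 + x * q" using Suc.IH unfolding x_def by auto
    have "e * P x + b * Q x = p + x * (e * p + b * q)" "c * P x - e * Q x = q + x * (c * p - e * q)"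
      unfolding IH by (simp_all add: p_def q_def algebra_simps)
    hence "e * P x + b * Q x = p" "c * P x - e * Q x = q" unfolding N2 by simp_all
    thus ?case unfolding x using step[of x] IH by (simp add: distrib_right)
  qed simp
  have vanish: "hval n C z1 z2 = 0"
    if C: "\<And>m. hval n C (w1 + of_nat m / k * z1) (w2 + of_nat m / k * z2) = r + of_nat m / k * s" for C r s
  proof -
    define f where "f = line_poly n C z1 w1 z2 w2"
    define g where "g = Polynomial.monom r n + Polynomial.monom s (n - 1)"
    have "poly f (k / of_nat (Suc m)) = poly g (k / of_nat (Suc m))" for m
    proof -
      define u where "u = k / of_nat (Suc m)"
      have u: "u \<noteq> 0" "of_nat (Suc m) / k = 1 / u" using k(1) unfolding u_def by (simp_all del: of_nat_Suc)
      have "poly f u = hval n C (u * (w1 + 1 / u * z1)) (u * (w2 + 1 / u * z2))"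
        unfolding f_def poly_line_poly using u(1) by (simp add: algebra_simps)
      also have "\<dots> = u ^ n * (r + 1 / u * s)"
        unfolding hval_scale using C[of "Suc m"] unfolding u(2) by simp
      also have "\<dots> = poly g u"
        using u(1) n unfolding g_def
        by (cases n) (simp_all add: Polynomial.poly_monom field_simps)
      finally show ?thesis unfolding u_def .
    qed
    hence "range (\<lambda>m. k / of_nat (Suc m)) \<subseteq> {u. poly f u = poly g u}" by blast
    moreover have "infinite (range (\<lambda>m. k / of_nat (Suc m)))"
    proof (rule range_inj_infinite, rule injI)
      fix i j assume "k / of_nat (Suc i) = k / of_nat (Suc j)"
      hence "of_nat (Suc i) = (of_nat (Suc j) :: 'a)" using k(1) by (simp add: field_simps del: of_nat_Suc)
      thus "i = j" by (simp only: of_nat_eq_iff nat.inject)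
    qed
    ultimately have "f = g" using poly_eq_if_infinite infinite_super by blast
    hence "poly f 0 = poly g 0" by simp
    thus ?thesis unfolding f_def g_def poly_line_poly using n
      by (simp add: Polynomial.poly_monom power_0_left)
  qed
  have "hval n A z1 z2 = 0" "hval n B z1 z2 = 0"
    using affine unfolding P_def Q_def by (auto intro!: vanish)
  thus False using nz z0 unfolding no_common_zero_def by blast
qed

text \<open>
  The two fixed points of a semisimple \<open>M\<close> are permuted or collapsed by the map, and comparing
  eigenvalues shows that the ratio of the eigenvalues of \<open>M\<close> is a root of unity.
\<close>

lemma commuting_finite_order:
  fixes t :: "'a::{field_char_0, alg_closed_field}"
  assumes M: "commuting n A B (a, b, c, d) t" and t: "t \<noteq> 0" and nz: "no_common_zero n A B"
    and n: "n \<ge> 2" and det: "a * d - b * c \<noteq> 0" and nonscalar: "\<not> (b = 0 \<and> c = 0 \<and> a = d)"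
  obtains r m where "r \<noteq> 1" "r + inverse r = (a + d)\<^sup>2 / (a * d - b * c) - 2" "r ^ m = 1"
    "m > 0" "m dvd n * (n\<^sup>2 - 1)"
proof -
  obtain k where k: "poly [:a * d - b * c, - (a + d), 1:] k = 0"
    using alg_closed_imp_poly_has_root[of "[:a * d - b * c, - (a + d), 1:]"] by auto
  define l where "l = a + d - k"
  have sum: "k + l = a + d" unfolding l_def by simp
  have prod: "k * l = a * d - b * c" using k unfolding l_def by (simp add: algebra_simps add_eq_0_iff)
  have kl0: "k \<noteq> 0" "l \<noteq> 0" using det unfolding prod[symmetric] by auto
  have roots: "(x - a) * (x - d) = b * c \<longleftrightarrow> x = k \<or> x = l" for x
  proof -
    have "(x - a) * (x - d) - b * c = x * x - (a + d) * x + (a * d - b * c)" by (simp add: algebra_simps)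
    also have "\<dots> = (x - k) * (x - l)" unfolding prod[symmetric] sum[symmetric] by (simp add: algebra_simps)
    finally have "(x - a) * (x - d) = b * c \<longleftrightarrow> (x - k) * (x - l) = 0"
      by (metis right_minus_eq)
    thus ?thesis by simp
  qed
  have "k \<noteq> l"
  proof
    assume "k = l"
    hence "a + d = 2 * k" "a * d - b * c = k\<^sup>2" using sum prod by (simp_all add: power2_eq_square)
    thus False using commuting_not_unipotent[OF M t nz n kl0(1)] nonscalar by blast
  qed
  define r where "r = k / l"
  have r0: "r \<noteq> 0" using kl0 unfolding r_def by simp
  have "r \<noteq> 1" using \<open>k \<noteq> l\<close> kl0 unfolding r_def by simp
  moreover have "r + inverse r = (a + d)\<^sup>2 / (a * d - b * c) - 2"
    unfolding r_def prod[symmetric] sum[symmetric] using kl0 by (simp add: field_simps power2_eq_square)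
  moreover have "\<exists>m\<in>{n - 1, n, n + 1}. r ^ m = 1"
  proof -
    have "k ^ n / t = k \<or> k ^ n / t = l" "l ^ n / t = k \<or> l ^ n / t = l"
      using commuting_eigenvalue[OF M t nz, of k] commuting_eigenvalue[OF M t nz, of l] roots by auto
    hence kn: "k ^ n = t * k \<or> k ^ n = t * l" and ln: "l ^ n = t * k \<or> l ^ n = t * l"
      using t by (auto simp: field_simps)
    have rn: "r ^ n = k ^ n / l ^ n" unfolding r_def by (simp add: power_divide)
    have "r ^ n = 1 \<or> r ^ n = r \<or> r ^ n = inverse r"
      using kn ln kl0 t unfolding rn unfolding r_def by (auto simp: field_simps)
    moreover have "r ^ n = r * r ^ (n - 1)" using n by (simp add: power_eq_if)
    ultimately show ?thesis using r0 by auto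
  qed
  moreover have "n * (n\<^sup>2 - 1) = n * ((n - 1) * (n + 1))"
    using n by (simp add: power2_eq_square algebra_simps)
  hence "(n - 1) dvd n * (n\<^sup>2 - 1)" "n dvd n * (n\<^sup>2 - 1)" "(n + 1) dvd n * (n\<^sup>2 - 1)"
    by (metis dvd_mult dvd_triv_left dvd_triv_right)+
  hence "m dvd n * (n\<^sup>2 - 1)" "m > 0" if "m \<in> {n - 1, n, n + 1}" for m
    using that n by auto
  ultimately show ?thesis using that by blast
qed

section \<open>Evaluation\<close>

lemma finsum_type_ring:
  "finite I \<Longrightarrow> finsum (ring_of_type_algebra :: 'a::field ring) f I = sum f I"
proof (induction I rule: finite_induct)
  interpret cring "ring_of_type_algebra :: 'a ring" by (rule type_ring_cring)
  {
    case empty show ?case by simp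
  next
    case (insert i I) thus ?case by (subst finsum_insert) auto
  }
qed

lemma nat_pow_type_ring: "x [^]\<^bsub>ring_of_type_algebra\<^esub> (n::nat) = (x :: 'a::field) ^ n"
proof (induction n)
  interpret cring "ring_of_type_algebra :: 'a ring" by (rule type_ring_cring)
  {
    case 0 show ?case by simp
  next
    case (Suc n) thus ?case by (simp add: mult.commute)
  }
qed

context coeff_hom
begin

lemma eval_ring_hom_cring: "s \<in> carrier S \<Longrightarrow> ring_hom_cring (UP R) S (eval R S h s)"
proof -
  assume s: "s \<in> carrier S"
  interpret U: UP_pre_univ_prop R S h "UP R" by unfold_locales
  show ?thesis using U.eval_ring_hom[OF s] by (intro ring_hom_cringI PR.UP_cring S.is_cring)
qed

lemma eval_upto:
  assumes F: "F \<in> carrier (UP R)" and deg: "deg R F \<le> n" and s: "s \<in> carrier S"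
  shows "eval R S h s F = (\<Oplus>\<^bsub>S\<^esub>i\<in>{..n}. h (F i) \<otimes>\<^bsub>S\<^esub> s [^]\<^bsub>S\<^esub> i)"
proof -
  interpret U: UP_pre_univ_prop R S h "UP R" by unfold_locales
  have c: "up_ring.coeff (UP R) F i = F i" "F i \<in> carrier R" for i
    using UP_apply(1,6)[OF R.is_cring F] by auto
  have "F i = \<zero>\<^bsub>R\<^esub>" if "deg R F < i" for i
    using PR.deg_aboveD[OF that F] c by simp
  hence zero: "h (F i) \<otimes>\<^bsub>S\<^esub> s [^]\<^bsub>S\<^esub> i = \<zero>\<^bsub>S\<^esub>" if "i \<in> {..n} - {..deg R F}" for i
    using that s by simp
  have "eval R S h s F = (\<Oplus>\<^bsub>S\<^esub>i\<in>{..deg R F}. h (F i) \<otimes>\<^bsub>S\<^esub> s [^]\<^bsub>S\<^esub> i)"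
    unfolding PR.eval_on_carrier[OF F] c(1) ..
  also have "\<dots> = (\<Oplus>\<^bsub>S\<^esub>i\<in>{..n}. h (F i) \<otimes>\<^bsub>S\<^esub> s [^]\<^bsub>S\<^esub> i)"
    using deg s c(2) zero by (intro S.add.finprod_mono_neutral_cong_left) auto
  finally show ?thesis .
qed

lemma eval_lin_poly:
  assumes "a \<in> carrier R" "b \<in> carrier R" and s: "s \<in> carrier S"
  shows "eval R S h s (lin_poly R a b) = h a \<otimes>\<^bsub>S\<^esub> s \<oplus>\<^bsub>S\<^esub> h b"
proof -
  interpret U: UP_pre_univ_prop R S h "UP R" by unfold_locales
  interpret E: ring_hom_cring "UP R" S "eval R S h s" by (rule eval_ring_hom_cring[OF s])
  have "eval R S h s (lin_poly R a b) =
      eval R S h s (up_ring.monom (UP R) a 1) \<oplus>\<^bsub>S\<^esub> eval R S h s (up_ring.monom (UP R) b 0)"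
    unfolding lin_poly_def using assms by (intro E.hom_add) auto
  thus ?thesis using U.eval_monom[OF assms(1) s, of 1] U.eval_const[OF s assms(2)] s by simp
qed

lemma eval_smult:
  assumes "a \<in> carrier R" "F \<in> carrier (UP R)" and s: "s \<in> carrier S"
  shows "eval R S h s (a \<odot>\<^bsub>UP R\<^esub> F) = h a \<otimes>\<^bsub>S\<^esub> eval R S h s F"
proof -
  interpret U: UP_pre_univ_prop R S h "UP R" by unfold_locales
  interpret E: ring_hom_cring "UP R" S "eval R S h s" by (rule eval_ring_hom_cring[OF s])
  have "a \<odot>\<^bsub>UP R\<^esub> F = up_ring.monom (UP R) a 0 \<otimes>\<^bsub>UP R\<^esub> F"
    using assms by (simp add: PR.monom_mult_is_smult)
  thus ?thesis using assms U.eval_const[OF s assms(1)] by simp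
qed

lemma eval_hom_subst:
  assumes "A \<in> carrier (UP R)" "B \<in> carrier (UP R)" "C \<in> carrier (UP R)" and s: "s \<in> carrier S"
  shows "eval R S h s (hom_subst R n A B C) =
    (\<Oplus>\<^bsub>S\<^esub>i\<in>{..n}. h (A i) \<otimes>\<^bsub>S\<^esub> (eval R S h s B [^]\<^bsub>S\<^esub> i \<otimes>\<^bsub>S\<^esub> eval R S h s C [^]\<^bsub>S\<^esub> (n - i)))"
proof -
  interpret E: ring_hom_cring "UP R" S "eval R S h s" by (rule eval_ring_hom_cring[OF s])
  have A: "up_ring.coeff (UP R) A i = A i" "A i \<in> carrier R" for i
    using assms(1) UP_apply(1,6)[OF R.is_cring] by auto
  have closed: "B [^]\<^bsub>UP R\<^esub> i \<otimes>\<^bsub>UP R\<^esub> C [^]\<^bsub>UP R\<^esub> j \<in> carrier (UP R)" for i j :: nat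
    using assms by simp
  show ?thesis
    unfolding hom_subst_def A(1)
    by (subst E.hom_finsum) (use A(2) closed assms in \<open>auto simp: comp_def eval_smult\<close>)
qed

end

lemma lowest_terms_eval:
  assumes "coeff_hom R S h" "field R" and low: "lowest_terms R A B"
    and s: "s \<in> carrier S" and S: "\<one>\<^bsub>S\<^esub> \<noteq> \<zero>\<^bsub>S\<^esub>"
  shows "eval R S h s A \<noteq> \<zero>\<^bsub>S\<^esub> \<or> eval R S h s B \<noteq> \<zero>\<^bsub>S\<^esub>"
proof (rule ccontr)
  assume zero: "\<not> ?thesis"
  interpret coeff_hom R S h by fact
  interpret K: UP_field R "UP R" by (intro UP_field.intro assms(2))
  interpret E: ring_hom_cring "UP R" S "eval R S h s" by (rule eval_ring_hom_cring[OF s])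
  obtain U V where UV: "U \<in> carrier (UP R)" "V \<in> carrier (UP R)"
    "U \<otimes>\<^bsub>UP R\<^esub> A \<oplus>\<^bsub>UP R\<^esub> V \<otimes>\<^bsub>UP R\<^esub> B = \<one>\<^bsub>UP R\<^esub>"
    using K.lowest_terms_bezout[OF low] .
  note AB = K.lowest_terms_closed[OF low]
  have "eval R S h s (U \<otimes>\<^bsub>UP R\<^esub> A \<oplus>\<^bsub>UP R\<^esub> V \<otimes>\<^bsub>UP R\<^esub> B) =
      eval R S h s U \<otimes>\<^bsub>S\<^esub> eval R S h s A \<oplus>\<^bsub>S\<^esub> eval R S h s V \<otimes>\<^bsub>S\<^esub> eval R S h s B"
    using UV(1,2) AB by simp
  also have "\<dots> = \<zero>\<^bsub>S\<^esub>" using zero UV by simp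
  finally show False using S UV(3) by simp
qed

lemma lowest_terms_top_coeff:
  assumes "field R" and low: "lowest_terms R A B"
  defines "n \<equiv> max (deg R A) (deg R B)"
  shows "A n \<noteq> \<zero>\<^bsub>R\<^esub> \<or> B n \<noteq> \<zero>\<^bsub>R\<^esub>"
proof -
  interpret K: UP_field R "UP R" by (intro UP_field.intro assms(1))
  note AB = K.lowest_terms_closed[OF low]
  have top: "C (deg R C) \<noteq> \<zero>\<^bsub>R\<^esub>" if "C \<in> carrier (UP R)" "C \<noteq> \<zero>\<^bsub>UP R\<^esub>" for C
    using K.lcoeff_nonzero[OF that(2,1)] UP_apply(1)[OF K.R.is_cring that(1)] by simp
  have deg0: "C = \<zero>\<^bsub>UP R\<^esub> \<Longrightarrow> deg R C = 0" for C by simp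
  have cases: "(n = deg R A \<and> A \<noteq> \<zero>\<^bsub>UP R\<^esub>) \<or> (n = deg R B \<and> B \<noteq> \<zero>\<^bsub>UP R\<^esub>)"
    using K.lowest_terms_nonzero[OF low] deg0[of A] deg0[of B] unfolding n_def
    by (metis max.commute max_0L max_def)
  show ?thesis using cases top AB by metis
qed

section \<open>Evaluation in number fields and their algebraic closures\<close>

lemma coeff_hom_to_ac:
  "coeff_hom (ring_of_type_algebra :: 'k::field ring) (ring_of_type_algebra :: 'k alg_closure ring) to_ac"
  by (intro coeff_hom.intro coeff_hom_axioms.intro type_ring_cring) (auto simp: ring_hom_def)

lemma eval_eq_hval:
  fixes F :: "nat \<Rightarrow> 'k::field"
  assumes "F \<in> carrier (UP ring_of_type_algebra)" "deg ring_of_type_algebra F \<le> n"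
  shows "eval ring_of_type_algebra ring_of_type_algebra to_ac z F = hval n (to_ac \<circ> F) z 1"
proof -
  interpret coeff_hom "ring_of_type_algebra :: 'k ring" "ring_of_type_algebra :: 'k alg_closure ring" to_ac
    by (rule coeff_hom_to_ac)
  show ?thesis unfolding hval_def using eval_upto[OF assms, of z]
    by (simp add: finsum_type_ring nat_pow_type_ring)
qed

lemma hval_eq_scaled: "y \<noteq> 0 \<Longrightarrow> hval n A x y = y ^ n * hval n A (x / y) (1 :: 'a::field)"
  using hval_scale[of n A y "x / y" 1] by simp

lemma lowest_terms_no_common_zero:
  fixes A B :: "nat \<Rightarrow> 'k::field"
  assumes low: "lowest_terms ring_of_type_algebra A B"
  defines "n \<equiv> max (deg ring_of_type_algebra A) (deg ring_of_type_algebra B)"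
  shows "no_common_zero n (to_ac \<circ> A) (to_ac \<circ> B)"
  unfolding no_common_zero_def
proof (intro allI impI)
  interpret K: UP_field "ring_of_type_algebra :: 'k ring" "UP ring_of_type_algebra"
    by (intro UP_field.intro type_ring_field)
  note AB = K.lowest_terms_closed[OF low]
  fix x y :: "'k alg_closure" assume xy: "x \<noteq> 0 \<or> y \<noteq> 0"
  show "hval n (to_ac \<circ> A) x y \<noteq> 0 \<or> hval n (to_ac \<circ> B) x y \<noteq> 0"
  proof (cases "y = 0")
    case True
    have "A n \<noteq> 0 \<or> B n \<noteq> 0"
      using lowest_terms_top_coeff[OF type_ring_field low] unfolding n_def by simp
    thus ?thesis using True xy by (simp add: hval_at_infinity)
  next
    case False
    have "hval n (to_ac \<circ> A) (x / y) 1 \<noteq> 0 \<or> hval n (to_ac \<circ> B) (x / y) 1 \<noteq> 0"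
      using lowest_terms_eval[OF coeff_hom_to_ac type_ring_field low, of "x / y"]
        eval_eq_hval[OF AB(1), of n "x / y"] eval_eq_hval[OF AB(2), of n "x / y"]
      unfolding n_def by simp
    thus ?thesis using False hval_eq_scaled[of y n _ x] by simp
  qed
qed

text \<open>
  For \<open>y \<noteq> 0\<close> this is evaluation of polynomials at \<open>x / y\<close>, multiplied by \<open>y\<^sup>n\<close>.
\<close>

lemma hval_hom_subst:
  fixes A C :: "nat \<Rightarrow> 'k::field_char_0"
  assumes A: "A \<in> carrier (UP ring_of_type_algebra)" and C: "C \<in> carrier (UP ring_of_type_algebra)"
    and deg: "deg ring_of_type_algebra C \<le> n"
    and eq: "hom_subst ring_of_type_algebra n A (lin_poly ring_of_type_algebra p q)
      (lin_poly ring_of_type_algebra p' q') = C"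
  shows "hval n (to_ac \<circ> C) x y =
    hval n (to_ac \<circ> A) (to_ac p * x + to_ac q * y) (to_ac p' * x + to_ac q' * y)"
proof -
  interpret coeff_hom "ring_of_type_algebra :: 'k ring" "ring_of_type_algebra :: 'k alg_closure ring" to_ac
    by (rule coeff_hom_to_ac)
  have lin: "lin_poly (ring_of_type_algebra :: 'k ring) p q \<in> carrier (UP ring_of_type_algebra)" for p q
    by (rule lin_poly_closed[OF type_ring_cring]) auto
  have affine: "hval n (to_ac \<circ> C) z 1 = hval n (to_ac \<circ> A) (to_ac p * z + to_ac q) (to_ac p' * z + to_ac q')" for z
    using eval_hom_subst[OF A lin lin, of z n p q p' q'] eval_lin_poly[of p q z] eval_lin_poly[of p' q' z]
      eval_eq_hval[OF C deg, of z] unfolding eq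
    by (simp add: finsum_type_ring nat_pow_type_ring hval_def mult.assoc)
  have nonzero: "hval n (to_ac \<circ> C) x y =
      hval n (to_ac \<circ> A) (to_ac p * x + to_ac q * y) (to_ac p' * x + to_ac q' * y)" if "y \<noteq> 0" for y
  proof -
    have "y * (x / y) = x" using that by simp
    hence "y * (k * (x / y)) = k * x" for k by (metis mult.left_commute)
    hence scaled: "to_ac p * x + to_ac q * y = y * (to_ac p * (x / y) + to_ac q)"
      "to_ac p' * x + to_ac q' * y = y * (to_ac p' * (x / y) + to_ac q')"
      by (simp_all only: distrib_left mult.commute[of y "to_ac q"] mult.commute[of y "to_ac q'"])
    show ?thesis unfolding scaled hval_scale hval_eq_scaled[OF that, of n _ x] affine ..
  qed
  \<comment> \<open>both sides are polynomials in \<open>y\<close>, so the identity extends to \<open>y = 0\<close>\<close>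
  define f where "f = line_poly n (to_ac \<circ> C) x 0 0 1"
  define g where "g = line_poly n (to_ac \<circ> A) (to_ac p * x) (to_ac q) (to_ac p' * x) (to_ac q')"
  have "- {0} \<subseteq> {u. poly f u = poly g u}"
    unfolding f_def g_def poly_line_poly using nonzero by (auto simp: mult.commute)
  moreover have "infinite (- {0 :: 'k alg_closure})"
    using infinite_UNIV_char_0 by (simp add: finite_compl)
  ultimately have "f = g" using poly_eq_if_infinite infinite_super by blast
  hence "poly f y = poly g y" by simp
  thus ?thesis unfolding f_def g_def poly_line_poly by (simp add: mult.commute)
qed

text \<open>
  The hypotheses say \<open>M \<Phi>(adj(M) w) = s \<Phi>(w)\<close>; replacing \<open>w\<close> by \<open>M w\<close> gives
  \<open>(det M)\<^sup>n M \<Phi>(w) = s \<Phi>(M w)\<close>.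
\<close>

lemma commuting_if_conjugate_fixed:
  fixes A B :: "nat \<Rightarrow> 'k::field_char_0"
  defines "K \<equiv> ring_of_type_algebra :: 'k ring"
  assumes low: "lowest_terms K A B"
  defines "n \<equiv> max (deg K A) (deg K B)"
  assumes s: "s \<noteq> 0"
    and 1: "hom_subst K n (a \<odot>\<^bsub>UP K\<^esub> A \<oplus>\<^bsub>UP K\<^esub> b \<odot>\<^bsub>UP K\<^esub> B) (lin_poly K d (- b)) (lin_poly K (- c) a) = s \<odot>\<^bsub>UP K\<^esub> A"
    and 2: "hom_subst K n (c \<odot>\<^bsub>UP K\<^esub> A \<oplus>\<^bsub>UP K\<^esub> d \<odot>\<^bsub>UP K\<^esub> B) (lin_poly K d (- b)) (lin_poly K (- c) a) = s \<odot>\<^bsub>UP K\<^esub> B"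
  shows "commuting n (to_ac \<circ> A) (to_ac \<circ> B) (to_ac a, to_ac b, to_ac c, to_ac d) (to_ac ((a * d - b * c) ^ n / s))"
proof -
  interpret UP_field K "UP K" unfolding K_def by (intro UP_field.intro type_ring_field)
  note AB = lowest_terms_closed[OF low]
  define e where "e = to_ac (a * d - b * c)"
  have carrier: "z \<in> carrier K" for z unfolding K_def by simp
  have lincomb: "z \<odot>\<^bsub>UP K\<^esub> A \<oplus>\<^bsub>UP K\<^esub> w \<odot>\<^bsub>UP K\<^esub> B \<in> carrier (UP K)" for z w
    using AB carrier by simp
  have apply_lincomb: "to_ac \<circ> (z \<odot>\<^bsub>UP K\<^esub> A \<oplus>\<^bsub>UP K\<^esub> w \<odot>\<^bsub>UP K\<^esub> B) =
      (\<lambda>i. to_ac z * (to_ac \<circ> A) i + to_ac w * (to_ac \<circ> B) i)" for z w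
    by (rule ext, use AB carrier in \<open>simp add: UP_apply(3,4)[OF R.is_cring]\<close>) (simp add: K_def)
  have apply_smult: "to_ac \<circ> (s \<odot>\<^bsub>UP K\<^esub> C) = (\<lambda>i. to_ac s * (to_ac \<circ> C) i + 0 * (to_ac \<circ> C) i)"
    if "C \<in> carrier (UP K)" for C
    by (rule ext, use that carrier in \<open>simp add: UP_apply(4)[OF R.is_cring]\<close>) (simp add: K_def)
  have smult: "s \<odot>\<^bsub>UP K\<^esub> C \<in> carrier (UP K)" "deg K (s \<odot>\<^bsub>UP K\<^esub> C) \<le> deg K C" if "C \<in> carrier (UP K)" for C
    using that carrier deg_smult_decr by auto
  have degs: "deg K (s \<odot>\<^bsub>UP K\<^esub> A) \<le> n" "deg K (s \<odot>\<^bsub>UP K\<^esub> B) \<le> n"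
    using smult(2)[OF AB(1)] smult(2)[OF AB(2)] unfolding n_def by auto
  have eqs: "to_ac s * hval n (to_ac \<circ> A) x y =
      to_ac a * hval n (to_ac \<circ> A) (to_ac d * x + to_ac (- b) * y) (to_ac (- c) * x + to_ac a * y) +
      to_ac b * hval n (to_ac \<circ> B) (to_ac d * x + to_ac (- b) * y) (to_ac (- c) * x + to_ac a * y)"
    "to_ac s * hval n (to_ac \<circ> B) x y =
      to_ac c * hval n (to_ac \<circ> A) (to_ac d * x + to_ac (- b) * y) (to_ac (- c) * x + to_ac a * y) +
      to_ac d * hval n (to_ac \<circ> B) (to_ac d * x + to_ac (- b) * y) (to_ac (- c) * x + to_ac a * y)" for x y
    using hval_hom_subst[OF lincomb[unfolded K_def] smult(1)[OF AB(1), unfolded K_def] degs(1)[unfolded K_def] 1[unfolded K_def], of x y]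
      hval_hom_subst[OF lincomb[unfolded K_def] smult(1)[OF AB(2), unfolded K_def] degs(2)[unfolded K_def] 2[unfolded K_def], of x y]
    unfolding K_def[symmetric] apply_lincomb apply_smult[OF AB(1)] apply_smult[OF AB(2)] hval_lincomb by (simp_all add: comp_def)
  have "hval n (to_ac \<circ> A) (to_ac a * x + to_ac b * y) (to_ac c * x + to_ac d * y) =
      e ^ n / to_ac s * (to_ac a * hval n (to_ac \<circ> A) x y + to_ac b * hval n (to_ac \<circ> B) x y) \<and>
    hval n (to_ac \<circ> B) (to_ac a * x + to_ac b * y) (to_ac c * x + to_ac d * y) =
      e ^ n / to_ac s * (to_ac c * hval n (to_ac \<circ> A) x y + to_ac d * hval n (to_ac \<circ> B) x y)" for x y
  proof -
    have w: "to_ac d * (to_ac a * x + to_ac b * y) + to_ac (- b) * (to_ac c * x + to_ac d * y) = e * x"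
      "to_ac (- c) * (to_ac a * x + to_ac b * y) + to_ac a * (to_ac c * x + to_ac d * y) = e * y"
      unfolding e_def by (simp_all add: algebra_simps)
    show ?thesis
      using eqs[of "to_ac a * x + to_ac b * y" "to_ac c * x + to_ac d * y"] s
      unfolding w hval_scale by (simp add: field_simps)
  qed
  thus ?thesis unfolding commuting_def e_def by simp
qed

section \<open>Automorphisms at a place of good reduction\<close>

context place begin

lemma residue_poly_sum:
  assumes z: "v z \<le> 1" and A: "\<And>i. v (A i) \<le> 1"
  shows "v (\<Sum>i\<le>n. A i * z ^ i) \<le> 1 \<and> residue v (\<Sum>i\<le>n. A i * z ^ i) =
    (\<Oplus>\<^bsub>Fv\<^esub>i\<in>{..n}. residue v (A i) \<otimes>\<^bsub>Fv\<^esub> residue v z [^]\<^bsub>Fv\<^esub> i)"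
proof -
  interpret C: coeff_hom Ov Fv "residue v" by (rule coeff_hom_residue)
  have pow: "v (z ^ i) \<le> 1 \<and> residue v (z ^ i) = residue v z [^]\<^bsub>Fv\<^esub> i" for i
  proof (induction i)
    case 0
    thus ?case using C.H.hom_one by simp
  next
    case (Suc i)
    have "residue v (z ^ i * z) = residue v (z ^ i) \<otimes>\<^bsub>Fv\<^esub> residue v z"
      using C.H.hom_mult[of "z ^ i" z] Suc z by simp
    thus ?case using Suc z by (simp add: mult.commute mult_le_one)
  qed
  have summand: "v (A i * z ^ i) \<le> 1 \<and> residue v (A i * z ^ i) = residue v (A i) \<otimes>\<^bsub>Fv\<^esub> residue v z [^]\<^bsub>Fv\<^esub> i" for i
    using C.H.hom_mult[of "A i" "z ^ i"] pow[of i] A[of i] v_mult_le_1[of "A i" "z ^ i"] by simp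
  have closed: "residue v (A i) \<otimes>\<^bsub>Fv\<^esub> residue v z [^]\<^bsub>Fv\<^esub> i \<in> carrier Fv" for i
    using A z residue_closed by simp
  show ?thesis
  proof (induction n)
    case 0
    thus ?case using summand[of 0] closed[of 0] by simp
  next
    case (Suc n)
    let ?s = "\<Sum>i\<le>n. A i * z ^ i" and ?t = "A (Suc n) * z ^ Suc n"
    have "residue v (?t + ?s) = residue v ?t \<oplus>\<^bsub>Fv\<^esub> residue v ?s"
      using C.H.hom_add[of ?t ?s] Suc summand[of "Suc n"] by simp
    moreover have "v (?t + ?s) \<le> 1" using Suc summand[of "Suc n"] v_add_le by blast
    moreover have "(\<Sum>i\<le>Suc n. A i * z ^ i) = ?t + ?s" by simp
    ultimately show ?case
      using Suc summand[of "Suc n"] closed by (simp only: C.S.finsum_Suc Pi_I)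
  qed
qed

text \<open>
  Good reduction means that on the primitive vectors of the valuation ring the two forms have no
  common zero modulo \<open>v\<close>, so that the map respects the maximum norm.
\<close>

lemma form_norm:
  assumes AB: "A \<in> carrier (UP Ov)" "B \<in> carrier (UP Ov)"
    and low: "lowest_terms Fv (residue v \<circ> A) (residue v \<circ> B)"
    and deg: "max (deg Fv (residue v \<circ> A)) (deg Fv (residue v \<circ> B)) = n"
  shows "max (v (hval n A x y)) (v (hval n B x y)) = max (v x) (v y) ^ n"
proof -
  interpret C: coeff_hom Ov Fv "residue v" by (rule coeff_hom_residue)
  interpret F: UP_field Fv "UP Fv" by (intro UP_field.intro residue_field)
  have le1: "v (A i) \<le> 1" "v (B i) \<le> 1" for i using AB unfolding UP_val_ring_iff by auto
  have upper: "v (hval n D x y) \<le> max (v x) (v y) ^ n" if "\<And>i. v (D i) \<le> 1" for D x y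
    unfolding hval_def
  proof (rule v_sum_le)
    fix i assume i: "i \<in> {..n}"
    have "v (D i * x ^ i * y ^ (n - i)) \<le> 1 * max (v x) (v y) ^ i * max (v x) (v y) ^ (n - i)"
      unfolding v_mult v_power using that
      by (intro mult_mono power_mono mult_nonneg_nonneg zero_le_power) (auto simp: le_max_iff_disj)
    also have "\<dots> = max (v x) (v y) ^ n" using i by (simp flip: power_add)
    finally show "v (D i * x ^ i * y ^ (n - i)) \<le> max (v x) (v y) ^ n" .
  qed (simp add: le_max_iff_disj)
  have affine: "v (hval n A z 1) = 1 \<or> v (hval n B z 1) = 1" if z: "v z \<le> 1" for z
  proof (rule ccontr)
    assume not1: "\<not> ?thesis"
    interpret I: coeff_hom Fv Fv id
      by (intro coeff_hom.intro coeff_hom_axioms.intro residue_cring) (auto simp: ring_hom_def)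
    have eval: "eval Fv Fv id (residue v z) (residue v \<circ> D) = \<zero>\<^bsub>Fv\<^esub>"
      if D: "D \<in> carrier (UP Ov)" "deg Fv (residue v \<circ> D) \<le> n" "v (hval n D z 1) \<noteq> 1" for D
    proof -
      have D1: "v (D i) \<le> 1" for i using D unfolding UP_val_ring_iff by auto
      have "v (hval n D z 1) < 1" using upper[of D z 1] D1 D(3) z by (simp add: max_def less_le split: if_splits)
      hence "residue v (hval n D z 1) = \<zero>\<^bsub>Fv\<^esub>" by (simp add: residue_eq_0_iff)
      moreover have "eval Fv Fv id (residue v z) (residue v \<circ> D) =
          (\<Oplus>\<^bsub>Fv\<^esub>i\<in>{..n}. residue v (D i) \<otimes>\<^bsub>Fv\<^esub> residue v z [^]\<^bsub>Fv\<^esub> i)"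
        using I.eval_upto[OF C.comp_closed[OF D(1)] D(2), of "residue v z"] residue_closed[OF z] by simp
      ultimately show ?thesis using residue_poly_sum[OF z, of D n] D1 unfolding hval_def by simp
    qed
    have "deg Fv (residue v \<circ> A) \<le> n" "deg Fv (residue v \<circ> B) \<le> n" using deg by auto
    hence "eval Fv Fv id (residue v z) (residue v \<circ> A) = \<zero>\<^bsub>Fv\<^esub>"
      "eval Fv Fv id (residue v z) (residue v \<circ> B) = \<zero>\<^bsub>Fv\<^esub>"
      using not1 eval[OF AB(1)] eval[OF AB(2)] by auto
    thus False
      using lowest_terms_eval[OF I.coeff_hom_axioms residue_field low, of "residue v z"] residue_closed[OF z]
        F.R.one_not_zero by auto
  qed
  have infinity: "v (hval n A 1 w) = 1 \<or> v (hval n B 1 w) = 1" if w: "v w < 1" for w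
  proof -
    have top: "v (hval n D 1 w) = 1" if D1: "\<And>i. v (D i) \<le> 1" and "v (D n) = 1" for D
    proof -
      have "hval n D 1 w = (\<Sum>i<n. D i * w ^ (n - i)) + D n"
        unfolding hval_def by (simp add: lessThan_Suc_atMost[symmetric])
      moreover have "v (\<Sum>i<n. D i * w ^ (n - i)) < 1"
      proof (rule v_sum_less)
        fix i assume "i \<in> {..<n}"
        hence "v (w ^ (n - i)) < 1" using w by (simp add: power_less_one_iff)
        thus "v (D i * w ^ (n - i)) < 1" using v_mult_less_1[of "w ^ (n - i)" "D i"] D1 by (simp add: mult.commute)
      qed simp
      ultimately show ?thesis using v_add_eq[of "\<Sum>i<n. D i * w ^ (n - i)" "D n"] that(2) by simp
    qed
    have "residue v (A n) \<noteq> \<zero>\<^bsub>Fv\<^esub> \<or> residue v (B n) \<noteq> \<zero>\<^bsub>Fv\<^esub>"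
      using lowest_terms_top_coeff[OF residue_field low] unfolding deg by simp
    hence "v (A n) = 1 \<or> v (B n) = 1"
      using residue_eq_0_iff[of "A n"] residue_eq_0_iff[of "B n"] le1[of n] by auto
    thus ?thesis using top[of A] top[of B] le1 by blast
  qed
  have "max (v x) (v y) ^ n \<le> v (hval n A x y) \<or> max (v x) (v y) ^ n \<le> v (hval n B x y)"
  proof (cases "v x \<le> v y")
    case True
    show ?thesis
    proof (cases "y = 0")
      case True
      hence "x = 0" using \<open>v x \<le> v y\<close> v_nonneg[of x] v_eq_0[of x] by auto
      moreover have "n = 0 \<Longrightarrow> v (hval n A 0 0) = 1 \<or> v (hval n B 0 0) = 1"
        using infinity[of 0] by (simp add: hval_def)
      ultimately show ?thesis using True by (cases n) auto
    next
      case False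
      have scale: "hval n D x y = y ^ n * hval n D (x / y) 1" for D using hval_eq_scaled[OF False] .
      have "v (x / y) \<le> 1" using True False by (simp add: divide_le_eq less_le)
      thus ?thesis using affine[of "x / y"] True unfolding scale by (auto simp: max_def)
    qed
  next
    case False
    hence x: "x \<noteq> 0" using v_nonneg[of y] by auto
    have scale: "hval n D x y = x ^ n * hval n D 1 (y / x)" for D
      using hval_scale[of n D x 1 "y / x"] x by simp
    have "v (y / x) < 1" using False x by (simp add: divide_less_eq less_le)
    thus ?thesis using infinity[of "y / x"] False unfolding scale by (auto simp: max_def)
  qed
  thus ?thesis using upper[of A x y] upper[of B x y] le1 by (auto simp: max_def)
qed

text \<open>
  Let \<open>M\<close> have an entry of absolute value \<open>1\<close> and none larger, and let \<open>\<delta> = |det M|\<close>.  A vector \<open>e\<close> of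
  the standard basis with \<open>|M e| = 1\<close> gives \<open>1 = |M e|\<^sup>n = |t| |M \<Phi>(e)| \<le> |t|\<close>.  A column \<open>w\<close> of the
  adjugate with \<open>|w| = 1\<close> has \<open>|M w| = \<delta>\<close>, so \<open>\<delta>\<^sup>n = |t| |M \<Phi>(w)| \<ge> |t| \<delta>\<close>.  Together
  \<open>1 \<le> \<delta>\<^sup>n\<^sup>-\<^sup>1\<close>, which forces \<open>\<delta> = 1\<close> because \<open>n \<ge> 2\<close>.
\<close>

lemma commuting_unimodular:
  assumes norm: "\<And>x y. max (v (hval n A x y)) (v (hval n B x y)) = max (v x) (v y) ^ n"
    and M: "commuting n A B (a, b, c, d) t" and n: "n \<ge> 2" and det: "a * d - b * c \<noteq> 0"
    and le1: "v a \<le> 1" "v b \<le> 1" "v c \<le> 1" "v d \<le> 1"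
    and eq1: "v a = 1 \<or> v b = 1 \<or> v c = 1 \<or> v d = 1"
  shows "v (a * d - b * c) = 1" and "v t = 1"
proof -
  define e where "e = v (a * d - b * c)"
  have e_pos: "e > 0" using det v_nonneg[of "a * d - b * c"] unfolding e_def by (simp add: less_le)
  have e_le1: "e \<le> 1" unfolding e_def using le1 by (intro v_diff_le v_mult_le_1)
  define N where "N = (\<lambda>x y. max (v x) (v y))"
  have contract: "N (p * x + q * y) (r * x + s * y) \<le> N x y"
    if "v p \<le> 1" "v q \<le> 1" "v r \<le> 1" "v s \<le> 1" for p q r s x y
  proof -
    have "v (k * z) \<le> N x y" if "v k \<le> 1" "v z \<le> N x y" for k z
      using mult_left_le_one_le[of "v z" "v k"] that by simp
    moreover have "v x \<le> N x y" "v y \<le> N x y" unfolding N_def by auto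
    ultimately have "v (p * x + q * y) \<le> N x y" "v (r * x + s * y) \<le> N x y"
      using that by (auto intro!: v_add_le)
    thus ?thesis unfolding N_def by simp
  qed
  have expand: "e * N x y \<le> N (a * x + b * y) (c * x + d * y)" for x y
  proof -
    have "d * (a * x + b * y) + (- b) * (c * x + d * y) = (a * d - b * c) * x"
      "(- c) * (a * x + b * y) + a * (c * x + d * y) = (a * d - b * c) * y"
      by (simp_all add: algebra_simps)
    hence "N ((a * d - b * c) * x) ((a * d - b * c) * y) \<le> N (a * x + b * y) (c * x + d * y)"
      using contract[of d "- b" "- c" a "a * x + b * y" "c * x + d * y"] le1 by simp
    moreover have "N ((a * d - b * c) * x) ((a * d - b * c) * y) = e * N x y"
      unfolding N_def e_def by (simp add: max_mult_distrib_left)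
    ultimately show ?thesis by simp
  qed
  define u where "u = (\<lambda>x y. hval n A x y)"
  define w where "w = (\<lambda>x y. hval n B x y)"
  have N_uw: "N (u x y) (w x y) = N x y ^ n" for x y unfolding N_def u_def w_def by (rule norm)
  have key: "N (a * x + b * y) (c * x + d * y) ^ n = v t * N (a * u x y + b * w x y) (c * u x y + d * w x y)" for x y
    using N_uw[of "a * x + b * y" "c * x + d * y"] commutingD[OF M, of x y]
    unfolding u_def w_def N_def by (simp add: max_mult_distrib_left)
  have t_ge: "1 \<le> v t"
  proof -
    have col: "1 \<le> v t" if "N (a * x + b * y) (c * x + d * y) = 1" "N x y = 1" for x y
    proof -
      have "N (a * u x y + b * w x y) (c * u x y + d * w x y) \<le> 1"
        using contract[of a b c d "u x y" "w x y"] le1 N_uw[of x y] that(2) by simp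
      hence "v t * N (a * u x y + b * w x y) (c * u x y + d * w x y) \<le> v t"
        by (intro mult_left_le) auto
      thus ?thesis using key[of x y] that(1) by simp
    qed
    have "v a = 1 \<or> v c = 1 \<Longrightarrow> ?thesis" using col[of 1 0] le1 unfolding N_def by (auto simp: max_def)
    moreover have "v b = 1 \<or> v d = 1 \<Longrightarrow> ?thesis" using col[of 0 1] le1 unfolding N_def by (auto simp: max_def)
    ultimately show ?thesis using eq1 by blast
  qed
  have t_le: "v t \<le> e ^ (n - 1)"
  proof -
    have col: "v t \<le> e ^ (n - 1)" if "N (a * x + b * y) (c * x + d * y) = e" "N x y = 1" for x y
    proof -
      have "v t * e \<le> v t * N (a * u x y + b * w x y) (c * u x y + d * w x y)"
        using expand[of "u x y" "w x y"] N_uw[of x y] that(2) by (intro mult_left_mono) auto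
      also have "\<dots> = e ^ n" using key[of x y] that(1) by simp
      also have "\<dots> = e ^ (n - 1) * e" using n by (simp add: power_eq_if)
      finally show ?thesis using e_pos by simp
    qed
    have "N (a * d + b * (- c)) (c * d + d * (- c)) = e" "N (a * (- b) + b * a) (c * (- b) + d * a) = e"
      unfolding N_def e_def by (simp_all add: mult.commute max_absorb1 max_absorb2)
    moreover have "v d = 1 \<or> v c = 1 \<Longrightarrow> N d (- c) = 1" "v b = 1 \<or> v a = 1 \<Longrightarrow> N (- b) a = 1"
      using le1 unfolding N_def by (auto simp: max_def)
    ultimately have "v d = 1 \<or> v c = 1 \<Longrightarrow> ?thesis" "v b = 1 \<or> v a = 1 \<Longrightarrow> ?thesis"
      using col by blast+
    thus ?thesis using eq1 by blast
  qed
  have "e ^ (n - 1) \<ge> 1" using t_ge t_le by simp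
  hence e1: "e = 1" using e_pos e_le1 n power_less_one_iff[of e "n - 1"] by force
  show "v (a * d - b * c) = 1" using e1 unfolding e_def .
  show "v t = 1" using t_ge t_le unfolding e1 by simp
qed

lemma commuting_of_ac:
  assumes "commuting n (to_ac \<circ> A) (to_ac \<circ> B) (to_ac a, to_ac b, to_ac c, to_ac d) (to_ac t)"
  shows "commuting n A B (a, b, c, d) t"
proof -
  have "to_ac (hval n A (a * x + b * y) (c * x + d * y)) = to_ac (t * (a * hval n A x y + b * hval n B x y)) \<and>
      to_ac (hval n B (a * x + b * y) (c * x + d * y)) = to_ac (t * (c * hval n A x y + d * hval n B x y))" for x y
    using commutingD[OF assms, of "to_ac x" "to_ac y"] by (simp add: to_ac_hval)
  thus ?thesis unfolding commuting_def by (simp only: to_ac_eq_iff prod.case) simp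
qed

text \<open>
  If two matrices commuting with the map agree modulo \<open>v\<close> up to a scalar, then their quotient \<open>D\<close> is
  scalar modulo \<open>v\<close>.  Unless it is scalar, the ratio \<open>r\<close> of its eigenvalues is a nontrivial root of
  unity, and \<open>r + 1 / r = (tr D)\<^sup>2 / det D - 2\<close> is congruent to \<open>2\<close> modulo \<open>v\<close>, because
  \<open>(tr D)\<^sup>2 - 4 det D\<close> vanishes modulo \<open>v\<close>.  Such a root of unity exists only at exceptional places.
\<close>

lemma commuting_congruent:
  assumes nf: "number_field TYPE('k)" and n: "n \<ge> 2"
    and nz: "no_common_zero n (to_ac \<circ> A) (to_ac \<circ> B)"
    and M: "commuting n (to_ac \<circ> A) (to_ac \<circ> B) (to_ac a, to_ac b, to_ac c, to_ac d) (to_ac t)" "t \<noteq> 0"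
    and M': "commuting n (to_ac \<circ> A) (to_ac \<circ> B) (to_ac a', to_ac b', to_ac c', to_ac d') (to_ac t')" "t' \<noteq> 0"
    and le1: "v a \<le> 1" "v b \<le> 1" "v c \<le> 1" "v d \<le> 1" "v a' \<le> 1" "v b' \<le> 1" "v c' \<le> 1" "v d' \<le> 1" "v u \<le> 1"
    and det: "v (a * d - b * c) = 1" "v (a' * d' - b' * c') = 1"
    and cong: "v (a - u * a') < 1" "v (b - u * b') < 1" "v (c - u * c') < 1" "v (d - u * d') < 1"
    and regular: "\<And>p. p \<in> S0 TYPE('k) n \<Longrightarrow> \<not> v (of_nat p) < 1"
  obtains k where "k \<noteq> 0" "a = k * a'" "b = k * b'" "c = k * c'" "d = k * d'"
proof -
  define e where "e = a * d - b * c"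
  define e' where "e' = a' * d' - b' * c'"
  have e: "e \<noteq> 0" "e' \<noteq> 0" using det unfolding e_def e'_def by auto
  define p where "p = a * d' + b * (- c')"
  define q where "q = a * (- b') + b * a'"
  define r where "r = c * d' + d * (- c')"
  define s where "s = c * (- b') + d * a'"
  have det_D: "p * s - q * r = e * e'"
    unfolding p_def q_def r_def s_def e_def e'_def by (simp add: algebra_simps)
  have adj: "commuting n (to_ac \<circ> A) (to_ac \<circ> B) (to_ac d', - to_ac b', - to_ac c', to_ac a')
      ((to_ac a' * to_ac d' - to_ac b' * to_ac c') ^ n / (to_ac t' * (to_ac a' * to_ac d' - to_ac b' * to_ac c')))"
    using M' e(2) by (intro commuting_adj) (auto simp: e'_def simp flip: to_ac_mult to_ac_diff)
  obtain T where T: "T \<noteq> 0"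
    and D: "commuting n (to_ac \<circ> A) (to_ac \<circ> B) (to_ac p, to_ac q, to_ac r, to_ac s) (to_ac T)"
    using commuting_mult[OF M(1) adj] that[of "t * (e' ^ n / (t' * e'))"] M(2) M'(2) e(2)
    unfolding p_def q_def r_def s_def e'_def by simp
  have "q = 0 \<and> r = 0 \<and> p = s"
  proof (rule ccontr)
    assume nonscalar: "\<not> ?thesis"
    obtain x m where x: "x \<noteq> 1" "x + inverse x = (to_ac p + to_ac s)\<^sup>2 / (to_ac p * to_ac s - to_ac q * to_ac r) - 2"
      "x ^ m = 1" "m > 0" "m dvd n * (n\<^sup>2 - 1)"
    proof (rule commuting_finite_order[OF D _ nz n])
      show "to_ac p * to_ac s - to_ac q * to_ac r \<noteq> 0"
        using det_D e by (simp flip: to_ac_mult to_ac_diff)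
    qed (use T nonscalar in auto)
    define z where "z = (p + s)\<^sup>2 / (e * e') - 2"
    have "to_ac p * to_ac s - to_ac q * to_ac r = to_ac (e * e')"
      by (simp only: det_D flip: to_ac_mult to_ac_diff)
    hence z: "to_ac z = x + inverse x" unfolding x(2) z_def by simp
    have small: "v (k * l) < 1" if "v k < 1" "v l \<le> 1" for k l using v_mult_less_1 that by blast
    define a1 b1 c1 d1 where "a1 = a - u * a'" and "b1 = b - u * b'" and "c1 = c - u * c'" and "d1 = d - u * d'"
    have small1: "v a1 < 1" "v b1 < 1" "v c1 < 1" "v d1 < 1"
      using cong unfolding a1_def b1_def c1_def d1_def by auto
    have "p - s = (a1 * d' - b1 * c') + (c1 * b' - d1 * a')" "q = b1 * a' - a1 * b'" "r = c1 * d' - d1 * c'"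
      unfolding p_def q_def r_def s_def a1_def b1_def c1_def d1_def by (simp_all add: algebra_simps)
    hence ps: "v (p - s) < 1" and q: "v q < 1" and r: "v r < 1"
      using small1 le1 by (simp_all only: v_add_less v_diff_less small)
    have ee: "v (e * e') = 1" using det unfolding e_def e'_def by simp
    have "z - 2 = ((p + s)\<^sup>2 - 4 * (e * e')) / (e * e')"
      unfolding z_def using e by (simp add: diff_divide_distrib)
    also have "(p + s)\<^sup>2 - 4 * (e * e') = (p - s) * (p - s) + q * (4 * r)"
      unfolding det_D[symmetric] by (simp add: algebra_simps power2_eq_square)
    finally have "v (z - 2) = v ((p - s) * (p - s) + q * (4 * r))" using ee by simp
    also have "\<dots> < 1"
      using ps q r v_of_nat_le_1[of 4] by (intro v_add_less small v_mult_le_1) auto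
    finally have "v (z - 2) < 1" .
    hence "\<exists>p\<in>S0 TYPE('k) n. v (of_nat p) < 1"
      by (rule exceptional_prime_if_finite_order[OF nf z _ x(1,3,4,5)])
    thus False using regular by blast
  qed
  hence scalar: "q = 0" "r = 0" "s = p" by auto
  \<comment> \<open>now \<open>M\<close> times the determinant of \<open>M'\<close> is \<open>p M'\<close>\<close>
  have "a * e' = p * a' + q * c'" "b * e' = p * b' + q * d'" "c * e' = r * a' + s * c'" "d * e' = r * b' + s * d'"
    unfolding p_def q_def r_def s_def e'_def by (simp_all add: algebra_simps)
  hence "a = p / e' * a'" "b = p / e' * b'" "c = p / e' * c'" "d = p / e' * d'"
    unfolding scalar using e(2) by (simp_all add: field_simps)
  moreover have "p / e' \<noteq> 0" using det_D e unfolding scalar by auto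
  ultimately show ?thesis using that by blast
qed

end

section \<open>Reduction of automorphisms\<close>

context place begin

lemma GL2_val_ring_iff:
  "(a, b, c, d) \<in> carrier (GL2 Ov) \<longleftrightarrow>
    v a \<le> 1 \<and> v b \<le> 1 \<and> v c \<le> 1 \<and> v d \<le> 1 \<and> v (a * d - b * c) = 1"
proof (cases "v b \<le> 1 \<and> v c \<le> 1")
  case True
  hence "a * d \<ominus>\<^bsub>Ov\<^esub> b * c = a * d - b * c" by (simp add: mult_le_one)
  thus ?thesis using True by (simp add: GL2_carrier_iff)
qed (auto simp: GL2_carrier_iff)

lemma GL2_val_ring_subset: "M \<in> carrier (GL2 Ov) \<Longrightarrow> M \<in> carrier (GL2 KK)"
  by (cases M) (auto simp: GL2_val_ring_iff GL2_carrier_iff[where R = KK])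

fun residue_mat :: "'k mat2 \<Rightarrow> 'k set mat2" where
  "residue_mat (a, b, c, d) = (residue v a, residue v b, residue v c, residue v d)"

lemma residue_mat_closed:
  assumes "M \<in> carrier (GL2 Ov)"
  shows "residue_mat M \<in> carrier (GL2 Fv)"
proof -
  interpret C: coeff_hom Ov Fv "residue v" by (rule coeff_hom_residue)
  obtain a b c d where M: "M = (a, b, c, d)" by (cases M)
  have abcd: "v a \<le> 1" "v b \<le> 1" "v c \<le> 1" "v d \<le> 1" and det: "v (a * d - b * c) = 1"
    using assms unfolding M GL2_val_ring_iff by auto
  have "residue v (a \<otimes>\<^bsub>Ov\<^esub> d \<ominus>\<^bsub>Ov\<^esub> b \<otimes>\<^bsub>Ov\<^esub> c) =
      residue v a \<otimes>\<^bsub>Fv\<^esub> residue v d \<ominus>\<^bsub>Fv\<^esub> residue v b \<otimes>\<^bsub>Fv\<^esub> residue v c"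
    using abcd by (subst C.H.hom_minus) (auto simp: mult_le_one simp flip: C.H.hom_mult)
  moreover have "a \<otimes>\<^bsub>Ov\<^esub> d \<ominus>\<^bsub>Ov\<^esub> b \<otimes>\<^bsub>Ov\<^esub> c = a * d - b * c"
    using abcd by (simp add: mult_le_one)
  ultimately show ?thesis
    using abcd residue_closed residue_Units[OF det] unfolding M by (simp add: GL2_carrier_iff)
qed

lemma residue_mat_mult:
  assumes "M \<in> carrier (GL2 Ov)" "N \<in> carrier (GL2 Ov)"
  shows "residue_mat (M \<otimes>\<^bsub>GL2 KK\<^esub> N) = residue_mat M \<otimes>\<^bsub>GL2 Fv\<^esub> residue_mat N"
    and "M \<otimes>\<^bsub>GL2 KK\<^esub> N \<in> carrier (GL2 Ov)"
proof -
  interpret C: coeff_hom Ov Fv "residue v" by (rule coeff_hom_residue)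
  obtain a b c d where M: "M = (a, b, c, d)" by (cases M)
  obtain a' b' c' d' where N: "N = (a', b', c', d')" by (cases N)
  have le1: "v a \<le> 1" "v b \<le> 1" "v c \<le> 1" "v d \<le> 1" "v a' \<le> 1" "v b' \<le> 1" "v c' \<le> 1" "v d' \<le> 1"
    using assms unfolding M N GL2_val_ring_iff by auto
  have hom: "residue v (x * y + z * w) =
      residue v x \<otimes>\<^bsub>Fv\<^esub> residue v y \<oplus>\<^bsub>Fv\<^esub> residue v z \<otimes>\<^bsub>Fv\<^esub> residue v w"
    if "v x \<le> 1" "v y \<le> 1" "v z \<le> 1" "v w \<le> 1" for x y z w
    using C.H.hom_add[of "x * y" "z * w"] C.H.hom_mult[of x y] C.H.hom_mult[of z w] that
    by (simp add: mult_le_one)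
  show "residue_mat (M \<otimes>\<^bsub>GL2 KK\<^esub> N) = residue_mat M \<otimes>\<^bsub>GL2 Fv\<^esub> residue_mat N"
    unfolding M N using le1 by (simp add: GL2_mult_eq hom)
  have "M \<otimes>\<^bsub>GL2 Ov\<^esub> N = M \<otimes>\<^bsub>GL2 KK\<^esub> N" unfolding M N by (simp add: GL2_mult_eq)
  moreover have "M \<otimes>\<^bsub>GL2 Ov\<^esub> N \<in> carrier (GL2 Ov)"
    using assms by (intro monoid.m_closed group.is_monoid GL2_group val_ring_cring)
  ultimately show "M \<otimes>\<^bsub>GL2 KK\<^esub> N \<in> carrier (GL2 Ov)" by simp
qed

text \<open>Any two integral representatives with unit determinant differ by a scalar that is a unit.\<close>

lemma red_proj_class:
  assumes M: "M \<in> carrier (GL2 Ov)"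
  shows "red v (proj_class KK M) = proj_class Fv (residue_mat M)"
proof -
  interpret C: coeff_hom Ov Fv "residue v" by (rule coeff_hom_residue)
  obtain a b c d where M_eq: "M = (a, b, c, d)" by (cases M)
  have le1: "v a \<le> 1" "v b \<le> 1" "v c \<le> 1" "v d \<le> 1" and det: "v (a * d - b * c) = 1"
    using M unfolding M_eq GL2_val_ring_iff by auto
  have same: "proj_class Fv (residue_mat N) = proj_class Fv (residue_mat M)"
    if N: "N \<in> proj_class KK M" "N \<in> carrier (GL2 Ov)" for N
  proof -
    obtain u where u: "N = (u * a, u * b, u * c, u * d)" "u \<noteq> 0"
      using N(1) GL2_val_ring_subset[OF M] unfolding M_eq by (auto simp: proj_class_eq[OF type_ring_cring])
    have "v (u * a * (u * d) - u * b * (u * c)) = 1" using N(2) unfolding u(1) GL2_val_ring_iff by simp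
    moreover have "u * a * (u * d) - u * b * (u * c) = u\<^sup>2 * (a * d - b * c)"
      by (simp add: algebra_simps power2_eq_square)
    ultimately have "v u ^ 2 = 1\<^sup>2" using det by simp
    hence vu: "v u = 1" using power2_eq_imp_eq[of "v u" 1] by simp
    have "residue v (u * x) = residue v u \<otimes>\<^bsub>Fv\<^esub> residue v x" if "v x \<le> 1" for x
      using C.H.hom_mult[of u x] that vu by simp
    hence "residue_mat N \<in> proj_class Fv (residue_mat M)"
      using le1 residue_Units[OF vu] residue_mat_closed[OF M] unfolding u(1) M_eq
      by (auto simp: proj_class_eq[OF residue_cring])
    thus ?thesis by (rule proj_class_eqI[OF residue_cring residue_mat_closed[OF M]])
  qed
  have "red v (proj_class KK M) = (\<Union>N \<in> proj_class KK M \<inter> carrier (GL2 Ov). proj_class Fv (residue_mat N))"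
    unfolding red_def proj_class_def by (rule SUP_cong[OF refl]) (auto split: prod.splits)
  also have "\<dots> = (\<Union>N \<in> proj_class KK M \<inter> carrier (GL2 Ov). proj_class Fv (residue_mat M))"
    by (rule SUP_cong[OF refl]) (use same in auto)
  also have "\<dots> = proj_class Fv (residue_mat M)"
    using M proj_class_self[OF type_ring_cring GL2_val_ring_subset[OF M]] by auto
  finally show ?thesis .
qed

lemma good_reduction_moebius:
  assumes M: "M \<in> carrier (GL2 Ov)"
  shows "good_reduction v (moebius KK (proj_class KK M))"
proof -
  interpret C: coeff_hom Ov Fv "residue v" by (rule coeff_hom_residue)
  interpret K: UP_field KK "UP KK" by (intro UP_field.intro type_ring_field)
  interpret F: UP_field Fv "UP Fv" by (intro UP_field.intro residue_field)
  obtain a b c d where M_eq: "M = (a, b, c, d)" by (cases M)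
  have le1: "v a \<le> 1" "v b \<le> 1" "v c \<le> 1" "v d \<le> 1" and det: "v (a * d - b * c) = 1"
    using M unfolding M_eq GL2_val_ring_iff by auto
  have MK: "(a, b, c, d) \<in> carrier (GL2 KK)" using GL2_val_ring_subset[OF M] unfolding M_eq .
  have MF: "(residue v a, residue v b, residue v c, residue v d) \<in> carrier (GL2 Fv)"
    using residue_mat_closed[OF M] unfolding M_eq by simp
  have coeffs: "lin_poly KK x y i = (if i = 0 then y else if i = 1 then x else 0)" for x y i
    by (simp add: lin_poly_apply[OF type_ring_cring])
  have "\<not> (v a < 1 \<and> v b < 1)"
  proof
    assume "v a < 1 \<and> v b < 1"
    hence "v (a * d - b * c) < 1" using le1 by (intro v_diff_less v_mult_less_1) auto
    thus False using det by simp
  qed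
  hence "v a = 1 \<or> v b = 1" using le1 by auto
  hence "v (lin_poly KK a b 1) = 1 \<or> v (lin_poly KK a b 0) = 1" by (simp add: coeffs)
  hence unit: "\<exists>i. v (lin_poly KK a b i) = 1" by (elim disjE) (rule exI, assumption)+
  have bound: "v (lin_poly KK x y i) \<le> 1" if "v x \<le> 1" "v y \<le> 1" for x y i
    using that by (simp add: coeffs)
  have norm: "normalized (lin_poly KK a b) (lin_poly KK c d)"
    unfolding normalized_def using unit by (intro conjI allI bound le1) (elim exE, intro exI disjI1)
  have res: "residue v \<circ> lin_poly KK x y = lin_poly Fv (residue v x) (residue v y)" if "v x \<le> 1" "v y \<le> 1" for x y
    using C.comp_lin_poly[of x y] lin_poly_val_ring[of x y] that by simp
  have "reduction v (rat_frac KK (lin_poly KK a b) (lin_poly KK c d)) =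
      rat_frac Fv (lin_poly Fv (residue v a) (residue v b)) (lin_poly Fv (residue v c) (residue v d))"
    unfolding reduction_eq[OF K.lowest_terms_lin(1)[OF MK] norm] using le1 by (simp add: res)
  thus ?thesis
    unfolding good_reduction_def M_eq K.moebius_proj_class[OF MK]
    by (simp only: K.rat_degree_lowest[OF K.lowest_terms_lin(1)[OF MK]] K.lowest_terms_lin(2)[OF MK]
        F.rat_degree_lowest[OF F.lowest_terms_lin(1)[OF MF]] F.lowest_terms_lin(2)[OF MF])
qed

lemma proj_class_normalized:
  assumes "f \<in> carrier (PGL2 KK)"
  obtains a b c d where "f = proj_class KK (a, b, c, d)" "(a, b, c, d) \<in> carrier (GL2 KK)"
    "v a \<le> 1" "v b \<le> 1" "v c \<le> 1" "v d \<le> 1" "v a = 1 \<or> v b = 1 \<or> v c = 1 \<or> v d = 1"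
proof -
  obtain a b c d where f: "f = proj_class KK (a, b, c, d)" and M: "(a, b, c, d) \<in> carrier (GL2 KK)"
    using assms unfolding PGL2_carrier by auto
  have det: "a * d - b * c \<noteq> 0" using M by (simp add: GL2_carrier_iff)
  define m where "m = Max (v ` {a, b, c, d})"
  have "m \<in> v ` {a, b, c, d}" unfolding m_def by (intro Max_in) auto
  then obtain x where x: "x \<in> {a, b, c, d}" "v x = m" by auto
  have le: "v y \<le> v x" if "y \<in> {a, b, c, d}" for y
    unfolding x(2) m_def using that by (intro Max_ge) auto
  have x0: "x \<noteq> 0"
  proof
    assume "x = 0"
    hence "v y = 0" if "y \<in> {a, b, c, d}" for y using le[OF that] v_nonneg[of y] by simp
    hence "a = 0" "b = 0" by auto
    thus False using det by simp
  qed
  define u where "u = inverse x"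
  have u: "u \<noteq> 0" "v (u * y) = v y / v x" for y using x0 unfolding u_def by (simp_all add: field_simps)
  have scaled: "(u * a, u * b, u * c, u * d) \<in> proj_class KK (a, b, c, d)"
    using u(1) by (auto simp: proj_class_eq[OF type_ring_cring M])
  have "u * a * (u * d) - u * b * (u * c) = u\<^sup>2 * (a * d - b * c)" by (simp add: algebra_simps power2_eq_square)
  hence GL: "(u * a, u * b, u * c, u * d) \<in> carrier (GL2 KK)" using det u(1) by (simp add: GL2_carrier_iff)
  have vx: "v x > 0" using x0 v_nonneg[of x] by (simp add: less_le)
  have le1: "v (u * y) \<le> 1" if "y \<in> {a, b, c, d}" for y unfolding u(2) using le[OF that] vx by simp
  have "v (u * x) = 1" unfolding u(2) using x0 by simp
  hence "v (u * a) = 1 \<or> v (u * b) = 1 \<or> v (u * c) = 1 \<or> v (u * d) = 1" using x(1) by auto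
  thus ?thesis
    using that[of "u * a" "u * b" "u * c" "u * d"] GL le1 proj_class_eqI[OF type_ring_cring M scaled] f by simp
qed

text \<open>
  Scale a representing matrix so that its largest entry has absolute value \<open>1\<close>.  Then its determinant and
  the constant \<open>t\<close> are units by \<open>commuting_unimodular\<close>, and so is the constant in the polynomial
  identity expressing that \<open>f\<close> fixes \<open>A / B\<close>.  Reducing this identity modulo \<open>v\<close> shows that the reduced
  matrix fixes the reduced map.
\<close>

lemma automorphism_representative:
  assumes low: "lowest_terms KK A B" and norm: "normalized A B"
    and good: "good_reduction v (rat_frac KK A B)"
  defines "n \<equiv> max (deg KK A) (deg KK B)"
  assumes n: "n \<ge> 2" and f: "f \<in> carrier (Aut_rat KK (rat_frac KK A B))"
  obtains a b c d t where "f = proj_class KK (a, b, c, d)" "(a, b, c, d) \<in> carrier (GL2 Ov)"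
    "commuting n (to_ac \<circ> A) (to_ac \<circ> B) (to_ac a, to_ac b, to_ac c, to_ac d) (to_ac t)" "t \<noteq> 0"
    "proj_class Fv (residue_mat (a, b, c, d)) \<in>
      carrier (Aut_rat Fv (rat_frac Fv (residue v \<circ> A) (residue v \<circ> B)))"
proof -
  interpret C: coeff_hom Ov Fv "residue v" by (rule coeff_hom_residue)
  interpret K: UP_field KK "UP KK" by (intro UP_field.intro type_ring_field)
  interpret F: UP_field Fv "UP Fv" by (intro UP_field.intro residue_field)
  note AB = normalized_closed[OF low norm]
  note res = good_reduction_lowest[OF low norm good, folded n_def]
  have f': "f \<in> carrier (PGL2 KK)"
    "rat_comp KK (rat_comp KK (moebius KK f) (rat_frac KK A B)) (moebius KK (inv\<^bsub>PGL2 KK\<^esub> f)) = rat_frac KK A B"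
    using f unfolding Aut_rat_def by auto
  obtain a b c d where f_eq: "f = proj_class KK (a, b, c, d)" and M: "(a, b, c, d) \<in> carrier (GL2 KK)"
    and le1: "v a \<le> 1" "v b \<le> 1" "v c \<le> 1" "v d \<le> 1"
    and eq1: "v a = 1 \<or> v b = 1 \<or> v c = 1 \<or> v d = 1"
    using proj_class_normalized[OF f'(1)] .
  define e where "e = a * d - b * c"
  have e: "e \<noteq> 0" using M unfolding e_def by (simp add: GL2_carrier_iff)
  obtain s where s: "s \<noteq> 0" and
    eqs: "hom_subst KK n (a \<odot>\<^bsub>UP KK\<^esub> A \<oplus>\<^bsub>UP KK\<^esub> b \<odot>\<^bsub>UP KK\<^esub> B) (lin_poly KK d (- b)) (lin_poly KK (- c) a) = s \<odot>\<^bsub>UP KK\<^esub> A"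
      "hom_subst KK n (c \<odot>\<^bsub>UP KK\<^esub> A \<oplus>\<^bsub>UP KK\<^esub> d \<odot>\<^bsub>UP KK\<^esub> B) (lin_poly KK d (- b)) (lin_poly KK (- c) a) = s \<odot>\<^bsub>UP KK\<^esub> B"
    using K.conjugate_fixedD[OF M low f'(2)[unfolded f_eq]] unfolding n_def by auto
  define t where "t = e ^ n / s"
  have t: "t \<noteq> 0" using e s unfolding t_def by simp
  have comm: "commuting n (to_ac \<circ> A) (to_ac \<circ> B) (to_ac a, to_ac b, to_ac c, to_ac d) (to_ac t)"
    using commuting_if_conjugate_fixed[OF low s eqs[unfolded n_def]] unfolding t_def e_def n_def .
  have unimod: "v e = 1" "v t = 1"
    using commuting_unimodular[OF form_norm[OF AB res] commuting_of_ac[OF comm] n _ le1 eq1] e unfolding e_def by auto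
  have vs: "v s = 1"
    using arg_cong[OF t_def, of v] unimod s by (simp add: field_simps)
  have MO: "(a, b, c, d) \<in> carrier (GL2 Ov)" using le1 unimod(1) unfolding GL2_val_ring_iff e_def by simp
  have MF: "(residue v a, residue v b, residue v c, residue v d) \<in> carrier (GL2 Fv)"
    using residue_mat_closed[OF MO] by simp
  have neg: "residue v (- x) = \<ominus>\<^bsub>Fv\<^esub> residue v x" if "v x \<le> 1" for x
    using C.H.hom_a_inv[of x] that by simp
  have "rat_comp Fv (rat_comp Fv (moebius Fv (proj_class Fv (residue_mat (a, b, c, d)))) (rat_frac Fv (residue v \<circ> A) (residue v \<circ> B)))
      (moebius Fv (inv\<^bsub>PGL2 Fv\<^esub> (proj_class Fv (residue_mat (a, b, c, d))))) = rat_frac Fv (residue v \<circ> A) (residue v \<circ> B)"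
    unfolding residue_mat.simps
  proof (rule F.conjugate_fixedI[OF MF res(1)])
    show "residue v s \<in> carrier Fv" "residue v s \<noteq> \<zero>\<^bsub>Fv\<^esub>"
      using residue_closed[of s] residue_eq_0_iff[of s] vs by auto
    show "hom_subst Fv (max (deg Fv (residue v \<circ> A)) (deg Fv (residue v \<circ> B)))
        (residue v a \<odot>\<^bsub>UP Fv\<^esub> (residue v \<circ> A) \<oplus>\<^bsub>UP Fv\<^esub> residue v b \<odot>\<^bsub>UP Fv\<^esub> (residue v \<circ> B))
        (lin_poly Fv (residue v d) (\<ominus>\<^bsub>Fv\<^esub> residue v b)) (lin_poly Fv (\<ominus>\<^bsub>Fv\<^esub> residue v c) (residue v a)) =
        residue v s \<odot>\<^bsub>UP Fv\<^esub> (residue v \<circ> A)"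
      using residue_identity[OF AB AB(1) _ _ _ _ _ _ _ eqs(1)] le1 vs unfolding res(2) by (simp add: neg)
    show "hom_subst Fv (max (deg Fv (residue v \<circ> A)) (deg Fv (residue v \<circ> B)))
        (residue v c \<odot>\<^bsub>UP Fv\<^esub> (residue v \<circ> A) \<oplus>\<^bsub>UP Fv\<^esub> residue v d \<odot>\<^bsub>UP Fv\<^esub> (residue v \<circ> B))
        (lin_poly Fv (residue v d) (\<ominus>\<^bsub>Fv\<^esub> residue v b)) (lin_poly Fv (\<ominus>\<^bsub>Fv\<^esub> residue v c) (residue v a)) =
        residue v s \<odot>\<^bsub>UP Fv\<^esub> (residue v \<circ> B)"
      using residue_identity[OF AB AB(2) _ _ _ _ _ _ _ eqs(2)] le1 vs unfolding res(2) by (simp add: neg)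
  qed
  hence "proj_class Fv (residue_mat (a, b, c, d)) \<in>
      carrier (Aut_rat Fv (rat_frac Fv (residue v \<circ> A) (residue v \<circ> B)))"
    using MF unfolding Aut_rat_def by (auto simp: PGL2_carrier)
  thus ?thesis using that[OF f_eq MO comm t] by blast
qed

lemma red_mon:
  assumes nf: "number_field TYPE('k)" and low: "lowest_terms KK A B" and norm: "normalized A B"
    and good: "good_reduction v (rat_frac KK A B)"
  defines "n \<equiv> max (deg KK A) (deg KK B)" and "\<phi> \<equiv> rat_frac KK A B"
  assumes n: "n \<ge> 2" and regular: "\<And>p. p \<in> S0 TYPE('k) n \<Longrightarrow> \<not> v (of_nat p) < 1"
  shows "\<forall>f \<in> carrier (Aut_rat KK \<phi>). good_reduction v (moebius KK f)"
    and "red v \<in> mon (Aut_rat KK \<phi>) (Aut_rat Fv (reduction v \<phi>))"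
proof -
  interpret C: coeff_hom Ov Fv "residue v" by (rule coeff_hom_residue)
  define comm where "comm = (\<lambda>(a, b, c, d). \<exists>t. t \<noteq> 0 \<and>
    commuting n (to_ac \<circ> A) (to_ac \<circ> B) (to_ac a, to_ac b, to_ac c, to_ac d) (to_ac t))"
  have rep: "\<exists>M. f = proj_class KK M \<and> M \<in> carrier (GL2 Ov) \<and> comm M \<and>
      proj_class Fv (residue_mat M) \<in> carrier (Aut_rat Fv (reduction v \<phi>))"
    if f: "f \<in> carrier (Aut_rat KK \<phi>)" for f
  proof -
    obtain a b c d t where "f = proj_class KK (a, b, c, d)" "(a, b, c, d) \<in> carrier (GL2 Ov)"
      "commuting n (to_ac \<circ> A) (to_ac \<circ> B) (to_ac a, to_ac b, to_ac c, to_ac d) (to_ac t)" "t \<noteq> 0"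
      "proj_class Fv (residue_mat (a, b, c, d)) \<in>
        carrier (Aut_rat Fv (rat_frac Fv (residue v \<circ> A) (residue v \<circ> B)))"
      using automorphism_representative[OF low norm good n[unfolded n_def] f[unfolded \<phi>_def]] unfolding n_def .
    thus ?thesis unfolding \<phi>_def reduction_eq[OF low norm] comm_def
      by (intro exI[of _ "(a, b, c, d)"]) auto
  qed
  show "\<forall>f \<in> carrier (Aut_rat KK \<phi>). good_reduction v (moebius KK f)"
    using rep good_reduction_moebius by metis
  have "red v \<in> hom (Aut_rat KK \<phi>) (Aut_rat Fv (reduction v \<phi>))"
  proof (rule homI)
    fix f assume "f \<in> carrier (Aut_rat KK \<phi>)"
    then obtain M where M: "f = proj_class KK M" "M \<in> carrier (GL2 Ov)"
      "proj_class Fv (residue_mat M) \<in> carrier (Aut_rat Fv (reduction v \<phi>))"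
      using rep by metis
    thus "red v f \<in> carrier (Aut_rat Fv (reduction v \<phi>))" using red_proj_class[OF M(2)] by simp
    fix g assume "g \<in> carrier (Aut_rat KK \<phi>)"
    then obtain N where N: "g = proj_class KK N" "N \<in> carrier (GL2 Ov)"
      using rep by metis
    have mult: "x \<otimes>\<^bsub>Aut_rat R \<psi>\<^esub> y = x \<otimes>\<^bsub>PGL2 R\<^esub> y" for R :: "'r ring" and x y \<psi>
      unfolding Aut_rat_def by simp
    have "f \<otimes>\<^bsub>PGL2 KK\<^esub> g = proj_class KK (M \<otimes>\<^bsub>GL2 KK\<^esub> N)"
      unfolding M(1) N(1) using M(2) N(2) by (intro proj_class_mult type_ring_cring GL2_val_ring_subset)
    hence "red v (f \<otimes>\<^bsub>PGL2 KK\<^esub> g) = proj_class Fv (residue_mat M \<otimes>\<^bsub>GL2 Fv\<^esub> residue_mat N)"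
      using red_proj_class[OF residue_mat_mult(2)[OF M(2) N(2)]] residue_mat_mult(1)[OF M(2) N(2)] by simp
    also have "\<dots> = red v f \<otimes>\<^bsub>PGL2 Fv\<^esub> red v g"
      unfolding M(1) N(1) red_proj_class[OF M(2)] red_proj_class[OF N(2)] using M(2) N(2)
      by (intro proj_class_mult[symmetric] residue_cring residue_mat_closed)
    finally show "red v (f \<otimes>\<^bsub>Aut_rat KK \<phi>\<^esub> g) = red v f \<otimes>\<^bsub>Aut_rat Fv (reduction v \<phi>)\<^esub> red v g"
      unfolding Aut_rat_def by simp
  qed
  moreover have "inj_on (red v) (carrier (Aut_rat KK \<phi>))"
  proof (rule inj_onI)
    fix f g assume fg: "f \<in> carrier (Aut_rat KK \<phi>)" "g \<in> carrier (Aut_rat KK \<phi>)" "red v f = red v g"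
    obtain M where M: "f = proj_class KK M" "M \<in> carrier (GL2 Ov)" "comm M" using rep[OF fg(1)] by metis
    obtain N where N: "g = proj_class KK N" "N \<in> carrier (GL2 Ov)" "comm N" using rep[OF fg(2)] by metis
    obtain a b c d where M_eq: "M = (a, b, c, d)" by (cases M)
    obtain a' b' c' d' where N_eq: "N = (a', b', c', d')" by (cases N)
    have Mi: "v a \<le> 1" "v b \<le> 1" "v c \<le> 1" "v d \<le> 1" "v (a * d - b * c) = 1"
      using M(2) unfolding M_eq GL2_val_ring_iff by auto
    have Ni: "v a' \<le> 1" "v b' \<le> 1" "v c' \<le> 1" "v d' \<le> 1" "v (a' * d' - b' * c') = 1"
      using N(2) unfolding N_eq GL2_val_ring_iff by auto
    have "residue_mat M \<in> proj_class Fv (residue_mat N)"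
      using fg(3) proj_class_self[OF residue_cring residue_mat_closed[OF M(2)]]
      unfolding M(1) N(1) red_proj_class[OF M(2)] red_proj_class[OF N(2)] by simp
    then obtain w where w: "w \<in> Units Fv" "residue v a = w \<otimes>\<^bsub>Fv\<^esub> residue v a'" "residue v b = w \<otimes>\<^bsub>Fv\<^esub> residue v b'"
      "residue v c = w \<otimes>\<^bsub>Fv\<^esub> residue v c'" "residue v d = w \<otimes>\<^bsub>Fv\<^esub> residue v d'"
      using residue_mat_closed[OF N(2)] unfolding M_eq N_eq by (auto simp: proj_class_eq[OF residue_cring])
    have "w \<in> carrier Fv" using w(1) by blast
    then obtain u where u: "v u \<le> 1" "w = residue v u" unfolding residue_carrier by blast
    have cong: "v (x - u * y) < 1" if "v x \<le> 1" "v y \<le> 1" "residue v x = w \<otimes>\<^bsub>Fv\<^esub> residue v y" for x y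
      using residue_eq_iff[of x "u * y"] C.H.hom_mult[of u y] that u by (simp add: mult_le_one)
    obtain t where t: "t \<noteq> 0" "commuting n (to_ac \<circ> A) (to_ac \<circ> B) (to_ac a, to_ac b, to_ac c, to_ac d) (to_ac t)"
      using M(3) unfolding comm_def M_eq by auto
    obtain t' where t': "t' \<noteq> 0" "commuting n (to_ac \<circ> A) (to_ac \<circ> B) (to_ac a', to_ac b', to_ac c', to_ac d') (to_ac t')"
      using N(3) unfolding comm_def N_eq by auto
    obtain k where k: "k \<noteq> 0" "a = k * a'" "b = k * b'" "c = k * c'" "d = k * d'"
      by (rule commuting_congruent[OF nf n lowest_terms_no_common_zero[OF low, folded n_def] t(2,1) t'(2,1)
            Mi(1-4) Ni(1-4) u(1) Mi(5) Ni(5)])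
        (use cong Mi Ni w regular in auto)
    have "M \<in> proj_class KK N"
      using GL2_val_ring_subset[OF N(2)] k unfolding M_eq N_eq by (auto simp: proj_class_eq[OF type_ring_cring])
    thus "f = g" unfolding M(1) N(1)
      by (rule proj_class_eqI[OF type_ring_cring GL2_val_ring_subset[OF N(2)]])
  qed
  ultimately show "red v \<in> mon (Aut_rat KK \<phi>) (Aut_rat Fv (reduction v \<phi>))"
    unfolding mon_def by simp
qed

end

theorem proposition1p4:
  fixes \<phi> :: "'k::field_char_0 ratfun" and K :: "'k ring" and d :: nat
  defines "K \<equiv> ring_of_type_algebra"
  assumes "number_field TYPE('k)"
    and "\<phi> \<in> rat_functions K"
    and "rat_degree K \<phi> = d"
    and "d \<ge> 2"
  shows "\<forall>v. finite_place v \<and> v \<notin> exceptional_places \<phi> \<longrightarrow>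
           (\<forall>f \<in> carrier (Aut_rat K \<phi>). good_reduction v (moebius K f)) \<and>
           red v \<in> mon (Aut_rat K \<phi>) (Aut_rat (residue_field v) (reduction v \<phi>))"
proof (intro allI impI)
  fix v :: "'k \<Rightarrow> real"
  assume v: "finite_place v \<and> v \<notin> exceptional_places \<phi>"
  interpret place v using v by unfold_locales simp
  interpret UP_field K "UP K" unfolding K_def by (intro UP_field.intro type_ring_field)
  obtain A0 B0 where "lowest_terms K A0 B0" "\<phi> = rat_frac K A0 B0"
    using rat_functions_lowest[OF R.field_axioms assms(3)] .
  then obtain A B where low: "lowest_terms K A B" and \<phi>: "\<phi> = rat_frac K A B" and norm: "normalized A B"
    using normalized_exists[of A0 B0] unfolding K_def by metis
  have deg: "max (deg K A) (deg K B) = d"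
    using rat_degree_lowest[OF low] assms(4) unfolding \<phi> by simp
  have good: "good_reduction v \<phi>" and regular: "\<And>p. p \<in> S0 TYPE('k) d \<Longrightarrow> \<not> v (of_nat p) < 1"
    using v assms(4) unfolding exceptional_places_def K_def by auto
  show "(\<forall>f \<in> carrier (Aut_rat K \<phi>). good_reduction v (moebius K f)) \<and>
      red v \<in> mon (Aut_rat K \<phi>) (Aut_rat (residue_field v) (reduction v \<phi>))"
    using red_mon[OF assms(2) low[unfolded K_def] norm good[unfolded \<phi> K_def]] deg assms(5) regular
    unfolding \<phi> K_def by auto
qed

end
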